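(* Let $G=(V,E)$ be a directed unweighted graph with $n$ vertices whose $(s,t)$-max-flow has value $\lambda$. Then one can compute in polynomial time a family $\mathcal{B}$ of $2\lambda+1$ $(s,t)$-flows in $G$ such that (1) for each edge $e$, $\mathcal{B}$ contains an $(s,t)$-max-flow of $G-e$; and (2) any two flows $f,f'\in\mathcal{B}$ disagree (i.e., $f(x)\ne f'(x)$) on at most $O(n)$ edges $x$.
   Context: Edges have unit capacity (multigraphs allowed). $G-e$ is the graph obtained by deleting edge $e$. *)

theory Defs
  imports "Graph_Theory.Digraph" "HOL-Computational_Algebra.Polynomial" Complex_Main
begin

text \<open>All arcs have capacity 1. A flow vanishes outside the arcs of its graph, so that a flow of
  \<open>G - e\<close> is the same thing as a flow of \<open>G\<close> that is \<open>0\<close> on \<open>e\<close>.\<close>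

definition st_flow :: "('v, 'e) pre_digraph \<Rightarrow> 'v \<Rightarrow> 'v \<Rightarrow> ('e \<Rightarrow> real) \<Rightarrow> bool" where
  "st_flow G s t f \<longleftrightarrow>
     (\<forall>e \<in> arcs G. 0 \<le> f e \<and> f e \<le> 1) \<and>
     (\<forall>e. e \<notin> arcs G \<longrightarrow> f e = 0) \<and>
     (\<forall>v \<in> verts G - {s, t}. (\<Sum>e \<in> in_arcs G v. f e) = (\<Sum>e \<in> out_arcs G v. f e))"

definition flow_value :: "('v, 'e) pre_digraph \<Rightarrow> 'v \<Rightarrow> ('e \<Rightarrow> real) \<Rightarrow> real" where
  "flow_value G s f = (\<Sum>e \<in> out_arcs G s. f e) - (\<Sum>e \<in> in_arcs G s. f e)"

definition st_max_flow :: "('v, 'e) pre_digraph \<Rightarrow> 'v \<Rightarrow> 'v \<Rightarrow> ('e \<Rightarrow> real) \<Rightarrow> bool" where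
  "st_max_flow G s t f \<longleftrightarrow>
     st_flow G s t f \<and> (\<forall>g. st_flow G s t g \<longrightarrow> flow_value G s g \<le> flow_value G s f)"


text \<open>Computation model: a first-order, call-by-value functional language with general
  recursion over binary trees, in the style of the languages F and WHILE of N. D. Jones
  (Computability and Complexity, 1997). Every evaluation rule costs one time unit. Trees can be
  represented by shared pointers, so that each rule takes constant time on a pointer machine and
  running times agree with those of Turing machines up to a polynomial.\<close>

datatype dat = Leaf | Node dat dat

text \<open>Variables are de Bruijn indices into the environment; \<open>Call i es\<close> calls the
  \<open>i\<close>-th function of the program.\<close>

datatype exp =
    Var nat
  | LeafE
  | NodeE exp exp
  | Left exp
  | Right exp
  | IfLeaf exp exp exp
  | LetE exp exp
  | Call nat "exp list"

text \<open>A program is the finite list of its function bodies.\<close>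

type_synonym program = "exp list"

fun left_of :: "dat \<Rightarrow> dat" where
  "left_of Leaf = Leaf"
| "left_of (Node a b) = a"

fun right_of :: "dat \<Rightarrow> dat" where
  "right_of Leaf = Leaf"
| "right_of (Node a b) = b"

text \<open>\<open>eval P \<sigma> e v k\<close>: under the environment \<open>\<sigma>\<close>, the expression \<open>e\<close> evaluates to
  \<open>v\<close> in time \<open>k\<close>.\<close>

inductive eval :: "program \<Rightarrow> dat list \<Rightarrow> exp \<Rightarrow> dat \<Rightarrow> nat \<Rightarrow> bool"
  and evals :: "program \<Rightarrow> dat list \<Rightarrow> exp list \<Rightarrow> dat list \<Rightarrow> nat \<Rightarrow> bool"
  for P :: program
where
  Var: "i < length \<sigma> \<Longrightarrow> eval P \<sigma> (Var i) (\<sigma> ! i) 1"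
| LeafE: "eval P \<sigma> LeafE Leaf 1"
| NodeE: "eval P \<sigma> e1 v1 k1 \<Longrightarrow> eval P \<sigma> e2 v2 k2 \<Longrightarrow>
    eval P \<sigma> (NodeE e1 e2) (Node v1 v2) (k1 + k2 + 1)"
| Left: "eval P \<sigma> e v k \<Longrightarrow> eval P \<sigma> (Left e) (left_of v) (k + 1)"
| Right: "eval P \<sigma> e v k \<Longrightarrow> eval P \<sigma> (Right e) (right_of v) (k + 1)"
| If_Leaf: "eval P \<sigma> e Leaf k \<Longrightarrow> eval P \<sigma> e1 v k1 \<Longrightarrow>
    eval P \<sigma> (IfLeaf e e1 e2) v (k + k1 + 1)"
| If_Node: "eval P \<sigma> e (Node a b) k \<Longrightarrow> eval P \<sigma> e2 v k2 \<Longrightarrow>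
    eval P \<sigma> (IfLeaf e e1 e2) v (k + k2 + 1)"
| LetE: "eval P \<sigma> e1 v1 k1 \<Longrightarrow> eval P (v1 # \<sigma>) e2 v2 k2 \<Longrightarrow>
    eval P \<sigma> (LetE e1 e2) v2 (k1 + k2 + 1)"
| Call: "evals P \<sigma> es vs k \<Longrightarrow> i < length P \<Longrightarrow> eval P vs (P ! i) v k' \<Longrightarrow>
    eval P \<sigma> (Call i es) v (k + k' + 1)"
| Empty: "evals P \<sigma> [] [] 1"
| More: "eval P \<sigma> e v k \<Longrightarrow> evals P \<sigma> es vs k' \<Longrightarrow>
    evals P \<sigma> (e # es) (v # vs) (k + k' + 1)"

inductive_cases eval_elims:
  "eval P \<sigma> (Var i) v k"
  "eval P \<sigma> LeafE v k"
  "eval P \<sigma> (NodeE e1 e2) v k"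
  "eval P \<sigma> (Left e) v k"
  "eval P \<sigma> (Right e) v k"
  "eval P \<sigma> (IfLeaf e e1 e2) v k"
  "eval P \<sigma> (LetE e1 e2) v k"
  "eval P \<sigma> (Call i es) v k"
  "evals P \<sigma> [] vs k"
  "evals P \<sigma> (e # es) vs k"

lemma eval_deterministic:
  "eval P \<sigma> e v k \<Longrightarrow> \<forall>v' k'. eval P \<sigma> e v' k' \<longrightarrow> v' = v \<and> k' = k"
  "evals P \<sigma> es vs l \<Longrightarrow> \<forall>vs' l'. evals P \<sigma> es vs' l' \<longrightarrow> vs' = vs \<and> l' = l"
proof (induction rule: eval_evals.inducts)
qed (intro allI impI, (erule eval_elims; (metis dat.distinct(1) Suc_eq_plus1 One_nat_def)))+

text \<open>The main function of a program is its first one.\<close>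

definition runs :: "program \<Rightarrow> dat \<Rightarrow> dat \<Rightarrow> nat \<Rightarrow> bool" where
  "runs P inp out k \<longleftrightarrow> eval P [inp] (Call 0 [Var 0]) out k"


text \<open>Numbers are written in unary. For vertex numbers this changes the size of an instance only
  by a factor polynomial in the number of vertices and arcs.\<close>

fun enc_nat :: "nat \<Rightarrow> dat" where
  "enc_nat 0 = Leaf"
| "enc_nat (Suc n) = Node Leaf (enc_nat n)"

fun enc_list :: "('x \<Rightarrow> dat) \<Rightarrow> 'x list \<Rightarrow> dat" where
  "enc_list enc [] = Leaf"
| "enc_list enc (x # xs) = Node (enc x) (enc_list enc xs)"

definition enc_pair :: "('x \<Rightarrow> dat) \<Rightarrow> ('y \<Rightarrow> dat) \<Rightarrow> 'x \<times> 'y \<Rightarrow> dat" where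
  "enc_pair enc1 enc2 p = Node (enc1 (fst p)) (enc2 (snd p))"

text \<open>An algorithm receives \<open>G\<close> through a numbering \<open>num\<close> of its vertices by
  \<open>0, \<dots>, n - 1\<close> and a listing \<open>es\<close> of its arcs.\<close>

definition graph_presentation ::
    "('v, 'e) pre_digraph \<Rightarrow> ('v \<Rightarrow> nat) \<Rightarrow> 'e list \<Rightarrow> bool" where
  "graph_presentation G num es \<longleftrightarrow>
     bij_betw num (verts G) {..<card (verts G)} \<and> distinct es \<and> set es = arcs G"

definition enc_instance ::
    "('v, 'e) pre_digraph \<Rightarrow> ('v \<Rightarrow> nat) \<Rightarrow> 'e list \<Rightarrow> 'v \<Rightarrow> 'v \<Rightarrow> dat" where
  "enc_instance G num es s t =
     Node (enc_nat (card (verts G)))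
       (Node (enc_list (\<lambda>e. Node (enc_nat (num (tail G e))) (enc_nat (num (head G e)))) es)
         (Node (enc_nat (num s)) (enc_nat (num t))))"

text \<open>A flow is output as the list of its values on \<open>es\<close>, each written as a fraction.\<close>

definition fractions_of_flow :: "'e list \<Rightarrow> ('e \<Rightarrow> real) \<Rightarrow> (nat \<times> nat) list \<Rightarrow> bool" where
  "fractions_of_flow es f qs \<longleftrightarrow>
     list_all2 (\<lambda>e q. 0 < snd q \<and> f e = real (fst q) / real (snd q)) es qs"

definition encodes_flows :: "'e list \<Rightarrow> ('e \<Rightarrow> real) list \<Rightarrow> dat \<Rightarrow> bool" where
  "encodes_flows es B d \<longleftrightarrow>
     (\<exists>qss. list_all2 (fractions_of_flow es) B qss \<and>
            d = enc_list (enc_list (enc_pair enc_nat enc_nat)) qss)"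

end

theory Submission
  imports Defs
begin

text \<open>Call an arc critical if it lies in some minimum cut, and let \<open>k\<close> be the value of a maximum
  flow. Give critical arcs the capacity \<open>k + 1\<close> and all others the capacity \<open>k\<close>. A cut with a
  non-critical arc has at least \<open>k + 1\<close> arcs, so every cut has capacity at least \<open>k (k + 1)\<close> and
  there is an integral flow \<open>h\<close> of this value. By the integer
  decomposition property, \<open>h\<close> is a sum of \<open>k + 1\<close> maximum flows, and every non-critical arc is
  missed by one of them. Removing from one of these flows each of its \<open>k\<close> paths in turn serves the critical
  arcs.

  To keep the flows close to each other, undirected cycles of arcs on which \<open>h\<close> is strictly between
  \<open>0\<close> and the capacity are cancelled, so that these arcs form a forest. On the remaining arcs that
  \<open>h\<close> uses, each of the \<open>k + 1\<close> flows misses \<open>O(n)\<close> arcs, provided none of the flows is much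
  shorter than the average. The flows are split off one by one by rounding \<open>h / (k + 1)\<close>,
  \<open>(h - f) / k\<close>, and so on, where rounding is again cancelling of cycles: once the arcs with
  fractional flow form a forest, there are none. Choosing the direction in which the cycles are
  cancelled keeps the lengths under control.

  The running time is polynomial because polynomial-time computable functions are closed under
  composition, and under iteration as long as the intermediate results stay polynomially
  bounded.\<close>

section \<open>Polynomial-time functions on encoded data\<close>

text \<open>Closeness is measured against one reference, the indicator of the arcs that
  \<open>h\<close> saturates. Each of the flows vanishes where \<open>h\<close> does, and at most
  \<open>n\<close> arcs are strictly between 0 and the capacity, so a flow that is not
  \<open>O(n)\<close> shorter than the number \<open>sat\<close> of saturated arcs misses only
  \<open>O(n)\<close> of them. Such lengths can be attained on average: \<open>h\<close> is at least
  \<open>k\<close> on every saturated arc, so the average length is at least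
  \<open>sat - sat / (k + 1)\<close>, and \<open>sat \<le> (k + 1) n\<close> because
  \<open>h\<close> arises from \<open>k (k + 1)\<close> augmentations along simple paths and hence
  has total length at most \<open>k (k + 1) n\<close>. This is why lengths are tracked from the
  first augmentation on. The final constant is \<open>12 = 2 (5 + 1)\<close>: per flow
  \<open>2 n\<close> for the arcs in between, \<open>2 n\<close> for the lowered target and
  \<open>n\<close> for the rounding, and one more \<open>n\<close> for a removed path.

  Fractions never occur: \<open>h / k\<close> is represented by \<open>h\<close> with all capacities
  equal to \<open>k\<close>. The functions are total, and their time bounds have to hold on
  meaningless inputs too, so sizes are controlled by invariants that do not presuppose a
  flow.\<close>

class encodable =
  fixes repr :: "'a \<Rightarrow> dat"

instantiation nat :: encodable
begin
definition repr_nat where "repr_nat = enc_nat"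
instance ..
end

instantiation unit :: encodable
begin
definition repr_unit :: "unit \<Rightarrow> dat" where "repr_unit _ = Leaf"
instance ..
end

text \<open>Different types share trees on purpose: a number is the tree of a list of units,
  \<open>True\<close> that of \<open>[()]\<close>, and \<open>x # xs\<close> that of
  \<open>(x, xs)\<close>. Passing from one to the other is then the identity on trees, so that case
  distinction on lists provides the one on numbers and booleans.\<close>

instantiation bool :: encodable
begin
definition repr_bool where "repr_bool b = (if b then Node Leaf Leaf else Leaf)"
instance ..
end

instantiation list :: (encodable) encodable
begin
definition repr_list where "repr_list = enc_list repr"
instance ..
end

instantiation prod :: (encodable, encodable) encodable
begin
definition repr_prod where "repr_prod = enc_pair repr repr"
instance ..
end

lemma repr_simps [simp]:
  "repr (0::nat) = Leaf" "repr (Suc n) = Node Leaf (repr n)"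
  "repr u = Leaf" "repr True = Node Leaf Leaf" "repr False = Leaf"
  "repr [] = Leaf" "repr (x # xs) = Node (repr x) (repr xs)"
  "repr (a, b) = Node (repr a) (repr b)"
  for u :: unit
  by (simp_all add: repr_nat_def repr_unit_def repr_bool_def repr_list_def repr_prod_def enc_pair_def)

abbreviation rsize :: "'a::encodable \<Rightarrow> nat" where
  "rsize x \<equiv> size (repr x)"

lemma rsize_nat [simp]: "rsize (n::nat) = n"
  by (induction n) auto

lemma rsize_list: "rsize xs = (\<Sum>x\<leftarrow>xs. Suc (rsize x))"
  by (induction xs) auto

lemma rsize_append [simp]: "rsize (xs @ ys) = rsize xs + rsize ys"
  by (simp add: rsize_list)

lemma length_le_rsize: "length xs \<le> rsize xs"
  by (induction xs) auto

lemma rsize_mem_less: "x \<in> set xs \<Longrightarrow> rsize x < rsize xs"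
  by (induction xs) auto

lemma rsize_list_le: "(\<And>x. x \<in> set xs \<Longrightarrow> rsize x \<le> b) \<Longrightarrow> rsize xs \<le> length xs * Suc b"
proof (induction xs)
  case (Cons x xs)
  then have "rsize xs \<le> length xs * Suc b" "rsize x \<le> b" by auto
  then show ?case by simp
qed simp

section \<open>Polynomial bounds\<close>

definition polybound :: "(nat \<Rightarrow> nat) \<Rightarrow> bool" where
  "polybound g \<longleftrightarrow> (\<exists>c. \<forall>n. g n \<le> (n + 2) ^ c)"

lemma polyboundI: "(\<And>n. g n \<le> (n + 2) ^ c) \<Longrightarrow> polybound g"
  by (auto simp: polybound_def)

lemma polybound_mono: "polybound g \<Longrightarrow> (\<And>n. f n \<le> g n) \<Longrightarrow> polybound f"
  unfolding polybound_def by (meson order_trans)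

text \<open>The base \<open>n + 2\<close> never drops below 2, so that constants and sums are
  absorbed by a larger exponent even at \<open>n = 0\<close>.\<close>

lemma polybound_const: "polybound (\<lambda>n. c)"
proof (rule polyboundI)
  fix n :: nat
  have "c \<le> 2 ^ c" by (simp add: less_imp_le)
  also have "\<dots> \<le> (n + 2) ^ c" by (simp add: power_mono)
  finally show "c \<le> (n + 2) ^ c" .
qed

lemma polybound_id: "polybound (\<lambda>n. n)"
  by (rule polyboundI[where c = 1]) simp

lemma polybound_mult:
  assumes "polybound f" "polybound g"
  shows "polybound (\<lambda>n. f n * g n)"
proof -
  obtain c d where "\<And>n. f n \<le> (n + 2) ^ c" "\<And>n. g n \<le> (n + 2) ^ d"
    using assms unfolding polybound_def by blast
  then show ?thesis
    by (intro polyboundI[where c = "c + d"]) (simp add: power_add mult_mono)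
qed

lemma polybound_add:
  assumes "polybound f" "polybound g"
  shows "polybound (\<lambda>n. f n + g n)"
proof (rule polybound_mono)
  show "polybound (\<lambda>n. (f n + 1) * (g n + 1))"
  proof (rule polybound_mult)
    have *: "polybound (\<lambda>n. h n + 1)" if h: "polybound h" for h
    proof -
      obtain c where c: "\<And>n. h n \<le> (n + 2) ^ c"
        using h unfolding polybound_def by auto
      have "h n + 1 \<le> (n + 2) ^ Suc c" for n
      proof -
        have "1 \<le> (n + 2) ^ c" by simp
        then have "h n + 1 \<le> 2 * (n + 2) ^ c" using c[of n] by linarith
        also have "\<dots> \<le> (n + 2) ^ Suc c" by simp
        finally show ?thesis .
      qed
      then show ?thesis by (rule polyboundI)
    qed
    show "polybound (\<lambda>n. f n + 1)" "polybound (\<lambda>n. g n + 1)"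
      by (fact *[OF assms(1)], fact *[OF assms(2)])
  qed
qed simp

lemma polybound_power: "polybound f \<Longrightarrow> polybound (\<lambda>n. f n ^ c)"
  by (induction c) (auto intro: polybound_const polybound_mult)

lemmas polybound_intros =
  polybound_const polybound_id polybound_mult polybound_add polybound_power

section \<open>Joining programs, with the calls of the later one relocated\<close>

fun shift :: "nat \<Rightarrow> exp \<Rightarrow> exp" where
  "shift q (Var i) = Var i"
| "shift q LeafE = LeafE"
| "shift q (NodeE a b) = NodeE (shift q a) (shift q b)"
| "shift q (Left a) = Left (shift q a)"
| "shift q (Right a) = Right (shift q a)"
| "shift q (IfLeaf a b c) = IfLeaf (shift q a) (shift q b) (shift q c)"
| "shift q (LetE a b) = LetE (shift q a) (shift q b)"
| "shift q (Call i es) = Call (q + i) (map (shift q) es)"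

lemma shift_0 [simp]: "shift 0 e = e"
proof (induction "0::nat" e rule: shift.induct)
qed (auto simp: map_idI)

lemma eval_shift:
  "eval P \<sigma> e v k \<Longrightarrow> eval (Q @ map (shift (length Q)) P @ R) \<sigma> (shift (length Q) e) v k"
  "evals P \<sigma> es vs k \<Longrightarrow>
     evals (Q @ map (shift (length Q)) P @ R) \<sigma> (map (shift (length Q)) es) vs k"
proof (induction rule: eval_evals.inducts)
  case (Call \<sigma> es vs k i v k')
  have "(Q @ map (shift (length Q)) P @ R) ! (length Q + i) = shift (length Q) (P ! i)"
    using Call by (simp add: nth_append)
  then show ?case
    using eval_evals.Call[where P = "Q @ map (shift (length Q)) P @ R" and i = "length Q + i"] Call
    by simp
qed (unfold shift.simps list.map, (blast intro: eval_evals.intros)+)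

text \<open>The size of the result has a bound of its own because the running time does not provide
  one: values are shared, so a recursion that repeatedly forms \<open>NodeE (Var 0) (Var 0)\<close>
  builds a tree of exponential size in linear time.\<close>

definition realizes ::
    "program \<Rightarrow> nat \<Rightarrow> ('a::encodable \<Rightarrow> 'b::encodable) \<Rightarrow> nat \<Rightarrow> bool" where
  "realizes P i f c \<longleftrightarrow> i < length P \<and>
     (\<forall>x. (\<exists>k \<le> (rsize x + 2) ^ c. eval P [repr x] (P ! i) (repr (f x)) k) \<and>
        rsize (f x) \<le> (rsize x + 2) ^ c)"

definition ptime :: "('a::encodable \<Rightarrow> 'b::encodable) \<Rightarrow> bool" where
  "ptime f \<longleftrightarrow> (\<exists>P i c. realizes P i f c)"

named_theorems ptime_intros

lemma realizes_shift:
  assumes "realizes P i f c"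
  shows "realizes (Q @ map (shift (length Q)) P @ R) (length Q + i) f c"
proof -
  have "(Q @ map (shift (length Q)) P @ R) ! (length Q + i) = shift (length Q) (P ! i)"
    using assms by (simp add: nth_append realizes_def)
  then show ?thesis
    using assms unfolding realizes_def by (auto intro: eval_shift)
qed

lemma realizes_append: "realizes P i f c \<Longrightarrow> realizes (P @ R) i f c"
  using realizes_shift[of P i f c "[]" R] by (simp add: map_idI)

text \<open>With a second function placed behind a given program, one new body can call
  both.\<close>

lemma ptime_extend:
  assumes "ptime f"
  obtains R i c where "realizes (P @ R) i f c"
  using assms realizes_shift[where R = "[]" and Q = P] unfolding ptime_def by fastforce

lemma realizes_call:
  assumes "realizes P i f c" "eval P \<sigma> e (repr x) k"
  shows "\<exists>k' \<le> k + (rsize x + 2) ^ c + 3. eval P \<sigma> (Call i [e]) (repr (f x)) k'"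
proof -
  obtain k1 where k1: "k1 \<le> (rsize x + 2) ^ c" "eval P [repr x] (P ! i) (repr (f x)) k1"
    using assms(1) unfolding realizes_def by blast
  have "i < length P" using assms(1) by (simp add: realizes_def)
  from eval_evals.Call[OF eval_evals.More[OF assms(2) eval_evals.Empty] this k1(2)]
  have "eval P \<sigma> (Call i [e]) (repr (f x)) ((k + 1 + 1) + k1 + 1)" .
  then show ?thesis using k1(1) by (intro exI[of _ "(k + 1 + 1) + k1 + 1"]) simp
qed

lemma realizes_size: "realizes P i f c \<Longrightarrow> rsize (f x) \<le> (rsize x + 2) ^ c"
  by (simp add: realizes_def)

lemma eval_Var0: "eval P (v # \<sigma>) (Var 0) v 1"
  using eval_evals.Var[of 0 "v # \<sigma>" P] by simp

lemma eval_Var1: "eval P (u # v # \<sigma>) (Var 1) v 1"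
  using eval_evals.Var[of 1 "u # v # \<sigma>" P] by simp

lemma eval_Var2: "eval P (u # v # w # \<sigma>) (Var 2) w 1"
  using eval_evals.Var[of 2 "u # v # w # \<sigma>" P] by simp

lemma realizes_call0:
  "realizes P i f c \<Longrightarrow>
    \<exists>k \<le> (rsize x + 2) ^ c + 4. eval P (repr x # \<sigma>) (Call i [Var 0]) (repr (f x)) k"
  using realizes_call[OF _ eval_Var0, of P i f c x \<sigma>] by (simp add: add.commute)

lemma realizes_call1:
  "realizes P i f c \<Longrightarrow>
    \<exists>k \<le> (rsize x + 2) ^ c + 4. eval P (u # repr x # \<sigma>) (Call i [Var 1]) (repr (f x)) k"
  using realizes_call[OF _ eval_Var1, where c = c and f = f and x = x]
  by (simp add: add.commute)

lemma ptime_body: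
  assumes eval: "\<And>x. \<exists>k \<le> T (rsize x). eval (P @ e # R) [repr x] e (repr (f x)) k"
    and size: "\<And>x. rsize (f x) \<le> S (rsize x)"
    and "polybound T" "polybound S"
  shows "ptime f"
proof -
  obtain c where c: "\<And>n. T n + S n \<le> (n + 2) ^ c"
    using polybound_add[OF assms(3,4)] unfolding polybound_def by blast
  have "\<exists>k \<le> (rsize x + 2) ^ c. eval (P @ e # R) [repr x] e (repr (f x)) k" for x
    using eval[of x] c[of "rsize x"] by (meson add_leE order_trans)
  moreover have "rsize (f x) \<le> (rsize x + 2) ^ c" for x
    using size[of x] c[of "rsize x"] by linarith
  ultimately have "realizes (P @ e # R) (length P) f c"
    by (auto simp: realizes_def)
  then show ?thesis unfolding ptime_def by blast
qed

section \<open>Elementary functions and case distinction\<close>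

lemma ptime_coerce:
  assumes "\<And>x. repr (f x) = repr x"
  shows "ptime f"
proof (rule ptime_body[where P = "[]" and R = "[]" and e = "Var 0"])
  show "\<exists>k \<le> 1. eval ([] @ Var 0 # []) [repr x] (Var 0) (repr (f x)) k" for x
    using eval_Var0 by (auto simp: assms)
  show "rsize (f x) \<le> rsize x" for x by (simp add: assms)
qed (intro polybound_intros)+

lemma ptime_id [ptime_intros]: "ptime (\<lambda>x. x)"
  by (rule ptime_coerce) simp

lemma ptime_comp:
  assumes "ptime f" "ptime g"
  shows "ptime (\<lambda>x. f (g x))"
proof -
  obtain P i c where f: "realizes P i f c"
    using assms(1) unfolding ptime_def by blast
  obtain Q j d where g: "realizes (P @ Q) j g d"
    using ptime_extend[OF assms(2)] by blast
  let ?e = "Call i [Call j [Var 0]]"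
  let ?P = "(P @ Q) @ ?e # []"
  have f': "realizes ?P i f c" and g': "realizes ?P j g d"
    using realizes_append[OF f] realizes_append[OF g] by auto
  show ?thesis
  proof (rule ptime_body)
    fix x
    let ?T = "\<lambda>n::nat. ((n + 2) ^ d + 4) + ((n + 2) ^ d + 2) ^ c + 3"
    have size: "(rsize (g x) + 2) ^ c \<le> ((rsize x + 2) ^ d + 2) ^ c"
      using realizes_size[OF g, of x] by (simp add: power_mono)
    obtain k1 where k1: "k1 \<le> (rsize x + 2) ^ d + 4"
        "eval ?P [repr x] (Call j [Var 0]) (repr (g x)) k1"
      using realizes_call0[OF g', of x "[]"] by blast
    obtain k2 where k2: "k2 \<le> k1 + (rsize (g x) + 2) ^ c + 3"
        "eval ?P [repr x] ?e (repr (f (g x))) k2"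
      using realizes_call[OF f' k1(2)] by blast
    have "k2 \<le> ?T (rsize x)" using k2(1) k1(1) size by linarith
    then show "\<exists>k \<le> ?T (rsize x). eval ?P [repr x] ?e (repr (f (g x))) k"
      using k2(2) by blast
    show "rsize (f (g x)) \<le> ((rsize x + 2) ^ d + 2) ^ c"
      using realizes_size[OF f, of "g x"] size by linarith
  qed (intro polybound_intros)+
qed

lemma ptime_Pair [ptime_intros]:
  assumes "ptime f" "ptime g"
  shows "ptime (\<lambda>x. (f x, g x))"
proof -
  obtain P i c where f: "realizes P i f c"
    using assms(1) unfolding ptime_def by blast
  obtain Q j d where g: "realizes (P @ Q) j g d"
    using ptime_extend[OF assms(2)] by blast
  let ?e = "NodeE (Call i [Var 0]) (Call j [Var 0])"
  let ?P = "(P @ Q) @ ?e # []"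
  have f': "realizes ?P i f c" and g': "realizes ?P j g d"
    using realizes_append[OF f] realizes_append[OF g] by auto
  show ?thesis
  proof (rule ptime_body)
    fix x
    let ?T = "\<lambda>n::nat. ((n + 2) ^ c + 4) + ((n + 2) ^ d + 4) + 1"
    obtain k1 where k1: "k1 \<le> (rsize x + 2) ^ c + 4"
        "eval ?P [repr x] (Call i [Var 0]) (repr (f x)) k1"
      using realizes_call0[OF f', of x "[]"] by blast
    obtain k2 where k2: "k2 \<le> (rsize x + 2) ^ d + 4"
        "eval ?P [repr x] (Call j [Var 0]) (repr (g x)) k2"
      using realizes_call0[OF g', of x "[]"] by blast
    have "eval ?P [repr x] ?e (repr (f x, g x)) (k1 + k2 + 1)"
      using eval_evals.NodeE[OF k1(2) k2(2)] by simp
    moreover have "k1 + k2 + 1 \<le> ?T (rsize x)" using k1 k2 by simp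
    ultimately show "\<exists>k \<le> ?T (rsize x). eval ?P [repr x] ?e (repr (f x, g x)) k"
      by blast
    show "rsize (f x, g x) \<le> (rsize x + 2) ^ c + (rsize x + 2) ^ d + 1"
      using realizes_size[OF f, of x] realizes_size[OF g, of x] by simp
  qed (intro polybound_intros)+
qed

lemma ptime_fst': "ptime (fst :: 'a::encodable \<times> 'b::encodable \<Rightarrow> 'a)"
proof (rule ptime_body[where P = "[]" and R = "[]" and e = "Left (Var 0)"])
  show "\<exists>k \<le> 2. eval ([] @ Left (Var 0) # []) [repr x] (Left (Var 0)) (repr (fst x)) k"
    for x :: "'a \<times> 'b"
    using eval_evals.Left[OF eval_Var0[of "[Left (Var 0)]" "repr x" "[]"]]
    by (cases x) (auto simp: numeral_2_eq_2)
  show "rsize (fst x) \<le> rsize x" for x :: "'a \<times> 'b" by (cases x) auto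
qed (intro polybound_intros)+

lemma ptime_snd': "ptime (snd :: 'a::encodable \<times> 'b::encodable \<Rightarrow> 'b)"
proof (rule ptime_body[where P = "[]" and R = "[]" and e = "Right (Var 0)"])
  show "\<exists>k \<le> 2. eval ([] @ Right (Var 0) # []) [repr x] (Right (Var 0)) (repr (snd x)) k"
    for x :: "'a \<times> 'b"
    using eval_evals.Right[OF eval_Var0[of "[Right (Var 0)]" "repr x" "[]"]]
    by (cases x) (auto simp: numeral_2_eq_2)
  show "rsize (snd x) \<le> rsize x" for x :: "'a \<times> 'b" by (cases x) auto
qed (intro polybound_intros)+

lemmas ptime_fst [ptime_intros] = ptime_comp[OF ptime_fst']
lemmas ptime_snd [ptime_intros] = ptime_comp[OF ptime_snd']

lemma ptime_const [ptime_intros]: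
  fixes c :: "'b::encodable"
  shows "ptime (\<lambda>x::'a::encodable. c)"
proof -
  have "\<exists>e k. \<forall>P \<sigma>. eval P \<sigma> e d k" for d
  proof (induction d)
    case Leaf
    show ?case by (rule exI[of _ LeafE]) (auto intro: eval_evals.intros)
  next
    case (Node d1 d2)
    then obtain e1 k1 e2 k2 where "\<forall>P \<sigma>. eval P \<sigma> e1 d1 k1" "\<forall>P \<sigma>. eval P \<sigma> e2 d2 k2"
      by blast
    then have "\<forall>P \<sigma>. eval P \<sigma> (NodeE e1 e2) (Node d1 d2) (k1 + k2 + 1)"
      using eval_evals.NodeE by blast
    then show ?case by blast
  qed
  then obtain e k where e: "\<And>P \<sigma>. eval P \<sigma> e (repr c) k" by blast
  show ?thesis
  proof (rule ptime_body[where P = "[]" and R = "[]" and e = e])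
    show "\<exists>l \<le> k. eval ([] @ e # []) [repr x] e (repr c) l" for x :: 'a
      using e by blast
    show "rsize c \<le> rsize c" by simp
  qed (intro polybound_intros)+
qed

text \<open>Functions of several arguments are treated as functions of a nested pair. They are
  written with \<open>fst\<close> and \<open>snd\<close>, so that the premise for a concrete
  \<open>g\<close> is again solved by the rules for projections.\<close>

lemma ptime_case_list [ptime_intros]:
  fixes l :: "'a::encodable \<Rightarrow> 'b::encodable list" and f :: "'a \<Rightarrow> 'c::encodable"
  assumes "ptime l" "ptime f" "ptime (\<lambda>z. g (fst z) (fst (snd z)) (snd (snd z)))"
  shows "ptime (\<lambda>x. case l x of [] \<Rightarrow> f x | y # ys \<Rightarrow> g x y ys)"
proof -
  let ?g = "\<lambda>z. g (fst z) (fst (snd z)) (snd (snd z))"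
  obtain P i c where l: "realizes P i l c"
    using assms(1) unfolding ptime_def by blast
  obtain Q j d where f: "realizes (P @ Q) j f d"
    using ptime_extend[OF assms(2)] by blast
  obtain R m b where g: "realizes ((P @ Q) @ R) m ?g b"
    using ptime_extend[OF assms(3)] by blast
  let ?e = "LetE (Call i [Var 0])
    (IfLeaf (Var 0) (Call j [Var 1]) (Call m [NodeE (Var 1) (Var 0)]))"
  let ?P = "((P @ Q) @ R) @ ?e # []"
  have l': "realizes ?P i l c" and f': "realizes ?P j f d"
    and g': "realizes ?P m ?g b"
    using realizes_append[OF l, of "Q @ R @ ?e # []"] realizes_append[OF f, of "R @ ?e # []"]
      realizes_append[OF g] by simp_all
  let ?h = "\<lambda>x. case l x of [] \<Rightarrow> f x | y # ys \<Rightarrow> g x y ys"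
  show ?thesis
  proof (rule ptime_body)
    fix x
    let ?S = "\<lambda>n::nat. (n + 2) ^ d + (n + (n + 2) ^ c + 3) ^ b"
    let ?T = "\<lambda>n::nat. (n + 2) ^ c + ?S n + 20"
    have ls: "rsize (l x) \<le> (rsize x + 2) ^ c"
      using realizes_size[OF l, of x] by simp
    obtain k1 where k1: "k1 \<le> (rsize x + 2) ^ c + 4"
        "eval ?P [repr x] (Call i [Var 0]) (repr (l x)) k1"
      using realizes_call0[OF l', of x "[]"] by blast
    have "(\<exists>k \<le> ?T (rsize x). eval ?P [repr x] ?e (repr (?h x)) k) \<and> rsize (?h x) \<le> ?S (rsize x)"
    proof (cases "l x")
      case Nil
      obtain k2 where k2: "k2 \<le> (rsize x + 2) ^ d + 4"
          "eval ?P [Leaf, repr x] (Call j [Var 1]) (repr (f x)) k2"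
        using realizes_call1[OF f', of x Leaf "[]"] by blast
      have "eval ?P [repr x] ?e (repr (f x)) (k1 + (1 + k2 + 1) + 1)"
        using eval_evals.LetE[OF _ eval_evals.If_Leaf[OF eval_Var0 k2(2)]] k1(2) Nil by simp
      moreover have "k1 + (1 + k2 + 1) + 1 \<le> ?T (rsize x)" using k1(1) k2(1) by simp
      ultimately show ?thesis
        using Nil realizes_size[OF f, of x] by (auto intro!: exI[of _ "k1 + (1 + k2 + 1) + 1"])
    next
      case (Cons y ys)
      have s: "rsize (x, y, ys) = rsize x + rsize (l x) + 1" using Cons by simp
      have "(rsize (x, y, ys) + 2) ^ b \<le> (rsize x + (rsize x + 2) ^ c + 3) ^ b"
        by (rule power_mono) (use s ls in linarith, simp)
      then have sb: "(rsize (x, y, ys) + 2) ^ b \<le> ?S (rsize x)" by linarith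
      \<comment> \<open>The tree of \<open>y # ys\<close> is also that of \<open>(y, ys)\<close>, so
        the whole list is handed over without taking it apart.\<close>
      have "eval ?P [repr (l x), repr x] (NodeE (Var 1) (Var 0)) (repr (x, y, ys)) (1 + 1 + 1)"
        using Cons eval_evals.NodeE[OF eval_Var1 eval_Var0] by simp
      from realizes_call[OF g' this] obtain k2 where
        k2: "k2 \<le> (1 + 1 + 1) + (rsize (x, y, ys) + 2) ^ b + 3"
          "eval ?P [repr (l x), repr x] (Call m [NodeE (Var 1) (Var 0)]) (repr (g x y ys)) k2"
        unfolding fst_conv snd_conv by blast
      have "eval ?P [repr (l x), repr x] (Var 0) (Node (repr y) (repr ys)) 1"
        using Cons eval_Var0 by simp
      then have "eval ?P [repr x] ?e (repr (g x y ys)) (k1 + (1 + k2 + 1) + 1)"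
        using k1(2) k2(2) by (blast intro: eval_evals.LetE eval_evals.If_Node)
      moreover have "k1 + (1 + k2 + 1) + 1 \<le> ?T (rsize x)" using k1(1) k2(1) sb by simp
      moreover have "rsize (g x y ys) \<le> ?S (rsize x)"
        using realizes_size[OF g, of "(x, y, ys)"] sb by simp
      ultimately show ?thesis unfolding Cons list.case by blast
    qed
    then show "\<exists>k \<le> ?T (rsize x). eval ?P [repr x] ?e (repr (?h x)) k"
      and "rsize (?h x) \<le> ?S (rsize x)" by blast+
  qed (intro polybound_intros)+
qed

section \<open>Folds and iteration\<close>

text \<open>All recursion passes through this rule. The accumulator has to be bounded after every
  prefix of the list: a polynomial step may square the size, and iterating it would leave polynomial
  size.\<close>

lemma ptime_foldl:
  fixes init :: "'a::encodable \<Rightarrow> 's::encodable" and l :: "'a \<Rightarrow> 'b::encodable list"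
  assumes "ptime (\<lambda>z. step (fst z) (fst (snd z)) (snd (snd z)))" "ptime init" "ptime l"
    and bound: "\<And>x ys zs. l x = ys @ zs \<Longrightarrow> rsize (foldl (step x) (init x) ys) \<le> B (rsize x)"
    and B: "polybound B"
  shows "ptime (\<lambda>x. foldl (step x) (init x) (l x))"
proof -
  let ?step = "\<lambda>z. step (fst z) (fst (snd z)) (snd (snd z))"
  obtain P i c where st: "realizes P i ?step c"
    using assms(1) unfolding ptime_def by blast
  obtain Q j d where init: "realizes (P @ Q) j init d"
    using ptime_extend[OF assms(2)] by blast
  obtain R m b where l: "realizes ((P @ Q) @ R) m l b"
    using ptime_extend[OF assms(3)] by blast
  let ?q = "length ((P @ Q) @ R)"
  \<comment> \<open>The loop sits at index \<open>?q\<close>, right behind the three given programs,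
    and calls itself there. Its environment is the input, the accumulator and the rest of the
    list.\<close>
  let ?loop = "IfLeaf (Var 2) (Var 1)
    (Call ?q [Var 0, Call i [NodeE (Var 0) (NodeE (Var 1) (Left (Var 2)))], Right (Var 2)])"
  let ?e = "Call ?q [Var 0, Call j [Var 0], Call m [Var 0]]"
  let ?P = "(((P @ Q) @ R) @ [?loop]) @ ?e # []"
  have st': "realizes ?P i ?step c"
    and init': "realizes ?P j init d"
    and l': "realizes ?P m l b"
    using realizes_append[OF st, of "Q @ R @ ?loop # ?e # []"]
      realizes_append[OF init, of "R @ ?loop # ?e # []"]
      realizes_append[OF l, of "?loop # ?e # []"] by simp_all
  have q: "?q < length ?P" "?P ! ?q = ?loop"
    by (simp_all add: nth_append)
  let ?U = "\<lambda>n::nat. (n + B n + (n + 2) ^ b + 4) ^ c + 40"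
  have loop: "\<exists>k \<le> (length zs + 1) * ?U (rsize x).
      eval ?P [repr x, repr (foldl (step x) (init x) ys), repr zs] ?loop
        (repr (foldl (step x) (init x) (l x))) k"
    if "l x = ys @ zs" for x ys zs
    using that
  proof (induction zs arbitrary: ys)
    case Nil
    have "eval ?P [repr x, repr (foldl (step x) (init x) ys), repr ([]::'b list)] ?loop
        (repr (foldl (step x) (init x) ys)) (1 + 1 + 1)"
      using eval_Var2[of ?P "repr x" "repr (foldl (step x) (init x) ys)" Leaf "[]"]
        eval_Var1[of ?P "repr x" "repr (foldl (step x) (init x) ys)" "[Leaf]"]
      by (simp only: repr_simps) (rule eval_evals.If_Leaf)
    then show ?case using Nil by (intro exI[of _ "1 + 1 + 1"]) auto
  next
    case (Cons z zs)
    let ?s = "foldl (step x) (init x) ys"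
    let ?\<sigma> = "[repr x, repr ?s, repr (z # zs)]"
    have v2: "eval ?P ?\<sigma> (Var 2) (Node (repr z) (repr zs)) 1" using eval_Var2 by simp
    have v1: "eval ?P ?\<sigma> (Var 1) (repr ?s) 1" by (rule eval_Var1)
    have v0: "eval ?P ?\<sigma> (Var 0) (repr x) 1" by (rule eval_Var0)
    have "eval ?P ?\<sigma> (NodeE (Var 0) (NodeE (Var 1) (Left (Var 2)))) (repr (x, ?s, z))
        (1 + (1 + (1 + 1) + 1) + 1)"
      using eval_evals.NodeE[OF v0 eval_evals.NodeE[OF v1 eval_evals.Left[OF v2]]] by simp
    from realizes_call[OF st' this] obtain k1 where
      k1: "k1 \<le> (1 + (1 + (1 + 1) + 1) + 1) + (rsize (x, ?s, z) + 2) ^ c + 3"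
        "eval ?P ?\<sigma> (Call i [NodeE (Var 0) (NodeE (Var 1) (Left (Var 2)))])
          (repr (step x ?s z)) k1"
      unfolding fst_conv snd_conv by blast
    have "rsize z \<le> rsize (l x)" using Cons.prems by simp
    then have "rsize z \<le> (rsize x + 2) ^ b" using realizes_size[OF l, of x] by simp
    moreover have "rsize ?s \<le> B (rsize x)" using bound[OF Cons.prems] .
    ultimately have "(rsize (x, ?s, z) + 2) ^ c \<le> (rsize x + B (rsize x) + (rsize x + 2) ^ b + 4) ^ c"
      by (intro power_mono) auto
    then have k1': "k1 + 30 \<le> ?U (rsize x)" using k1(1) by linarith
    obtain k2 where k2: "k2 \<le> (length zs + 1) * ?U (rsize x)"
        "eval ?P [repr x, repr (step x ?s z), repr zs] ?loop
          (repr (foldl (step x) (init x) (l x))) k2"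
      using Cons.IH[of "ys @ [z]"] Cons.prems by auto
    have "evals ?P ?\<sigma> [Var 0, Call i [NodeE (Var 0) (NodeE (Var 1) (Left (Var 2)))], Right (Var 2)]
        [repr x, repr (step x ?s z), repr zs] (1 + (k1 + ((1 + 1) + 1 + 1) + 1) + 1)"
      using eval_evals.Right[OF v2] k1(2) v0
      by (intro eval_evals.More eval_evals.Empty) auto
    from eval_evals.If_Node[OF v2 eval_evals.Call[OF this q(1), unfolded q(2), OF k2(2)]]
    have "eval ?P ?\<sigma> ?loop (repr (foldl (step x) (init x) (l x)))
      (1 + (1 + (k1 + ((1 + 1) + 1 + 1) + 1) + 1 + k2 + 1) + 1)" by simp
    moreover have "1 + (1 + (k1 + ((1 + 1) + 1 + 1) + 1) + 1 + k2 + 1) + 1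
      \<le> (length (z # zs) + 1) * ?U (rsize x)"
      using k1' k2(1) by (simp add: algebra_simps)
    ultimately show ?case by blast
  qed
  show ?thesis
  proof (rule ptime_body)
    fix x
    let ?T = "\<lambda>n::nat. (n + 2) ^ d + (n + 2) ^ b + ((n + 2) ^ b + 1) * ?U n + 20"
    obtain k1 where k1: "k1 \<le> (rsize x + 2) ^ d + 4"
        "eval ?P [repr x] (Call j [Var 0]) (repr (init x)) k1"
      using realizes_call0[OF init', of x "[]"] by blast
    obtain k2 where k2: "k2 \<le> (rsize x + 2) ^ b + 4"
        "eval ?P [repr x] (Call m [Var 0]) (repr (l x)) k2"
      using realizes_call0[OF l', of x "[]"] by blast
    obtain k3 where k3: "k3 \<le> (length (l x) + 1) * ?U (rsize x)"
        "eval ?P [repr x, repr (init x), repr (l x)] ?loop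
          (repr (foldl (step x) (init x) (l x))) k3"
      using loop[of x "[]" "l x"] by auto
    have "length (l x) \<le> (rsize x + 2) ^ b"
      using realizes_size[OF l, of x] length_le_rsize[of "l x"] by simp
    then have "(length (l x) + 1) * ?U (rsize x) \<le> ((rsize x + 2) ^ b + 1) * ?U (rsize x)"
      by (intro mult_right_mono) auto
    then have k3': "k3 \<le> ((rsize x + 2) ^ b + 1) * ?U (rsize x)" using k3(1) by linarith
    have "evals ?P [repr x] [Var 0, Call j [Var 0], Call m [Var 0]]
        [repr x, repr (init x), repr (l x)] (1 + (k1 + (k2 + 1 + 1) + 1) + 1)"
      using k1(2) k2(2) by (intro eval_evals.More eval_evals.Empty eval_Var0)
    from eval_evals.Call[OF this q(1), unfolded q(2), OF k3(2)]
    have "eval ?P [repr x] ?e (repr (foldl (step x) (init x) (l x)))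
      (1 + (k1 + (k2 + 1 + 1) + 1) + 1 + k3 + 1)" .
    moreover have "1 + (k1 + (k2 + 1 + 1) + 1) + 1 + k3 + 1 \<le> ?T (rsize x)"
      using k1(1) k2(1) k3' by linarith
    ultimately show "\<exists>k \<le> ?T (rsize x). eval ?P [repr x] ?e
        (repr (foldl (step x) (init x) (l x))) k" by blast
    show "rsize (foldl (step x) (init x) (l x)) \<le> B (rsize x)"
      using bound[of x "l x" "[]"] by simp
  qed (intro polybound_intros B)+
qed

lemma ptime_size:
  assumes "ptime f"
  obtains c where "\<And>x. rsize (f x) \<le> (rsize x + 2) ^ c"
  using assms realizes_size unfolding ptime_def by metis

text \<open>The growth per step is bounded in terms of the fixed input and not of the accumulator,
  so after polynomially many steps it is still polynomial.\<close>

lemma ptime_foldl_additive: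
  fixes init :: "'a::encodable \<Rightarrow> 's::encodable" and l :: "'a \<Rightarrow> 'b::encodable list"
  assumes "ptime (\<lambda>z. step (fst z) (fst (snd z)) (snd (snd z)))" "ptime init" "ptime l"
    and add: "\<And>x s a. a \<in> set (l x) \<Longrightarrow> rsize (step x s a) \<le> rsize s + D (rsize x)"
    and D: "polybound D"
  shows "ptime (\<lambda>x. foldl (step x) (init x) (l x))"
proof -
  obtain c where c: "\<And>x. rsize (init x) \<le> (rsize x + 2) ^ c"
    using ptime_size[OF assms(2)] by blast
  obtain d where d: "\<And>x. rsize (l x) \<le> (rsize x + 2) ^ d"
    using ptime_size[OF assms(3)] by blast
  show ?thesis
  proof (rule ptime_foldl[OF assms(1-3)])
    fix x ys zs assume eq: "l x = ys @ zs"
    have "rsize (foldl (step x) s ys) \<le> rsize s + length ys * D (rsize x)"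
      if "set ys \<subseteq> set (l x)" for s ys
      using that
    proof (induction ys arbitrary: s)
      case (Cons a ys)
      have "rsize (foldl (step x) (step x s a) ys) \<le> rsize (step x s a) + length ys * D (rsize x)"
        using Cons by simp
      then show ?case using add[of a x s] Cons.prems by simp
    qed simp
    from this[of ys "init x"]
    have "rsize (foldl (step x) (init x) ys) \<le> rsize (init x) + length ys * D (rsize x)"
      using eq by simp
    also have "\<dots> \<le> (rsize x + 2) ^ c + (rsize x + 2) ^ d * D (rsize x)"
      using c[of x] d[of x] length_le_rsize[of "l x"] eq by (intro add_mono mult_right_mono) auto
    finally show "rsize (foldl (step x) (init x) ys)
      \<le> (rsize x + 2) ^ c + (rsize x + 2) ^ d * D (rsize x)" .
  qed (intro polybound_intros D)
qed

lemma ptime_comp2: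
  assumes "ptime (\<lambda>z. g (fst z) (snd z))" "ptime a" "ptime b"
  shows "ptime (\<lambda>x. g (a x) (b x))"
  using ptime_comp[OF assms(1) ptime_Pair[OF assms(2,3)]] by simp

lemma ptime_Cons [ptime_intros]:
  assumes "ptime f" "ptime g"
  shows "ptime (\<lambda>x. f x # g x)"
  using ptime_comp[OF ptime_coerce[of "\<lambda>p. fst p # snd p"] ptime_Pair[OF assms]] by fastforce

lemma repr_replicate_unit: "repr (replicate n ()) = repr n"
  by (induction n) auto

lemma ptime_replicate_unit: "ptime n \<Longrightarrow> ptime (\<lambda>x. replicate (n x) ())"
  by (rule ptime_comp[OF ptime_coerce]) (rule repr_replicate_unit)

lemma ptime_length_unit:
  assumes "ptime l"
  shows "ptime (\<lambda>x. length (l x :: unit list))"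
proof (rule ptime_comp[OF ptime_coerce assms])
  fix l :: "unit list" show "repr (length l) = repr l" by (induction l) auto
qed

lemma ptime_case_nat [ptime_intros]:
  assumes "ptime n" "ptime f" "ptime (\<lambda>z. g (fst z) (snd z))"
  shows "ptime (\<lambda>x. case n x of 0 \<Rightarrow> f x | Suc m \<Rightarrow> g x m)"
proof -
  have "ptime (\<lambda>z. g (fst z) (length (snd (snd z) :: unit list)))"
    by (intro ptime_comp2[OF assms(3)] ptime_intros ptime_length_unit)
  from ptime_case_list[OF ptime_replicate_unit[OF assms(1)] assms(2), of "\<lambda>x _ ys. g x (length ys)", OF this]
  show ?thesis
    by (rule back_subst[of ptime]) (auto split: nat.split)
qed

lemma ptime_if [ptime_intros]:
  assumes "ptime b" "ptime f" "ptime g"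
  shows "ptime (\<lambda>x. if b x then f x else g x)"
proof -
  have "ptime (\<lambda>x. if b x then [()] else [])"
    by (rule ptime_comp[OF ptime_coerce assms(1)]) simp
  from ptime_case_list[OF this assms(3), of "\<lambda>x _ _. f x", OF ptime_comp[OF assms(2) ptime_fst']]
  show ?thesis
    by (rule back_subst[of ptime]) auto
qed

lemma ptime_Suc [ptime_intros]:
  assumes "ptime n"
  shows "ptime (\<lambda>x. Suc (n x))"
  using ptime_length_unit[OF ptime_Cons[OF ptime_const ptime_replicate_unit[OF assms]]] by simp

lemma ptime_Not [ptime_intros]: "ptime a \<Longrightarrow> ptime (\<lambda>x. \<not> a x)"
  using ptime_if[OF _ ptime_const ptime_const, of a False True] by (simp add: if_bool_eq_conj)

lemma ptime_conj [ptime_intros]: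
  assumes "ptime a" "ptime b"
  shows "ptime (\<lambda>x. a x \<and> b x)"
proof -
  have eq: "(\<lambda>x. a x \<and> b x) = (\<lambda>x. if a x then b x else False)" by auto
  show ?thesis unfolding eq by (intro ptime_intros assms)
qed

lemma ptime_eq_bool [ptime_intros]:
  assumes "ptime a" "ptime b"
  shows "ptime (\<lambda>x. a x = (b x :: bool))"
proof -
  have eq: "(\<lambda>x. a x = (b x :: bool)) = (\<lambda>x. if a x then b x else \<not> b x)" by auto
  show ?thesis unfolding eq by (intro ptime_intros assms)
qed

lemma foldl_replicate_unit: "foldl (\<lambda>s _. f s) s (replicate n ()) = (f ^^ n) s"
  by (induction n arbitrary: s) (simp_all add: funpow_swap1)

lemma ptime_funpow:
  fixes init :: "'a::encodable \<Rightarrow> 's::encodable" and step :: "'a \<Rightarrow> 's \<Rightarrow> 's"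
  assumes "ptime (\<lambda>z. step (fst z) (snd z))" "ptime init" "ptime n"
    and bound: "\<And>x j. j \<le> n x \<Longrightarrow> rsize ((step x ^^ j) (init x)) \<le> B (rsize x)"
    and B: "polybound B"
  shows "ptime (\<lambda>x. (step x ^^ n x) (init x))"
proof -
  have "ptime (\<lambda>x. foldl (\<lambda>s _. step x s) (init x) (replicate (n x) ()))"
  proof (rule ptime_foldl[OF _ assms(2) ptime_replicate_unit[OF assms(3)] _ B])
    show "ptime (\<lambda>z::'a \<times> 's \<times> unit. step (fst z) (fst (snd z)))"
      by (intro ptime_comp2[OF assms(1)] ptime_intros)
  next
    fix x ys zs assume eq: "replicate (n x) () = ys @ zs"
    then have "ys = replicate (length ys) ()" "length ys \<le> n x"
      using arg_cong[OF eq, of length] by (auto simp: list_eq_iff_nth_eq)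
    then show "rsize (foldl (\<lambda>s _. step x s) (init x) ys) \<le> B (rsize x)"
      using bound foldl_replicate_unit by metis
  qed
  then show ?thesis by (simp add: foldl_replicate_unit)
qed

lemma ptime_funpow_inv:
  fixes init :: "'a::encodable \<Rightarrow> 's::encodable" and step :: "'a \<Rightarrow> 's \<Rightarrow> 's"
  assumes "ptime (\<lambda>z. step (fst z) (snd z))" "ptime init" "ptime n"
    and "\<And>x. I x (init x)" "\<And>x s. I x s \<Longrightarrow> I x (step x s)"
    and bound: "\<And>x s. I x s \<Longrightarrow> rsize s \<le> B (rsize x)" and B: "polybound B"
  shows "ptime (\<lambda>x. (step x ^^ n x) (init x))"
proof (rule ptime_funpow[OF assms(1-3) _ B])
  fix x j
  have "I x ((step x ^^ j) (init x))" by (induction j) (auto intro: assms)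
  then show "rsize ((step x ^^ j) (init x)) \<le> B (rsize x)" by (rule bound)
qed

section \<open>Arithmetic on unary numbers\<close>

lemma ptime_pred: "ptime n \<Longrightarrow> ptime (\<lambda>x. n x - Suc 0)"
  using ptime_case_nat[OF _ ptime_const ptime_snd[OF ptime_id], of n 0]
  by (rule back_subst[of ptime]) (auto split: nat.split)

lemma ptime_diff [ptime_intros]:
  assumes "ptime a" "ptime b"
  shows "ptime (\<lambda>x. a x - b x :: nat)"
proof -
  obtain c where c: "\<And>x. rsize (a x) \<le> (rsize x + 2) ^ c"
    using ptime_size[OF assms(1)] by blast
  have eq: "((\<lambda>s. s - Suc 0) ^^ n) m = m - n" for m n :: nat
    by (induction n) auto
  have "ptime (\<lambda>x. ((\<lambda>s. s - Suc 0) ^^ b x) (a x))"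
  proof (rule ptime_funpow[OF _ assms])
    show "rsize (((\<lambda>s. s - Suc 0) ^^ j) (a x)) \<le> (rsize x + 2) ^ c" for x j
      unfolding eq using c[of x] by simp
  qed (intro polybound_intros ptime_pred ptime_intros)+
  then show ?thesis by (simp only: eq)
qed

lemma ptime_add [ptime_intros]:
  assumes "ptime a" "ptime b"
  shows "ptime (\<lambda>x. a x + b x :: nat)"
proof -
  obtain c where c: "\<And>x. rsize (a x) \<le> (rsize x + 2) ^ c"
    using ptime_size[OF assms(1)] by blast
  obtain d where d: "\<And>x. rsize (b x) \<le> (rsize x + 2) ^ d"
    using ptime_size[OF assms(2)] by blast
  have eq: "(Suc ^^ n) m = m + n" for m n :: nat
    by (induction n) auto
  have "ptime (\<lambda>x. (Suc ^^ b x) (a x))"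
  proof (rule ptime_funpow[OF _ assms])
    show "rsize ((Suc ^^ j) (a x)) \<le> (rsize x + 2) ^ c + (rsize x + 2) ^ d" if "j \<le> b x" for x j
      unfolding eq using c[of x] d[of x] that by simp
  qed (intro polybound_intros ptime_intros)+
  then show ?thesis by (simp only: eq)
qed

lemma ptime_mult [ptime_intros]:
  assumes "ptime a" "ptime b"
  shows "ptime (\<lambda>x. a x * b x :: nat)"
proof -
  obtain c where c: "\<And>x. rsize (a x) \<le> (rsize x + 2) ^ c"
    using ptime_size[OF assms(1)] by blast
  obtain d where d: "\<And>x. rsize (b x) \<le> (rsize x + 2) ^ d"
    using ptime_size[OF assms(2)] by blast
  have eq: "((\<lambda>s. s + m) ^^ n) 0 = n * m" for m n :: nat
    by (induction n) auto
  have "ptime (\<lambda>x. ((\<lambda>s. s + b x) ^^ a x) 0)"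
  proof (rule ptime_funpow[OF _ _ assms(1)])
    show "ptime (\<lambda>z. snd z + b (fst z))"
      by (intro ptime_intros ptime_comp[OF assms(2)])
    show "rsize (((\<lambda>s. s + b x) ^^ j) 0) \<le> (rsize x + 2) ^ c * (rsize x + 2) ^ d" if "j \<le> a x" for x j
      unfolding eq rsize_nat using c[of x] d[of x] that by (intro mult_mono) auto
  qed (intro polybound_intros ptime_intros)+
  then show ?thesis by (simp only: eq)
qed

lemma ptime_eq_0:
  assumes "ptime a"
  shows "ptime (\<lambda>x. a x = (0::nat))"
proof -
  have eq: "(\<lambda>x. a x = 0) = (\<lambda>x. case a x of 0 \<Rightarrow> True | Suc _ \<Rightarrow> False)"
  proof (rule ext)
    show "(a x = 0) = (case a x of 0 \<Rightarrow> True | Suc _ \<Rightarrow> False)" for x by (cases "a x") auto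
  qed
  show ?thesis unfolding eq by (intro ptime_intros assms)
qed

lemma ptime_le [ptime_intros]: "ptime a \<Longrightarrow> ptime b \<Longrightarrow> ptime (\<lambda>x. a x \<le> (b x :: nat))"
  using ptime_eq_0[OF ptime_diff, of a b] by simp

lemma ptime_less [ptime_intros]: "ptime a \<Longrightarrow> ptime b \<Longrightarrow> ptime (\<lambda>x. a x < (b x :: nat))"
  using ptime_Not[OF ptime_le, of b a] by (simp add: not_le)

lemma ptime_eq_nat [ptime_intros]: "ptime a \<Longrightarrow> ptime b \<Longrightarrow> ptime (\<lambda>x. a x = (b x :: nat))"
  using ptime_conj[OF ptime_le ptime_le, of a b b a] by (simp add: order_eq_iff)

lemma ptime_min [ptime_intros]: "ptime a \<Longrightarrow> ptime b \<Longrightarrow> ptime (\<lambda>x. min (a x) (b x :: nat))"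
  unfolding min_def by (intro ptime_intros)


section \<open>Operations on lists\<close>

lemma ptime_rev_append:
  assumes "ptime l" "ptime m"
  shows "ptime (\<lambda>x. rev (l x) @ m x)"
proof -
  obtain c where c: "\<And>x. rsize (l x) \<le> (rsize x + 2) ^ c"
    using ptime_size[OF assms(1)] by blast
  have eq: "foldl (\<lambda>s a. a # s) ys xs = rev xs @ ys" for xs ys :: "'b list"
    by (induction xs arbitrary: ys) auto
  have "ptime (\<lambda>x. foldl (\<lambda>s a. a # s) (m x) (l x))"
  proof (rule ptime_foldl_additive[OF _ assms(2,1)])
    show "rsize (a # s) \<le> rsize s + (rsize x + 2) ^ c" if "a \<in> set (l x)" for x s a
      using rsize_mem_less[OF that] c[of x] by simp
  qed (intro polybound_intros ptime_intros)+
  then show ?thesis by (simp only: eq)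
qed

lemma ptime_rev [ptime_intros]: "ptime l \<Longrightarrow> ptime (\<lambda>x. rev (l x))"
  using ptime_rev_append[OF _ ptime_const, of l "[]"] by simp

lemma ptime_append [ptime_intros]: "ptime l \<Longrightarrow> ptime m \<Longrightarrow> ptime (\<lambda>x. l x @ m x)"
  using ptime_rev_append[OF ptime_rev, of l m] by simp

lemma rsize_rev [simp]: "rsize (rev xs) = rsize xs"
  by (induction xs) auto

lemma ptime_concat_map [ptime_intros]:
  assumes "ptime (\<lambda>z. f (fst z) (snd z))" "ptime l"
  shows "ptime (\<lambda>x. concat (map (f x) (l x)))"
proof -
  obtain c where c: "\<And>z. rsize (f (fst z) (snd z)) \<le> (rsize z + 2) ^ c"
    using ptime_size[OF assms(1)] by blast
  obtain d where d: "\<And>x. rsize (l x) \<le> (rsize x + 2) ^ d"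
    using ptime_size[OF assms(2)] by blast
  have eq: "foldl (\<lambda>s a. rev (g a) @ s) ys xs = rev (concat (map g xs)) @ ys"
    for xs ys and g :: "'b \<Rightarrow> 'c list"
    by (induction xs arbitrary: ys) auto
  have "ptime (\<lambda>x. foldl (\<lambda>s a. rev (f x a) @ s) [] (l x))"
  proof (rule ptime_foldl_additive[OF _ ptime_const assms(2)])
    have "ptime (\<lambda>z. f (fst z) (snd (snd z)))"
      by (intro ptime_comp2[OF assms(1)] ptime_intros)
    then show "ptime (\<lambda>z. rev (f (fst z) (snd (snd z))) @ fst (snd z))"
      by (intro ptime_intros)
  next
    fix x s a assume "a \<in> set (l x)"
    then have "rsize a \<le> (rsize x + 2) ^ d" using rsize_mem_less d[of x] by fastforce
    then have "(rsize (x, a) + 2) ^ c \<le> (rsize x + (rsize x + 2) ^ d + 3) ^ c"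
      by (intro power_mono) auto
    then show "rsize (rev (f x a) @ s) \<le> rsize s + (rsize x + (rsize x + 2) ^ d + 3) ^ c"
      using c[of "(x, a)"] by simp
  qed (intro polybound_intros)
  from ptime_rev[OF this] show ?thesis by (simp add: eq)
qed

lemma ptime_map [ptime_intros]:
  assumes "ptime (\<lambda>z. f (fst z) (snd z))" "ptime l"
  shows "ptime (\<lambda>x. map (f x) (l x))"
proof -
  have "ptime (\<lambda>x. concat (map (\<lambda>a. [f x a]) (l x)))"
    by (intro ptime_intros assms)
  moreover have "concat (map (\<lambda>a. [g a]) xs) = map g xs" for xs and g :: "'b \<Rightarrow> 'c"
    by (induction xs) auto
  ultimately show ?thesis by simp
qed

lemma ptime_filter [ptime_intros]:
  assumes "ptime (\<lambda>z. p (fst z) (snd z))" "ptime l"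
  shows "ptime (\<lambda>x. filter (p x) (l x))"
proof -
  have "ptime (\<lambda>x. concat (map (\<lambda>a. if p x a then [a] else []) (l x)))"
    by (intro ptime_intros assms)
  moreover have "concat (map (\<lambda>a. if q a then [a] else []) xs) = filter q xs"
    for xs and q :: "'b \<Rightarrow> bool"
    by (induction xs) auto
  ultimately show ?thesis by simp
qed

lemma ptime_length [ptime_intros]: "ptime l \<Longrightarrow> ptime (\<lambda>x. length (l x))"
  using ptime_length_unit[OF ptime_map[of "\<lambda>_ _. ()" l]] by (simp add: ptime_const)

lemma ptime_sum_list [ptime_intros]:
  assumes "ptime l"
  shows "ptime (\<lambda>x. sum_list (l x) :: nat)"
proof -
  have "ptime (\<lambda>x. length (concat (map (\<lambda>n. replicate n ()) (l x))))"
    by (intro ptime_intros ptime_replicate_unit assms)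
  then show ?thesis by (simp add: length_concat comp_def)
qed

lemma ptime_list_ex [ptime_intros]:
  assumes "ptime (\<lambda>z. p (fst z) (snd z))" "ptime l"
  shows "ptime (\<lambda>x. list_ex (p x) (l x))"
proof -
  have "ptime (\<lambda>x. 0 < length (filter (p x) (l x)))"
    by (intro ptime_intros assms)
  then show ?thesis by (simp add: filter_empty_conv list_ex_iff Bex_def)
qed

section \<open>The algorithm\<close>

text \<open>A network is a list of entries. An arc \<open>Arc x y i b\<close> is a way to move from \<open>x\<close> to \<open>y\<close>
  by changing the flow on the entry \<open>i\<close>, which is increased if \<open>b\<close> holds and decreased
  otherwise.\<close>

datatype entry = Entry (eid: nat) (src: nat) (dst: nat) (cap: nat) (flo: nat)

datatype arc = Arc (atail: nat) (ahead: nat) (aid: nat) (fwd: bool)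

definition set_flo :: "nat \<Rightarrow> entry \<Rightarrow> entry" where
  "set_flo f e = Entry (eid e) (src e) (dst e) (cap e) f"

definition set_cap :: "nat \<Rightarrow> entry \<Rightarrow> entry" where
  "set_cap c e = Entry (eid e) (src e) (dst e) c (flo e)"

lemma fields_set [simp]:
  "eid (set_flo f e) = eid e" "src (set_flo f e) = src e" "dst (set_flo f e) = dst e"
  "cap (set_flo f e) = cap e" "flo (set_flo f e) = f"
  "eid (set_cap c e) = eid e" "src (set_cap c e) = src e" "dst (set_cap c e) = dst e"
  "cap (set_cap c e) = c" "flo (set_cap c e) = flo e"
  by (simp_all add: set_flo_def set_cap_def)

text \<open>Graph search remembers, for each vertex it has reached, a path to it as the reversed list
  of its arcs.\<close>

definition relax :: "(nat \<times> arc list) list \<Rightarrow> arc \<Rightarrow> (nat \<times> arc list) list" where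
  "relax R a = (case filter (\<lambda>q. fst q = atail a) R of
      [] \<Rightarrow> R
    | q # _ \<Rightarrow> if list_ex (\<lambda>r. fst r = ahead a) R then R else (ahead a, a # snd q) # R)"

text \<open>Passes in the manner of Bellman and Ford: a pass over \<open>A\<close> reaches a new
  vertex unless the reached set is already closed, and besides \<open>x\<close> at most
  \<open>length A\<close> vertices can be reached.\<close>

definition search :: "arc list \<Rightarrow> nat \<Rightarrow> (nat \<times> arc list) list" where
  "search A x = foldl relax [(x, [])] (concat (map (\<lambda>_. A) A))"

text \<open>The list serves as an option: \<open>search\<close> keeps one path per vertex, so there
  is at most one element.\<close>

definition find_path :: "arc list \<Rightarrow> nat \<Rightarrow> nat \<Rightarrow> arc list list" where
  "find_path A x y = map snd (filter (\<lambda>q. fst q = y) (search A x))"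

section \<open>Pushing flow and augmenting paths\<close>

text \<open>Changes are cut off at the capacity and at 0, so that sizes stay bounded and capacities
  stay respected even when the push makes no sense. For the pushes that matter the cut-off has no
  effect.\<close>

definition adj :: "arc list \<Rightarrow> nat \<Rightarrow> entry \<Rightarrow> entry" where
  "adj p d e =
    (if list_ex (\<lambda>a. aid a = eid e \<and> fwd a) p then set_flo (min (cap e) (flo e + d)) e
     else if list_ex (\<lambda>a. aid a = eid e) p then set_flo (flo e - d) e
     else e)"

definition push :: "arc list \<Rightarrow> nat \<Rightarrow> entry list \<Rightarrow> entry list" where
  "push p d N = map (adj p d) N"

definition residual :: "entry list \<Rightarrow> arc list" where
  "residual N = concat (map (\<lambda>e.
     (if flo e < cap e then [Arc (src e) (dst e) (eid e) True] else []) @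
     (if 0 < flo e then [Arc (dst e) (src e) (eid e) False] else [])) N)"

definition augment :: "nat \<Rightarrow> nat \<Rightarrow> entry list \<Rightarrow> entry list" where
  "augment s t N = (case find_path (residual N) s t of [] \<Rightarrow> N | p # _ \<Rightarrow> push p 1 N)"

text \<open>A successful augmentation raises the value by 1, and no value exceeds the sum of the
  capacities. As numbers are unary, this number of rounds is polynomial.\<close>

definition maxflow :: "nat \<Rightarrow> nat \<Rightarrow> entry list \<Rightarrow> entry list" where
  "maxflow s t N = (augment s t ^^ sum_list (map cap N)) N"

definition netval :: "nat \<Rightarrow> entry list \<Rightarrow> nat" where
  "netval s N = sum_list (map flo (filter (\<lambda>e. src e = s) N)) -
     sum_list (map flo (filter (\<lambda>e. dst e = s) N))"

text \<open>The total length of a decomposition of the flow into paths and cycles; for a flow with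
  values 0 and 1, the number of arcs it uses.\<close>

definition mass :: "entry list \<Rightarrow> nat" where
  "mass N = sum_list (map flo N)"

section \<open>Cancelling undirected cycles\<close>

definition inner :: "entry \<Rightarrow> bool" where
  "inner e \<longleftrightarrow> 0 < flo e \<and> flo e < cap e"

definition inner_arcs :: "entry list \<Rightarrow> nat \<Rightarrow> arc list" where
  "inner_arcs N i = concat (map (\<lambda>e.
     if inner e \<and> eid e \<noteq> i then [Arc (src e) (dst e) (eid e) True, Arc (dst e) (src e) (eid e) False]
     else []) N)"

text \<open>An undirected cycle is an inner entry together with a path that joins its ends and
  avoids the entry itself. A loop is a cycle with the empty path.\<close>

definition inner_cycles :: "entry list \<Rightarrow> arc list list" where
  "inner_cycles N = concat (map (\<lambda>e.
     if inner e then
       map (\<lambda>p. Arc (src e) (dst e) (eid e) True # p) (find_path (inner_arcs N (eid e)) (dst e) (src e))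
     else []) N)"

definition flip :: "arc list \<Rightarrow> arc list" where
  "flip p = map (\<lambda>a. Arc (ahead a) (atail a) (aid a) (\<not> fwd a)) p"

definition rooms :: "arc list \<Rightarrow> entry list \<Rightarrow> nat list" where
  "rooms p N = concat (map (\<lambda>e.
     if list_ex (\<lambda>a. aid a = eid e \<and> fwd a) p then [cap e - flo e]
     else if list_ex (\<lambda>a. aid a = eid e) p then [flo e]
     else []) N)"

text \<open>The bottleneck of the cycle. The fold starts from a number that is at least every room
  of a valid network.\<close>

definition amount :: "arc list \<Rightarrow> entry list \<Rightarrow> nat" where
  "amount p N = foldl min (sum_list (map cap N)) (rooms p N)"

definition bump :: "arc list \<Rightarrow> entry list \<Rightarrow> entry list" where
  "bump p N = push p (amount p N) N"

text \<open>Pushing along a cycle in one direction does not increase the total flow, and pushing in the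
  other one does not decrease it. The direction is chosen so that the total flow moves towards
  the target \<open>T\<close>.\<close>

definition cancel_step :: "nat \<Rightarrow> entry list \<Rightarrow> entry list" where
  "cancel_step T N = (case inner_cycles N of
      [] \<Rightarrow> N
    | p # _ \<Rightarrow>
        if (T \<le> mass N) = (mass (bump p N) \<le> mass (bump (flip p) N))
        then bump p N else bump (flip p) N)"

text \<open>Each effective step reduces the number of inner entries, so \<open>length N\<close>
  steps suffice.\<close>

definition cancel :: "nat \<Rightarrow> entry list \<Rightarrow> entry list" where
  "cancel T N = (cancel_step T ^^ length N) N"

section \<open>Splitting and peeling\<close>

definition uses :: "entry list \<Rightarrow> entry \<Rightarrow> bool" where
  "uses K e \<longleftrightarrow> list_ex (\<lambda>e'. eid e' = eid e \<and> 0 < flo e') K"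

definition without :: "entry list \<Rightarrow> entry list \<Rightarrow> entry list" where
  "without K H = map (\<lambda>e. if uses K e then set_flo (flo e - 1) e else e) H"

definition support :: "entry list \<Rightarrow> entry list \<Rightarrow> entry list" where
  "support K H = map (\<lambda>e. set_cap 1 (set_flo (if uses K e then 1 else 0) e)) H"

text \<open>Rounding of \<open>H / k\<close>, scaled by \<open>k\<close>: under the capacity
  \<open>k\<close> the fractional entries are exactly the inner ones, so the procedure that cancels
  cycles serves again. The target \<tau> for the mass is scaled likewise.\<close>

definition rounded :: "nat \<Rightarrow> nat \<Rightarrow> entry list \<Rightarrow> entry list" where
  "rounded \<tau> k H = cancel (k * \<tau>) (map (set_cap k) H)"

text \<open>The state consists of the number of flows still to be split off, the rest of the flow,
  and the flows already obtained.\<close>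

definition split_step ::
    "nat \<Rightarrow> nat \<times> entry list \<times> entry list list \<Rightarrow> nat \<times> entry list \<times> entry list list" where
  "split_step \<tau> x =
     (fst x - 1, without (rounded \<tau> (fst x) (fst (snd x))) (fst (snd x)),
      support (rounded \<tau> (fst x) (fst (snd x))) (fst (snd x)) # snd (snd x))"

definition split_flow :: "nat \<Rightarrow> nat \<Rightarrow> entry list \<Rightarrow> entry list list" where
  "split_flow \<tau> k H = snd (snd ((split_step \<tau> ^^ k) (k, H, [])))"

text \<open>Removing a unit of flow along a path from \<open>s\<close> to \<open>t\<close> is pushing it back from \<open>t\<close> to \<open>s\<close>.\<close>

definition return_arcs :: "entry list \<Rightarrow> arc list" where
  "return_arcs N = concat (map (\<lambda>e. if 0 < flo e then [Arc (dst e) (src e) (eid e) False] else []) N)"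

text \<open>The path is found in what is left of \<open>F\<close>, so that successive paths share no
  arc, but it is removed from \<open>F\<close> itself, so that each result has lost just one
  path.\<close>

definition peel_step ::
    "nat \<Rightarrow> nat \<Rightarrow> entry list \<Rightarrow> entry list \<times> entry list list \<Rightarrow> entry list \<times> entry list list" where
  "peel_step s t F x = (case find_path (return_arcs (fst x)) t s of
      [] \<Rightarrow> x
    | p # _ \<Rightarrow> (push p 1 (fst x), push p 1 F # snd x))"

definition peel :: "nat \<Rightarrow> nat \<Rightarrow> nat \<Rightarrow> entry list \<Rightarrow> entry list list" where
  "peel s t k F = snd ((peel_step s t F ^^ k) (F, []))"

section \<open>The whole algorithm\<close>

text \<open>The position of an arc is its id, which keeps parallel arcs apart.\<close>

definition network :: "(nat \<times> nat) list \<Rightarrow> entry list" where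
  "network xs = rev (foldl (\<lambda>N x. Entry (length N) (fst x) (snd x) 1 0 # N) [] xs)"

text \<open>For a maximum flow under unit capacities, the arcs of minimum cuts are the arcs with
  flow whose head cannot be reached from their tail in the residual network.\<close>

definition critical :: "entry list \<Rightarrow> entry \<Rightarrow> bool" where
  "critical N e \<longleftrightarrow> 0 < flo e \<and> length (find_path (residual N) (src e) (dst e)) = 0"

definition relaxed_network :: "entry list \<Rightarrow> nat \<Rightarrow> entry list" where
  "relaxed_network N k =
     map (\<lambda>e. set_flo 0 (set_cap (if critical N e then Suc k else k) e)) N"

text \<open>Without \<open>0 < flo e\<close>, the entries of capacity 0 that occur for
  \<open>k = 0\<close> would count as well.\<close>

definition saturated :: "entry list \<Rightarrow> nat" where
  "saturated N = length (filter (\<lambda>e. 0 < flo e \<and> flo e = cap e) N)"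

text \<open>The flows into which \<open>H\<close> is split have an average mass of at least \<open>saturated H - n\<close>. The
  target is lower by another \<open>n\<close>, because rounding may overshoot it by \<open>n\<close> and must not lower
  the average of the flows that remain.\<close>

definition families :: "nat \<Rightarrow> nat \<Rightarrow> nat \<Rightarrow> nat \<Rightarrow> entry list \<Rightarrow> entry list list" where
  "families n s t k H = (case split_flow (saturated H - (n + n)) (Suc k) H of
      [] \<Rightarrow> []
    | F # Fs \<Rightarrow> (F # Fs) @ peel s t k F)"

definition fault_tolerant_flows ::
    "nat \<times> (nat \<times> nat) list \<times> nat \<times> nat \<Rightarrow> entry list list" where
  "fault_tolerant_flows I =
    (let n = fst I; s = fst (snd (snd I)); t = snd (snd (snd I));
         N = maxflow s t (network (fst (snd I))); k = netval s N
     in families n s t k (cancel 0 (maxflow s t (relaxed_network N k))))"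

definition solve :: "nat \<times> (nat \<times> nat) list \<times> nat \<times> nat \<Rightarrow> (nat \<times> nat) list list" where
  "solve I = map (map (\<lambda>e. (flo e, 1))) (fault_tolerant_flows I)"

section \<open>Graph search\<close>

text \<open>A simple path with its last arc first, which is how \<open>search\<close> extends paths.
  Simplicity bounds its length by the number of vertices.\<close>

fun rpath :: "arc set \<Rightarrow> nat \<Rightarrow> arc list \<Rightarrow> nat \<Rightarrow> bool" where
  "rpath A x [] y \<longleftrightarrow> x = y"
| "rpath A x (a # p) y \<longleftrightarrow>
     a \<in> A \<and> ahead a = y \<and> y \<notin> insert x (ahead ` set p) \<and> rpath A x p (atail a)"

lemma rpath_subset: "rpath A x p y \<Longrightarrow> set p \<subseteq> A"
  by (induction p arbitrary: y) auto

lemma rpath_end: "rpath A x p y \<Longrightarrow> y \<in> insert x (ahead ` set p)"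
  by (cases p) auto

lemma rpath_ends:
  "rpath A x p y \<Longrightarrow> a \<in> set p \<Longrightarrow> {atail a, ahead a} \<subseteq> insert x (ahead ` set p)"
  by (induction p arbitrary: y) (use rpath_end in fastforce)+

lemma rpath_distinct: "rpath A x p y \<Longrightarrow> distinct (x # map ahead p)"
  by (induction p arbitrary: y) auto

lemma rpath_length:
  assumes "rpath A x p y" "finite V" "x \<in> V" "ahead ` A \<subseteq> V"
  shows "Suc (length p) \<le> card V"
proof -
  have "set (x # map ahead p) \<subseteq> V"
    using rpath_subset[OF assms(1)] assms(3,4) by auto
  then have "card (set (x # map ahead p)) \<le> card V"
    by (rule card_mono[OF assms(2)])
  then show ?thesis
    using distinct_card[OF rpath_distinct[OF assms(1)]] by simp
qed

lemma rpath_crossing: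
  "rpath A x p y \<Longrightarrow> x \<in> S \<Longrightarrow> y \<notin> S \<Longrightarrow> \<exists>a \<in> set p. atail a \<in> S \<and> ahead a \<notin> S"
  by (induction p arbitrary: y) auto

text \<open>The reason why a push along a path disturbs conservation only at its two ends.\<close>

lemma rpath_telescope:
  fixes \<pi> :: "nat \<Rightarrow> int"
  shows "rpath A x p y \<Longrightarrow> (\<Sum>a\<leftarrow>p. \<pi> (ahead a) - \<pi> (atail a)) = \<pi> y - \<pi> x"
proof (induction p arbitrary: y)
  case (Cons a p)
  then have "(\<Sum>a\<leftarrow>p. \<pi> (ahead a) - \<pi> (atail a)) = \<pi> (atail a) - \<pi> x" by auto
  then show ?case using Cons.prems by simp
qed simp

text \<open>Arcs with the same id are the two directions of one entry or equal, so they have the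
  same ends. A simple path cannot contain both, because the head of the later one would already have
  been visited.\<close>

lemma rpath_distinct_aid:
  assumes "rpath A x p y"
    and "\<And>a b. a \<in> A \<Longrightarrow> b \<in> A \<Longrightarrow> aid a = aid b \<Longrightarrow> {atail a, ahead a} = {atail b, ahead b}"
  shows "distinct (map aid p)"
  using assms(1)
proof (induction p arbitrary: y)
  case (Cons a p)
  then have p: "rpath A x p (atail a)" by simp
  have "aid a \<noteq> aid b" if "b \<in> set p" for b
  proof
    assume "aid a = aid b"
    then have "{atail a, ahead a} = {atail b, ahead b}"
      using Cons.prems rpath_subset[OF p] that by (intro assms(2)) auto
    then have "ahead a \<in> insert x (ahead ` set p)"
      using rpath_ends[OF p that] by blast
    then show False using Cons.prems by simp
  qed
  then show ?case using Cons.IH[OF p] by auto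
qed simp

definition reached :: "(nat \<times> arc list) list \<Rightarrow> nat set" where
  "reached R = fst ` set R"

text \<open>Stored paths stay inside the reached set, so a newly reached vertex is on none of them,
  and the extended path is simple.\<close>

definition search_inv :: "arc set \<Rightarrow> nat \<Rightarrow> (nat \<times> arc list) list \<Rightarrow> bool" where
  "search_inv A x R \<longleftrightarrow> distinct (map fst R) \<and> reached R \<subseteq> insert x (ahead ` A) \<and>
     (\<forall>q \<in> set R. rpath A x (snd q) (fst q) \<and> ahead ` set (snd q) \<subseteq> reached R) \<and> x \<in> reached R"

lemma relax_cases:
  obtains "relax R a = R" "atail a \<in> reached R \<Longrightarrow> ahead a \<in> reached R"
  | p where "relax R a = (ahead a, a # p) # R" "(atail a, p) \<in> set R" "ahead a \<notin> reached R"
proof (cases "filter (\<lambda>q. fst q = atail a) R")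
  case Nil
  then have "atail a \<notin> reached R"
    by (auto simp: reached_def filter_empty_conv)
  with Nil that(1) show ?thesis by (simp add: relax_def)
next
  case (Cons q qs)
  then have q: "q \<in> set R" "fst q = atail a"
    by (metis (mono_tags) filter_eq_ConsD in_set_conv_decomp)+
  have ex: "list_ex (\<lambda>r. fst r = ahead a) R \<longleftrightarrow> ahead a \<in> reached R"
    by (auto simp: list_ex_iff reached_def image_iff eq_commute)
  show ?thesis
  proof (cases "ahead a \<in> reached R")
    case True
    then have "relax R a = R"
      using Cons by (simp add: relax_def ex)
    with True that(1) show ?thesis by simp
  next
    case False
    then have "relax R a = (ahead a, a # snd q) # R"
      using Cons by (simp add: relax_def ex)
    with False that(2) q show ?thesis by (metis prod.collapse)
  qed
qed

lemma reached_relax: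
  "reached (relax R a) = (if atail a \<in> reached R then insert (ahead a) (reached R) else reached R)"
  by (rule relax_cases[of R a]) (auto simp: reached_def image_iff intro: bexI[rotated])

lemma search_inv_relax:
  assumes "search_inv A x R" "a \<in> A"
  shows "search_inv A x (relax R a)"
proof (cases rule: relax_cases[of R a])
  case 1
  with assms show ?thesis by simp
next
  case (2 p)
  have p: "rpath A x p (atail a)" "ahead ` set p \<subseteq> reached R"
    using assms(1) 2(2) unfolding search_inv_def by fastforce+
  have "x \<in> reached R" using assms(1) by (simp add: search_inv_def)
  then have "rpath A x (a # p) (ahead a)" using p 2(3) assms(2) by auto
  moreover have "reached (relax R a) = insert (ahead a) (reached R)"
    using 2(1) by (simp add: reached_def)
  ultimately show ?thesis
    using assms p(2) 2(3) unfolding search_inv_def 2(1)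
    by (simp add: reached_def) blast
qed

lemma search_inv_foldl:
  "search_inv A x R \<Longrightarrow> set as \<subseteq> A \<Longrightarrow> search_inv A x (foldl relax R as)"
  by (induction as arbitrary: R) (auto intro: search_inv_relax)

lemma search_inv_init: "search_inv A x [(x, [])]"
  by (simp add: search_inv_def reached_def)

lemma search_inv_search: "search_inv (set A) x (search A x)"
  unfolding search_def by (rule search_inv_foldl[OF search_inv_init]) auto

lemma reached_foldl_mono: "reached R \<subseteq> reached (foldl relax R as)"
proof (induction as arbitrary: R)
  case (Cons a as)
  have "reached R \<subseteq> reached (relax R a)" by (auto simp: reached_relax)
  with Cons show ?case by fastforce
qed simp

lemma reached_foldl_arc:
  "a \<in> set as \<Longrightarrow> atail a \<in> reached R \<Longrightarrow> ahead a \<in> reached (foldl relax R as)"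
proof (induction as arbitrary: R)
  case (Cons b as)
  show ?case
  proof (cases "a = b")
    case True
    then have "ahead a \<in> reached (relax R b)" using Cons.prems by (simp add: reached_relax)
    then show ?thesis using reached_foldl_mono by fastforce
  next
    case False
    then have "a \<in> set as" "atail a \<in> reached (relax R b)"
      using Cons.prems by (auto simp: reached_relax)
    then show ?thesis using Cons.IH by simp
  qed
qed simp

lemma reached_foldl_closed:
  "\<forall>a \<in> set as. atail a \<in> reached R \<longrightarrow> ahead a \<in> reached R \<Longrightarrow> reached (foldl relax R as) = reached R"
proof (induction as arbitrary: R)
  case (Cons a as)
  then have "reached (relax R a) = reached R" by (auto simp: reached_relax)
  with Cons show ?case by simp
qed simp

text \<open>Every pass that starts from a set that is not closed adds a vertex. If the set were
  still not closed after \<open>length A\<close> passes, it would have at least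
  \<open>length A + 1\<close> elements; but \<open>x\<close> and the heads of \<open>A\<close> are
  no more than that, so it would consist of all of them and be closed.\<close>

lemma search_closed:
  assumes "a \<in> set A" "atail a \<in> reached (search A x)"
  shows "ahead a \<in> reached (search A x)"
proof -
  define R where "R j = foldl relax [(x, [])] (concat (replicate j A))" for j
  have R_Suc: "R (Suc j) = foldl relax (R j) A" for j
  proof -
    have "concat (replicate (Suc j) A) = concat (replicate j A) @ A"
      by (induction j) auto
    then show ?thesis by (simp add: R_def)
  qed
  let ?closed = "\<lambda>j. \<forall>a \<in> set A. atail a \<in> reached (R j) \<longrightarrow> ahead a \<in> reached (R j)"
  have fin: "finite (reached (R j))" for j by (simp add: reached_def)
  have *: "?closed j \<or> Suc j \<le> card (reached (R j))" for j
  proof (induction j)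
    case 0
    show ?case by (simp add: R_def reached_def)
  next
    case (Suc j)
    show ?case
    proof (cases "?closed j")
      case True
      then have "reached (R (Suc j)) = reached (R j)"
        unfolding R_Suc by (rule reached_foldl_closed)
      with True show ?thesis by simp
    next
      case False
      then obtain a where a: "a \<in> set A" "atail a \<in> reached (R j)" "ahead a \<notin> reached (R j)"
        by blast
      then have "ahead a \<in> reached (R (Suc j))"
        unfolding R_Suc by (intro reached_foldl_arc)
      then have "reached (R j) \<subset> reached (R (Suc j))"
        using a(3) reached_foldl_mono unfolding R_Suc by blast
      then have "card (reached (R j)) < card (reached (R (Suc j)))"
        by (rule psubset_card_mono[OF fin])
      with Suc False show ?thesis by simp
    qed
  qed
  have search: "search A x = R (length A)"
    by (simp add: search_def R_def map_replicate_const)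
  have "?closed (length A)"
  proof (cases "Suc (length A) \<le> card (reached (R (length A)))")
    case True
    have sub: "reached (R (length A)) \<subseteq> insert x (ahead ` set A)"
      using search_inv_search[of A x] by (simp add: search search_inv_def)
    have "card (insert x (ahead ` set A)) \<le> Suc (card (ahead ` set A))"
      by (rule card_insert_le_m1) auto
    also have "card (ahead ` set A) \<le> length A"
      using card_image_le[of "set A" ahead] card_length[of A] by simp
    finally have "reached (R (length A)) = insert x (ahead ` set A)"
      using True card_mono[OF _ sub] by (intro card_subset_eq[OF _ sub]) auto
    then show ?thesis by simp
  next
    case False
    then show ?thesis using *[of "length A"] by blast
  qed
  then show ?thesis using assms by (simp add: search)
qed

lemma find_path_rpath:
  assumes "p \<in> set (find_path A x y)"
  shows "rpath (set A) x p y"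
  using assms search_inv_search[of A x] by (auto simp: find_path_def search_inv_def)

text \<open>The reached set is closed. The minimum cuts, the sets that separate the ends of a forest
  arc and the contradiction in peeling all come from here.\<close>

lemma find_path_Nil:
  assumes "find_path A x y = []"
  shows "\<exists>S. x \<in> S \<and> y \<notin> S \<and> (\<forall>a \<in> set A. atail a \<in> S \<longrightarrow> ahead a \<in> S)"
proof (intro exI[of _ "reached (search A x)"] conjI)
  show "x \<in> reached (search A x)"
    using search_inv_search[of A x] by (simp add: search_inv_def)
  show "y \<notin> reached (search A x)"
    using assms by (auto simp: find_path_def reached_def filter_empty_conv)
  show "\<forall>a \<in> set A. atail a \<in> reached (search A x) \<longrightarrow> ahead a \<in> reached (search A x)"
    using search_closed by blast
qed

section \<open>The algorithm runs in polynomial time\<close>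

lemma ptime_comp3:
  assumes "ptime (\<lambda>z. g (fst z) (fst (snd z)) (snd (snd z)))" "ptime a" "ptime b" "ptime c"
  shows "ptime (\<lambda>x. g (a x) (b x) (c x))"
  using ptime_comp[OF assms(1) ptime_Pair[OF assms(2) ptime_Pair[OF assms(3,4)]]] by simp

lemma ptime_comp4:
  assumes "ptime (\<lambda>z. g (fst z) (fst (snd z)) (fst (snd (snd z))) (snd (snd (snd z))))"
    "ptime a" "ptime b" "ptime c" "ptime d"
  shows "ptime (\<lambda>x. g (a x) (b x) (c x) (d x))"
  using ptime_comp[OF assms(1) ptime_Pair[OF assms(2) ptime_Pair[OF assms(3) ptime_Pair[OF assms(4,5)]]]]
  by simp

instantiation entry :: encodable
begin
definition repr_entry where "repr_entry e = repr (eid e, src e, dst e, cap e, flo e)"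
instance ..
end

instantiation arc :: encodable
begin
definition repr_arc where "repr_arc a = repr (atail a, ahead a, aid a, fwd a)"
instance ..
end

lemma ptime_Entry [ptime_intros]:
  assumes "ptime a" "ptime b" "ptime c" "ptime d" "ptime e"
  shows "ptime (\<lambda>x. Entry (a x) (b x) (c x) (d x) (e x))"
proof -
  have "ptime (\<lambda>z. Entry (fst z) (fst (snd z)) (fst (snd (snd z))) (fst (snd (snd (snd z))))
      (snd (snd (snd (snd z)))))"
    by (rule ptime_coerce) (simp add: repr_entry_def)
  from ptime_comp[OF this, of "\<lambda>x. (a x, b x, c x, d x, e x)"]
  show ?thesis by (simp add: ptime_intros assms)
qed

lemma ptime_Arc [ptime_intros]:
  assumes "ptime a" "ptime b" "ptime c" "ptime d"
  shows "ptime (\<lambda>x. Arc (a x) (b x) (c x) (d x))"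
proof -
  have "ptime (\<lambda>z. Arc (fst z) (fst (snd z)) (fst (snd (snd z))) (snd (snd (snd z))))"
    by (rule ptime_coerce) (simp add: repr_arc_def)
  from ptime_comp[OF this, of "\<lambda>x. (a x, b x, c x, d x)"]
  show ?thesis by (simp add: ptime_intros assms)
qed

lemma ptime_fields [ptime_intros]:
  assumes "ptime e"
  shows "ptime (\<lambda>x. eid (e x))" "ptime (\<lambda>x. src (e x))" "ptime (\<lambda>x. dst (e x))"
    "ptime (\<lambda>x. cap (e x))" "ptime (\<lambda>x. flo (e x))"
proof -
  have t: "ptime (\<lambda>x. (eid (e x), src (e x), dst (e x), cap (e x), flo (e x)))"
    by (rule ptime_comp[OF ptime_coerce assms]) (simp add: repr_entry_def)
  show "ptime (\<lambda>x. eid (e x))" using ptime_fst[OF t] by simp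
  show "ptime (\<lambda>x. src (e x))" using ptime_fst[OF ptime_snd[OF t]] by simp
  show "ptime (\<lambda>x. dst (e x))" using ptime_fst[OF ptime_snd[OF ptime_snd[OF t]]] by simp
  show "ptime (\<lambda>x. cap (e x))" using ptime_fst[OF ptime_snd[OF ptime_snd[OF ptime_snd[OF t]]]] by simp
  show "ptime (\<lambda>x. flo (e x))" using ptime_snd[OF ptime_snd[OF ptime_snd[OF ptime_snd[OF t]]]] by simp
qed

lemma ptime_arc_fields [ptime_intros]:
  assumes "ptime a"
  shows "ptime (\<lambda>x. atail (a x))" "ptime (\<lambda>x. ahead (a x))" "ptime (\<lambda>x. aid (a x))"
    "ptime (\<lambda>x. fwd (a x))"
proof -
  have t: "ptime (\<lambda>x. (atail (a x), ahead (a x), aid (a x), fwd (a x)))"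
    by (rule ptime_comp[OF ptime_coerce assms]) (simp add: repr_arc_def)
  show "ptime (\<lambda>x. atail (a x))" using ptime_fst[OF t] by simp
  show "ptime (\<lambda>x. ahead (a x))" using ptime_fst[OF ptime_snd[OF t]] by simp
  show "ptime (\<lambda>x. aid (a x))" using ptime_fst[OF ptime_snd[OF ptime_snd[OF t]]] by simp
  show "ptime (\<lambda>x. fwd (a x))" using ptime_snd[OF ptime_snd[OF ptime_snd[OF t]]] by simp
qed

lemma ptime_set_flo [ptime_intros]: "ptime f \<Longrightarrow> ptime e \<Longrightarrow> ptime (\<lambda>x. set_flo (f x) (e x))"
  unfolding set_flo_def by (intro ptime_intros)

lemma ptime_set_cap [ptime_intros]: "ptime f \<Longrightarrow> ptime e \<Longrightarrow> ptime (\<lambda>x. set_cap (f x) (e x))"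
  unfolding set_cap_def by (intro ptime_intros)

lemma ptime_relax: "ptime (\<lambda>z. relax (fst z) (snd z))"
  unfolding relax_def by (intro ptime_intros)

text \<open>There is one stored path per vertex, and the paths are simple, so neither their number
  nor their lengths exceed \<open>length A + 1\<close>.\<close>

lemma search_inv_rsize:
  assumes "search_inv (set A) x R"
  shows "rsize R \<le> (rsize (A, x) + 1) * (rsize (A, x) + rsize (A, x) * (rsize (A, x) + 1) + 2)"
proof -
  let ?n = "rsize (A, x)"
  have head: "ahead a \<le> rsize A" if "a \<in> set A" for a
  proof -
    have "ahead a \<le> rsize a" by (simp add: repr_arc_def)
    then show ?thesis using rsize_mem_less[OF that] by simp
  qed
  have card: "card (ahead ` set A) \<le> length A"
    using card_image_le[of "set A" ahead] card_length[of A] by simp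
  have len: "length A \<le> rsize A" by (rule length_le_rsize)
  have q: "rsize q \<le> ?n + ?n * (?n + 1) + 1" if "q \<in> set R" for q
  proof -
    have p: "rpath (set A) x (snd q) (fst q)" "fst q \<in> insert x (ahead ` set A)"
      using assms that by (auto simp: search_inv_def reached_def)
    have "length (snd q) = card (ahead ` set (snd q))"
      using distinct_card[of "map ahead (snd q)"] rpath_distinct[OF p(1)] by simp
    also have "\<dots> \<le> card (ahead ` set A)"
      using rpath_subset[OF p(1)] by (intro card_mono image_mono) auto
    finally have "length (snd q) \<le> ?n" using card len by simp
    moreover have "rsize (snd q) \<le> length (snd q) * Suc (rsize A)"
      using rpath_subset[OF p(1)] by (intro rsize_list_le) (auto dest: rsize_mem_less less_imp_le)
    moreover have "length (snd q) * Suc (rsize A) \<le> ?n * (?n + 1)"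
      using calculation(1) by (rule mult_mono) auto
    ultimately have "rsize (snd q) \<le> ?n * (?n + 1)" by linarith
    moreover have "fst q \<le> ?n" using p(2) head by fastforce
    ultimately show ?thesis by (cases q) simp
  qed
  have "length R = card (reached R)"
    using assms distinct_card[of "map fst R"] by (simp add: search_inv_def reached_def)
  also have "\<dots> \<le> card (insert x (ahead ` set A))"
    using assms by (intro card_mono) (auto simp: search_inv_def)
  also have "\<dots> \<le> ?n + 1"
    using card len card_insert_le_m1[of "Suc (card (ahead ` set A))" "ahead ` set A" x] by simp
  finally have "length R \<le> ?n + 1" .
  then have "length R * Suc (?n + ?n * (?n + 1) + 1) \<le> (?n + 1) * (?n + ?n * (?n + 1) + 2)"
    by (rule mult_mono) auto
  then show ?thesis using rsize_list_le[of R, OF q] by linarith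
qed

lemma ptime_search: "ptime (\<lambda>z. search (fst z) (snd z))"
  unfolding search_def
proof (rule ptime_foldl)
  fix z :: "arc list \<times> nat" and ys zs
  assume "concat (map (\<lambda>_. fst z) (fst z)) = ys @ zs"
  then have "set ys \<subseteq> set (concat (map (\<lambda>_. fst z) (fst z)))" by simp
  then have "search_inv (set (fst z)) (snd z) (foldl relax [(snd z, [])] ys)"
    by (intro search_inv_foldl search_inv_init) (simp split: if_splits)
  from search_inv_rsize[OF this]
  show "rsize (foldl relax [(snd z, [])] ys)
    \<le> (rsize z + 1) * (rsize z + rsize z * (rsize z + 1) + 2)" by simp
qed (intro ptime_intros ptime_comp2[OF ptime_relax] polybound_intros)+

text \<open>The attribute composes the fact with arbitrary argument expressions; this form lets
  \<open>intro ptime_intros\<close> follow the structure of a definition.\<close>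

lemma ptime_find_path [THEN ptime_comp3, ptime_intros]: "ptime (\<lambda>z. find_path (fst z) (fst (snd z)) (snd (snd z)))"
  unfolding find_path_def by (intro ptime_intros ptime_comp2[OF ptime_search])

lemma ptime_adj [THEN ptime_comp3, ptime_intros]: "ptime (\<lambda>z. adj (fst z) (fst (snd z)) (snd (snd z)))"
  unfolding adj_def by (intro ptime_intros)

lemma ptime_push [THEN ptime_comp3, ptime_intros]: "ptime (\<lambda>z. push (fst z) (fst (snd z)) (snd (snd z)))"
  unfolding push_def by (intro ptime_intros)

lemma ptime_residual [THEN ptime_comp, ptime_intros]: "ptime residual"
  unfolding residual_def by (intro ptime_intros)

lemma ptime_augment: "ptime (\<lambda>z. augment (fst z) (fst (snd z)) (snd (snd z)))"
  unfolding augment_def by (intro ptime_intros)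

text \<open>The maximum admits starting networks in which the flow exceeds the capacity; the time
  bounds must cover these as well. Since \<open>flo e\<close> is at most the sum of the old flow and
  capacity, the size at most doubles, however often one iterates.\<close>

definition dominated :: "entry list \<Rightarrow> entry list \<Rightarrow> bool" where
  "dominated N0 N \<longleftrightarrow> list_all2 (\<lambda>e0 e. eid e = eid e0 \<and> src e = src e0 \<and> dst e = dst e0 \<and>
     cap e = cap e0 \<and> flo e \<le> max (flo e0) (cap e0)) N0 N"

lemma rsize_entry: "rsize e = eid e + src e + dst e + cap e + flo e + 4" for e :: entry
  by (simp add: repr_entry_def)

lemma rsize_dominated: "dominated N0 N \<Longrightarrow> rsize N \<le> 2 * rsize N0"
  unfolding dominated_def
  by (induction rule: list_all2_induct) (auto simp: rsize_entry)

lemma dominated_refl: "dominated N N"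
  by (auto simp: dominated_def intro: list_all2_refl)

lemma dominated_map:
  assumes "dominated N0 N"
    and "\<And>e. eid (f e) = eid e \<and> src (f e) = src e \<and> dst (f e) = dst e \<and> cap (f e) = cap e \<and>
      flo (f e) \<le> max (flo e) (cap e)"
  shows "dominated N0 (map f N)"
  using assms(1) unfolding dominated_def list_all2_map2
proof (rule list_all2_mono)
  fix e0 e assume "eid e = eid e0 \<and> src e = src e0 \<and> dst e = dst e0 \<and> cap e = cap e0 \<and>
    flo e \<le> max (flo e0) (cap e0)"
  then show "eid (f e) = eid e0 \<and> src (f e) = src e0 \<and> dst (f e) = dst e0 \<and>
    cap (f e) = cap e0 \<and> flo (f e) \<le> max (flo e0) (cap e0)"
    using assms(2)[of e] by linarith
qed

lemma dominated_push: "dominated N0 N \<Longrightarrow> dominated N0 (push p d N)"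
  unfolding push_def by (erule dominated_map) (auto simp: adj_def)

lemma dominated_augment: "dominated N0 N \<Longrightarrow> dominated N0 (augment s t N)"
  by (auto simp: augment_def intro: dominated_push split: list.split)

lemma ptime_maxflow [THEN ptime_comp3, ptime_intros]: "ptime (\<lambda>z. maxflow (fst z) (fst (snd z)) (snd (snd z)))"
  unfolding maxflow_def
proof (rule ptime_funpow_inv[where I = "\<lambda>z. dominated (snd (snd z))" and B = "\<lambda>n. 2 * n"])
  show "ptime (\<lambda>z. augment (fst (fst z)) (fst (snd (fst z))) (snd z))"
    by (intro ptime_comp3[OF ptime_augment] ptime_intros)
  show "rsize N \<le> 2 * rsize z" if "dominated (snd (snd z)) N" for N and z :: "nat \<times> nat \<times> entry list"
    using rsize_dominated[OF that] by (cases z) auto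
qed (intro ptime_intros dominated_refl dominated_augment polybound_intros | assumption)+

lemma ptime_netval [THEN ptime_comp2, ptime_intros]: "ptime (\<lambda>z. netval (fst z) (snd z))"
  unfolding netval_def by (intro ptime_intros)

lemma ptime_mass [THEN ptime_comp, ptime_intros]: "ptime mass"
  unfolding mass_def by (intro ptime_intros)

lemma ptime_inner [ptime_intros]: "ptime e \<Longrightarrow> ptime (\<lambda>x. inner (e x))"
  unfolding inner_def by (intro ptime_intros)

lemma ptime_inner_arcs [THEN ptime_comp2, ptime_intros]: "ptime (\<lambda>z. inner_arcs (fst z) (snd z))"
  unfolding inner_arcs_def by (intro ptime_intros)

lemma ptime_inner_cycles [THEN ptime_comp, ptime_intros]: "ptime inner_cycles"
  unfolding inner_cycles_def by (intro ptime_intros)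

lemma ptime_flip [THEN ptime_comp, ptime_intros]: "ptime flip"
  unfolding flip_def by (intro ptime_intros)

lemma ptime_rooms [THEN ptime_comp2, ptime_intros]: "ptime (\<lambda>z. rooms (fst z) (snd z))"
  unfolding rooms_def by (intro ptime_intros)

lemma ptime_amount: "ptime (\<lambda>z. amount (fst z) (snd z))"
  unfolding amount_def
proof (rule ptime_foldl_additive[where D = "\<lambda>n. 0"])
  show "rsize (min a b) \<le> rsize a + 0" for a b :: nat by simp
qed (intro ptime_intros polybound_intros)+

lemma ptime_bump [THEN ptime_comp2, ptime_intros]: "ptime (\<lambda>z. bump (fst z) (snd z))"
  unfolding bump_def by (intro ptime_intros ptime_comp2[OF ptime_amount])

lemma ptime_cancel_step: "ptime (\<lambda>z. cancel_step (fst z) (snd z))"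
  unfolding cancel_step_def by (intro ptime_intros)

lemma dominated_cancel_step: "dominated N0 N \<Longrightarrow> dominated N0 (cancel_step T N)"
  by (auto simp: cancel_step_def bump_def intro: dominated_push split: list.split)

lemma ptime_cancel [THEN ptime_comp2, ptime_intros]: "ptime (\<lambda>z. cancel (fst z) (snd z))"
  unfolding cancel_def
proof (rule ptime_funpow_inv[where I = "\<lambda>z. dominated (snd z)" and B = "\<lambda>n. 2 * n"])
  show "ptime (\<lambda>z. cancel_step (fst (fst z)) (snd z))"
    by (intro ptime_comp2[OF ptime_cancel_step] ptime_intros)
  show "rsize N \<le> 2 * rsize z" if "dominated (snd z) N" for N and z :: "nat \<times> entry list"
    using rsize_dominated[OF that] by (cases z) auto
qed (intro ptime_intros dominated_refl dominated_cancel_step polybound_intros | assumption)+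

lemma ptime_uses [THEN ptime_comp2, ptime_intros]: "ptime (\<lambda>z. uses (fst z) (snd z))"
  unfolding uses_def by (intro ptime_intros)

lemma ptime_without [THEN ptime_comp2, ptime_intros]: "ptime (\<lambda>z. without (fst z) (snd z))"
  unfolding without_def by (intro ptime_intros)

lemma ptime_support [THEN ptime_comp2, ptime_intros]: "ptime (\<lambda>z. support (fst z) (snd z))"
  unfolding support_def by (intro ptime_intros)

lemma ptime_rounded [THEN ptime_comp3, ptime_intros]: "ptime (\<lambda>z. rounded (fst z) (fst (snd z)) (snd (snd z)))"
  unfolding rounded_def by (intro ptime_intros)

lemma ptime_split_step: "ptime (\<lambda>z. split_step (fst z) (snd z))"
  unfolding split_step_def by (intro ptime_intros)

lemma rsize_support: "rsize (support K H) \<le> 3 * rsize H"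
  by (induction H) (auto simp: support_def rsize_entry)

lemma split_step_bound:
  assumes "fst x \<le> k" "dominated H (fst (snd x))" "rsize (snd (snd x)) \<le> b"
  shows "fst (split_step \<tau> x) \<le> k \<and> dominated H (fst (snd (split_step \<tau> x))) \<and>
    rsize (snd (snd (split_step \<tau> x))) \<le> 6 * rsize H + 1 + b"
proof -
  let ?K = "rounded \<tau> (fst x) (fst (snd x))"
  have "rsize (support ?K (fst (snd x))) \<le> 6 * rsize H"
    using rsize_support[of ?K "fst (snd x)"] rsize_dominated[OF assms(2)] by simp
  moreover have "dominated H (without ?K (fst (snd x)))"
    unfolding without_def using assms(2) by (intro dominated_map) auto
  ultimately show ?thesis using assms by (simp add: split_step_def)
qed

lemma ptime_split_flow [THEN ptime_comp3, ptime_intros]: "ptime (\<lambda>z. split_flow (fst z) (fst (snd z)) (snd (snd z)))"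
proof -
  have "ptime (\<lambda>z. (split_step (fst z) ^^ fst (snd z)) (fst (snd z), snd (snd z), []))"
  proof (rule ptime_funpow)
    fix z :: "nat \<times> nat \<times> entry list" and j
    assume j: "j \<le> fst (snd z)"
    let ?st = "(split_step (fst z) ^^ j) (fst (snd z), snd (snd z), [])"
    have "fst ?st \<le> fst (snd z) \<and> dominated (snd (snd z)) (fst (snd ?st)) \<and>
      rsize (snd (snd ?st)) \<le> j * (6 * rsize (snd (snd z)) + 1)"
    proof (induction j)
      case 0
      show ?case by (simp add: dominated_refl)
    next
      case (Suc j)
      then show ?case
        unfolding funpow.simps comp_apply mult_Suc by (intro split_step_bound) blast+
    qed
    moreover have "rsize (fst (snd ?st)) \<le> 2 * rsize (snd (snd z))"
      using calculation rsize_dominated by blast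
    moreover have "j \<le> rsize z" "rsize (snd (snd z)) \<le> rsize z" "fst (snd z) \<le> rsize z"
      using j by (cases z; auto)+
    moreover have "j * (6 * rsize (snd (snd z)) + 1) \<le> rsize z * (6 * rsize z + 1)"
      using calculation by (intro mult_mono) auto
    ultimately have "fst ?st \<le> rsize z \<and> rsize (fst (snd ?st)) \<le> 2 * rsize z \<and>
      rsize (snd (snd ?st)) \<le> rsize z * (6 * rsize z + 1)" by linarith
    then show "rsize ?st \<le> rsize z + (2 * rsize z + rsize z * (6 * rsize z + 1)) + 2"
      by (cases ?st) auto
  qed (intro ptime_intros ptime_comp2[OF ptime_split_step] polybound_intros)+
  then show ?thesis unfolding split_flow_def by (intro ptime_intros)
qed

lemma ptime_return_arcs [THEN ptime_comp, ptime_intros]: "ptime return_arcs"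
  unfolding return_arcs_def by (intro ptime_intros)

lemma ptime_peel_step:
  "ptime (\<lambda>z. peel_step (fst z) (fst (snd z)) (fst (snd (snd z))) (snd (snd (snd z))))"
  unfolding peel_step_def by (intro ptime_intros)

lemma peel_step_bound:
  assumes "dominated F (fst x)" "rsize (snd x) \<le> b"
  shows "dominated F (fst (peel_step s t F x)) \<and>
    rsize (snd (peel_step s t F x)) \<le> 2 * rsize F + 1 + b"
proof -
  have "rsize (push p 1 F) \<le> 2 * rsize F" for p
    by (intro rsize_dominated dominated_push dominated_refl)
  then show ?thesis
    using assms by (auto simp: peel_step_def intro!: dominated_push add_mono split: list.split)
qed

lemma ptime_peel [THEN ptime_comp4, ptime_intros]: "ptime (\<lambda>z. peel (fst z) (fst (snd z)) (fst (snd (snd z))) (snd (snd (snd z))))"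
proof -
  have "ptime (\<lambda>z. (peel_step (fst z) (fst (snd z)) (snd (snd (snd z))) ^^ fst (snd (snd z)))
    (snd (snd (snd z)), []))"
  proof (rule ptime_funpow)
    fix z :: "nat \<times> nat \<times> nat \<times> entry list" and j
    assume j: "j \<le> fst (snd (snd z))"
    let ?F = "snd (snd (snd z))"
    let ?st = "\<lambda>j. (peel_step (fst z) (fst (snd z)) ?F ^^ j) (?F, [])"
    have "dominated ?F (fst (?st j)) \<and> rsize (snd (?st j)) \<le> j * (2 * rsize ?F + 1)"
    proof (induction j)
      case 0
      show ?case by (simp add: dominated_refl)
    next
      case (Suc j)
      then show ?case
        unfolding funpow.simps comp_apply mult_Suc by (intro peel_step_bound) blast+
    qed
    moreover have "rsize (fst (?st j)) \<le> 2 * rsize ?F"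
      using calculation rsize_dominated by blast
    moreover have "j \<le> rsize z" "rsize ?F \<le> rsize z"
      using j by (cases z; auto)+
    moreover have "j * (2 * rsize ?F + 1) \<le> rsize z * (2 * rsize z + 1)"
      using calculation by (intro mult_mono) auto
    ultimately have "rsize (fst (?st j)) \<le> 2 * rsize z \<and>
      rsize (snd (?st j)) \<le> rsize z * (2 * rsize z + 1)" by linarith
    then show "rsize (?st j) \<le> 2 * rsize z + rsize z * (2 * rsize z + 1) + 1"
      by (cases "?st j") auto
  qed (intro ptime_intros ptime_comp4[OF ptime_peel_step] polybound_intros)+
  then show ?thesis unfolding peel_def by (intro ptime_intros)
qed

lemma ptime_network [THEN ptime_comp, ptime_intros]: "ptime network"
proof -
  have "ptime (\<lambda>xs. foldl (\<lambda>N x. Entry (length N) (fst x) (snd x) 1 0 # N) [] xs :: entry list)"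
  proof (rule ptime_foldl)
    fix xs ys zs :: "(nat \<times> nat) list" assume xs: "xs = ys @ zs"
    let ?N = "\<lambda>ys. foldl (\<lambda>N x. Entry (length N) (fst x) (snd x) 1 0 # N) [] ys :: entry list"
    have len: "length (?N ys) = length ys" for ys
      by (induction ys rule: rev_induct) auto
    have "rsize (?N ys) \<le> rsize ys * (length ys + 6)"
    proof (induction ys rule: rev_induct)
      case (snoc y ys)
      have "rsize (?N (ys @ [y])) = rsize (?N ys) + length ys + rsize y + 5"
        using len[of ys] by (cases y) (simp add: repr_entry_def)
      also have "\<dots> \<le> rsize ys * (length ys + 6) + (length ys + rsize y + 5)" using snoc by simp
      also have "\<dots> \<le> rsize (ys @ [y]) * (length (ys @ [y]) + 6)" by (simp add: algebra_simps)
      finally show ?case .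
    qed simp
    also have "\<dots> \<le> rsize xs * (rsize xs + 6)"
      using length_le_rsize[of ys] by (intro mult_mono) (auto simp: xs)
    finally show "rsize (?N ys) \<le> rsize xs * (rsize xs + 6)" .
  qed (intro ptime_intros polybound_intros)+
  then show ?thesis unfolding network_def by (intro ptime_intros)
qed

lemma ptime_critical [THEN ptime_comp2, ptime_intros]: "ptime (\<lambda>z. critical (fst z) (snd z))"
  unfolding critical_def by (intro ptime_intros)

lemma ptime_relaxed_network [THEN ptime_comp2, ptime_intros]: "ptime (\<lambda>z. relaxed_network (fst z) (snd z))"
  unfolding relaxed_network_def by (intro ptime_intros)

lemma ptime_saturated [THEN ptime_comp, ptime_intros]: "ptime saturated"
  unfolding saturated_def by (intro ptime_intros)

lemma ptime_solve: "ptime solve"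
  unfolding solve_def fault_tolerant_flows_def families_def Let_def by (intro ptime_intros)

section \<open>Pushing flow\<close>

text \<open>One linear functional for two purposes: weight 1 gives the mass, and potential
  differences give conservation and the flow across cuts. The effect of a push is computed once for
  both.\<close>

definition wsum :: "(nat \<Rightarrow> nat \<Rightarrow> int) \<Rightarrow> entry list \<Rightarrow> int" where
  "wsum w N = (\<Sum>e\<leftarrow>N. w (src e) (dst e) * int (flo e))"

definition shape :: "entry \<Rightarrow> nat \<times> nat \<times> nat \<times> nat" where
  "shape e = (eid e, src e, dst e, cap e)"

definition valid :: "entry list \<Rightarrow> bool" where
  "valid N \<longleftrightarrow> distinct (map eid N) \<and> (\<forall>e \<in> set N. flo e \<le> cap e)"

text \<open>Conservation and value at once: testing against the potential that is \<open>1\<close> at one vertex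
  and \<open>0\<close> elsewhere gives conservation, and testing against the indicator of a set of vertices
  gives the net flow across a cut.\<close>

definition is_flow :: "nat \<Rightarrow> nat \<Rightarrow> entry list \<Rightarrow> int \<Rightarrow> bool" where
  "is_flow s t N F \<longleftrightarrow> (\<forall>\<pi>. wsum (\<lambda>u v. \<pi> v - \<pi> u) N = F * (\<pi> t - \<pi> s))"

lemma eid_inj: "distinct (map eid N) \<Longrightarrow> e \<in> set N \<Longrightarrow> e' \<in> set N \<Longrightarrow> eid e = eid e' \<Longrightarrow> e = e'"
  by (simp add: distinct_map inj_on_def)

lemma sum_list_single:
  fixes g :: "entry \<Rightarrow> 'a::comm_monoid_add"
  assumes "distinct (map eid N)" "e \<in> set N"
  shows "(\<Sum>e'\<leftarrow>N. if eid e' = eid e then g e' else 0) = g e"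
  using assms
proof (induction N)
  case (Cons e' N)
  show ?case
  proof (cases "e' = e")
    case True
    then have "\<forall>e'' \<in> set N. eid e'' \<noteq> eid e" using Cons.prems by (auto simp: image_iff)
    then have "(\<Sum>e'\<leftarrow>N. if eid e' = eid e then g e' else 0) = (\<Sum>e'\<leftarrow>N. 0)"
      by (intro arg_cong[where f = sum_list] map_cong) auto
    with True show ?thesis by simp
  next
    case False
    with Cons show ?thesis by (auto simp: image_iff)
  qed
qed simp

definition legal :: "entry list \<Rightarrow> nat \<Rightarrow> arc \<Rightarrow> bool" where
  "legal N d a \<longleftrightarrow> aid a \<in> eid ` set N \<and> (\<forall>e \<in> set N. eid e = aid a \<longrightarrow>
     (if fwd a then atail a = src e \<and> ahead a = dst e \<and> flo e + d \<le> cap e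
      else atail a = dst e \<and> ahead a = src e \<and> d \<le> flo e))"

definition sign :: "arc \<Rightarrow> int" where
  "sign a = (if fwd a then 1 else - 1)"

definition arc_weight :: "(nat \<Rightarrow> nat \<Rightarrow> int) \<Rightarrow> arc \<Rightarrow> int" where
  "arc_weight w a = (if fwd a then w (atail a) (ahead a) else - w (ahead a) (atail a))"

text \<open>The change of the flow on \<open>e\<close> per unit pushed along
  \<open>p\<close>.\<close>

definition delta :: "arc list \<Rightarrow> entry \<Rightarrow> int" where
  "delta p e = (\<Sum>a\<leftarrow>p. if aid a = eid e then sign a else 0)"

lemma shape_adj [simp]: "shape (adj p d e) = shape e"
  by (simp add: shape_def adj_def)

lemma shape_push [simp]: "map shape (push p d N) = map shape N"
  by (simp add: push_def)

lemma eid_adj [simp]: "eid (adj p d e) = eid e" and src_adj [simp]: "src (adj p d e) = src e"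
  and dst_adj [simp]: "dst (adj p d e) = dst e" and cap_adj [simp]: "cap (adj p d e) = cap e"
  by (simp_all add: adj_def)

lemma delta_notin: "aid ` set p \<inter> {eid e} = {} \<Longrightarrow> delta p e = 0"
  unfolding delta_def by (induction p) auto

lemma delta_in:
  assumes "distinct (map aid p)" "a \<in> set p" "aid a = eid e"
  shows "delta p e = sign a"
proof -
  obtain p1 p2 where p: "p = p1 @ a # p2" using split_list[OF assms(2)] by blast
  have "delta p1 e = 0" "delta p2 e = 0"
    using assms(1,3) unfolding p by (auto intro!: delta_notin simp: image_iff)
  then show ?thesis using assms(3) by (simp add: delta_def p)
qed

lemma adj_notin: "aid ` set p \<inter> {eid e} = {} \<Longrightarrow> adj p d e = e"
  by (force simp: adj_def list_ex_iff)

lemma adj_in: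
  assumes "distinct (map aid p)" "a \<in> set p" "aid a = eid e"
  shows "adj p d e = (if fwd a then set_flo (min (cap e) (flo e + d)) e else set_flo (flo e - d) e)"
proof -
  have "b = a" if "b \<in> set p" "aid b = eid e" for b
    using assms that by (auto simp: distinct_map inj_on_def)
  then have "list_ex (\<lambda>b. aid b = eid e \<and> fwd b) p \<longleftrightarrow> fwd a"
    using assms(2,3) unfolding list_ex_iff by blast
  moreover have "list_ex (\<lambda>b. aid b = eid e) p"
    using assms(2,3) unfolding list_ex_iff by blast
  ultimately show ?thesis by (simp add: adj_def)
qed

lemma flo_adj:
  assumes "distinct (map aid p)" "e \<in> set N" "\<forall>a \<in> set p. legal N d a"
  shows "int (flo (adj p d e)) = int (flo e) + int d * delta p e"
proof (cases "eid e \<in> aid ` set p")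
  case True
  then obtain a where a: "a \<in> set p" "aid a = eid e" by force
  then have "legal N d a" using assms(3) by blast
  then show ?thesis
    using a assms(2) adj_in[OF assms(1) a] delta_in[OF assms(1) a]
    by (auto simp: legal_def sign_def split: if_splits)
next
  case False
  then have "aid ` set p \<inter> {eid e} = {}" by simp
  then show ?thesis by (simp add: adj_notin delta_notin)
qed

text \<open>Exchange of the summation over entries with that over arcs, by adding one arc at a
  time.\<close>

lemma wsum_delta:
  assumes "distinct (map eid N)" "\<forall>a \<in> set p. legal N d a"
  shows "(\<Sum>e\<leftarrow>N. w (src e) (dst e) * delta p e) = (\<Sum>a\<leftarrow>p. arc_weight w a)"
  using assms(2)
proof (induction p)
  case Nil
  show ?case by (simp add: delta_def)
next
  case (Cons a p)
  then have legal: "legal N d a" by simp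
  then obtain e where e: "e \<in> set N" "aid a = eid e" by (auto simp: legal_def)
  have "(\<Sum>e\<leftarrow>N. w (src e) (dst e) * delta (a # p) e) =
    (\<Sum>e'\<leftarrow>N. (if eid e' = eid e then w (src e') (dst e') * sign a else 0) + w (src e') (dst e') * delta p e')"
    by (intro arg_cong[where f = sum_list] map_cong) (auto simp: delta_def e(2) algebra_simps)
  also have "\<dots> = w (src e) (dst e) * sign a + (\<Sum>e\<leftarrow>N. w (src e) (dst e) * delta p e)"
    using sum_list_single[OF assms(1) e(1), of "\<lambda>e'. w (src e') (dst e') * sign a"]
    by (simp add: sum_list_addf)
  also have "w (src e) (dst e) * sign a = arc_weight w a"
    using legal e by (auto simp: legal_def arc_weight_def sign_def split: if_splits)
  finally show ?case using Cons by simp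
qed

lemma wsum_push:
  assumes "distinct (map eid N)" "distinct (map aid p)" "\<forall>a \<in> set p. legal N d a"
  shows "wsum w (push p d N) = wsum w N + int d * (\<Sum>a\<leftarrow>p. arc_weight w a)"
proof -
  have "wsum w (push p d N) = (\<Sum>e\<leftarrow>N. w (src e) (dst e) * int (flo (adj p d e)))"
    by (simp add: wsum_def push_def comp_def)
  also have "\<dots> = (\<Sum>e\<leftarrow>N. w (src e) (dst e) * int (flo e) + int d * (w (src e) (dst e) * delta p e))"
    by (intro arg_cong[where f = sum_list] map_cong)
      (auto simp: flo_adj[OF assms(2) _ assms(3)] algebra_simps)
  also have "\<dots> = wsum w N + int d * (\<Sum>e\<leftarrow>N. w (src e) (dst e) * delta p e)"
    by (simp add: sum_list_addf sum_list_const_mult wsum_def)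
  finally show ?thesis by (simp add: wsum_delta[OF assms(1,3)])
qed

lemma potential_arc_weight: "arc_weight (\<lambda>u v. \<pi> v - \<pi> u) a = \<pi> (ahead a) - \<pi> (atail a)"
  by (simp add: arc_weight_def)

lemma mass_wsum: "int (mass N) = wsum (\<lambda>_ _. 1) N"
  by (induction N) (auto simp: mass_def wsum_def)

lemma mass_push:
  assumes "distinct (map eid N)" "distinct (map aid p)" "\<forall>a \<in> set p. legal N d a"
  shows "int (mass (push p d N)) = int (mass N) + int d * (\<Sum>a\<leftarrow>p. sign a)"
proof -
  have "arc_weight (\<lambda>_ _. 1) = sign" by (simp add: arc_weight_def sign_def fun_eq_iff)
  then show ?thesis by (simp add: mass_wsum wsum_push[OF assms])
qed

lemma sum_sign_bounds: "\<bar>\<Sum>a\<leftarrow>p. sign a\<bar> \<le> int (length p)"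
  by (induction p) (auto simp: sign_def)

lemma valid_push:
  assumes "valid N"
  shows "valid (push p d N)"
proof -
  have "map eid (push p d N) = map eid N" by (simp add: push_def)
  moreover have "flo (adj p d e) \<le> cap e" if "e \<in> set N" for e
  proof -
    have "flo e \<le> cap e" using assms that by (simp add: valid_def)
    then show ?thesis by (auto simp: adj_def)
  qed
  ultimately show ?thesis using assms unfolding valid_def by (simp add: push_def comp_def)
qed

lemma legal_ends:
  assumes "legal N d a" "legal N d b" "aid a = aid b"
  shows "{atail a, ahead a} = {atail b, ahead b}"
proof -
  obtain e where "e \<in> set N" "eid e = aid a" using assms(1) by (auto simp: legal_def)
  then have "{atail a, ahead a} = {src e, dst e}" "{atail b, ahead b} = {src e, dst e}"
    using assms by (auto simp: legal_def split: if_splits)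
  then show ?thesis by simp
qed

lemma rpath_legal_distinct:
  "rpath A x p y \<Longrightarrow> \<forall>a \<in> A. legal N d a \<Longrightarrow> distinct (map aid p)"
  by (erule rpath_distinct_aid) (rule legal_ends, auto)

text \<open>The factor \<open>c\<close> covers paths from \<open>s\<close> to \<open>t\<close> with
  \<open>c = 1\<close>, which augment, and paths from \<open>t\<close> to \<open>s\<close> with
  \<open>c = - 1\<close>, which peel.\<close>

lemma is_flow_push:
  assumes "valid N" "is_flow s t N F" "rpath A x p y" "\<forall>a \<in> A. legal N d a"
    and "\<And>\<pi>. \<pi> y - \<pi> x = c * (\<pi> t - \<pi> s :: int)"
  shows "is_flow s t (push p d N) (F + int d * c)"
  unfolding is_flow_def
proof
  fix \<pi> :: "nat \<Rightarrow> int"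
  have "\<forall>a \<in> set p. legal N d a" using assms(4) rpath_subset[OF assms(3)] by blast
  then have "wsum (\<lambda>u v. \<pi> v - \<pi> u) (push p d N) =
    wsum (\<lambda>u v. \<pi> v - \<pi> u) N + int d * (\<pi> y - \<pi> x)"
    using wsum_push[OF _ rpath_legal_distinct[OF assms(3,4)]] assms(1) rpath_telescope[OF assms(3)]
    by (simp add: potential_arc_weight valid_def)
  also have "\<dots> = (F + int d * c) * (\<pi> t - \<pi> s)"
    using assms(2) by (simp add: is_flow_def assms(5) algebra_simps)
  finally show "wsum (\<lambda>u v. \<pi> v - \<pi> u) (push p d N) = (F + int d * c) * (\<pi> t - \<pi> s)" .
qed

section \<open>Cuts and maximum flows\<close>

definition leaving :: "nat set \<Rightarrow> entry \<Rightarrow> bool" where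
  "leaving S e \<longleftrightarrow> src e \<in> S \<and> dst e \<notin> S"

definition outcap :: "nat set \<Rightarrow> entry list \<Rightarrow> nat" where
  "outcap S N = (\<Sum>e\<leftarrow>N. if leaving S e then cap e else 0)"

definition tight :: "nat set \<Rightarrow> entry list \<Rightarrow> bool" where
  "tight S N \<longleftrightarrow> (\<forall>e \<in> set N. (leaving S e \<longrightarrow> flo e = cap e) \<and> (leaving (- S) e \<longrightarrow> flo e = 0))"

lemma outcap_shape: "map shape N = map shape N' \<Longrightarrow> outcap S N = outcap S N'"
proof -
  have *: "outcap S N = (\<Sum>(i, u, v, c)\<leftarrow>map shape N. if u \<in> S \<and> v \<notin> S then c else 0)" for N
    by (simp add: outcap_def shape_def leaving_def comp_def)
  show "map shape N = map shape N' \<Longrightarrow> outcap S N = outcap S N'" by (simp only: *)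
qed

lemma cut_flow:
  assumes "is_flow s t N F"
  shows "(\<Sum>e\<leftarrow>N. (if leaving S e then int (flo e) else 0) - (if leaving (- S) e then int (flo e) else 0))
    = F * (of_bool (t \<notin> S) - of_bool (s \<notin> S))"
proof -
  have "(\<Sum>e\<leftarrow>N. (if leaving S e then int (flo e) else 0) - (if leaving (- S) e then int (flo e) else 0))
    = wsum (\<lambda>u v. of_bool (v \<notin> S) - of_bool (u \<notin> S)) N"
    unfolding wsum_def by (intro arg_cong[where f = sum_list] map_cong) (auto simp: leaving_def)
  then show ?thesis
    using assms unfolding is_flow_def by (auto dest: spec[of _ "\<lambda>v. of_bool (v \<notin> S)"])
qed

lemma cut_gap:
  assumes "is_flow s t N F" "s \<in> S" "t \<notin> S" "valid N"
  shows "int (outcap S N) - F = int (\<Sum>e\<leftarrow>N.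
    (if leaving S e then cap e - flo e else 0) + (if leaving (- S) e then flo e else 0))"
proof -
  have "(\<Sum>e\<leftarrow>N. (if leaving S e then int (flo e) else 0) - (if leaving (- S) e then int (flo e) else 0)) = F"
    using cut_flow[OF assms(1), of S] assms(2,3) by simp
  moreover have "int (outcap S N) -
      (\<Sum>e\<leftarrow>N. (if leaving S e then int (flo e) else 0) - (if leaving (- S) e then int (flo e) else 0)) =
    int (\<Sum>e\<leftarrow>N. (if leaving S e then cap e - flo e else 0) + (if leaving (- S) e then flo e else 0))"
    if "\<forall>e \<in> set N. flo e \<le> cap e"
    using that unfolding outcap_def
    by (induction N) (auto simp: leaving_def of_nat_diff)
  ultimately show ?thesis using assms(4) by (simp add: valid_def)
qed

lemma flow_le_outcap:
  "is_flow s t N F \<Longrightarrow> s \<in> S \<Longrightarrow> t \<notin> S \<Longrightarrow> valid N \<Longrightarrow> F \<le> int (outcap S N)"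
  using cut_gap[of s t N F S] by (metis diff_ge_0_iff_ge of_nat_0_le_iff)

lemma tight_iff:
  assumes "is_flow s t N F" "s \<in> S" "t \<notin> S" "valid N"
  shows "tight S N \<longleftrightarrow> F = int (outcap S N)"
proof -
  let ?g = "\<lambda>e. (if leaving S e then cap e - flo e else 0) + (if leaving (- S) e then flo e else 0)"
  have "F = int (outcap S N) \<longleftrightarrow> (\<forall>e \<in> set N. ?g e = 0)"
    using cut_gap[OF assms] sum_list_eq_0_iff[of "map ?g N"] by fastforce
  also have "\<dots> \<longleftrightarrow> tight S N"
  proof -
    have "?g e = 0 \<longleftrightarrow> (leaving S e \<longrightarrow> flo e = cap e) \<and> (leaving (- S) e \<longrightarrow> flo e = 0)"
      if "e \<in> set N" for e
      using assms(4) that by (auto simp: valid_def)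
    then show ?thesis unfolding tight_def by (intro ball_cong refl)
  qed
  finally show ?thesis by blast
qed

lemma residual_legal:
  "distinct (map eid N) \<Longrightarrow> a \<in> set (residual N) \<Longrightarrow> legal N 1 a"
  by (auto simp: residual_def legal_def split: if_splits dest: eid_inj)

lemma residual_heads:
  "a \<in> set (residual N) \<Longrightarrow> ahead a \<in> src ` set N \<union> dst ` set N"
  by (auto simp: residual_def split: if_splits)

lemma residual_closed_tight:
  assumes "\<forall>a \<in> set (residual N). atail a \<in> S \<longrightarrow> ahead a \<in> S" "valid N"
  shows "tight S N"
  unfolding tight_def
proof (intro ballI conjI impI)
  fix e assume e: "e \<in> set N"
  show "flo e = cap e" if "leaving S e"
  proof (rule ccontr)
    assume "flo e \<noteq> cap e"
    then have "flo e < cap e" using e assms(2) by (auto simp: valid_def)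
    then have "Arc (src e) (dst e) (eid e) True \<in> set (residual N)" using e by (auto simp: residual_def)
    then show False using assms(1) that by (fastforce simp: leaving_def)
  qed
  show "flo e = 0" if "leaving (- S) e"
  proof (rule ccontr)
    assume "flo e \<noteq> 0"
    then have "Arc (dst e) (src e) (eid e) False \<in> set (residual N)" using e by (auto simp: residual_def)
    then show False using assms(1) that by (fastforce simp: leaving_def)
  qed
qed

lemma tight_residual:
  assumes "tight S N" "a \<in> set (residual N)" "atail a \<in> S"
  shows "ahead a \<in> S"
  using assms by (auto simp: residual_def tight_def leaving_def split: if_splits)

lemma outcap_le_sum: "outcap S N \<le> sum_list (map cap N)"
  unfolding outcap_def by (rule sum_list_mono) auto

definition over :: "nat set \<Rightarrow> entry list \<Rightarrow> bool" where
  "over V N \<longleftrightarrow> (\<forall>e \<in> set N. src e \<in> V \<and> dst e \<in> V)"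

lemma over_shape: "map shape N = map shape N' \<Longrightarrow> over V N = over V N'"
proof -
  have *: "over V N \<longleftrightarrow> (\<forall>(i, u, v, c) \<in> set (map shape N). u \<in> V \<and> v \<in> V)" for N
    by (auto simp: over_def shape_def)
  show "map shape N = map shape N' \<Longrightarrow> over V N = over V N'" by (simp only: *)
qed

lemma augment_flow:
  assumes "valid N" "is_flow s t N F" "over V N" "finite V" "s \<in> V"
    and path: "find_path (residual N) s t \<noteq> []"
  shows "valid (augment s t N)" "map shape (augment s t N) = map shape N"
    "is_flow s t (augment s t N) (1 + F)" "mass (augment s t N) \<le> mass N + card V"
proof -
  obtain p ps where p: "find_path (residual N) s t = p # ps"
    using path by (auto simp: neq_Nil_conv)
  then have aug: "augment s t N = push p 1 N" by (simp add: augment_def)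
  have rp: "rpath (set (residual N)) s p t" using find_path_rpath[of p "residual N" s t] p by simp
  have leg: "\<forall>a \<in> set (residual N). legal N 1 a"
    using residual_legal assms(1) by (auto simp: valid_def)
  have leg': "\<forall>a \<in> set p. legal N 1 a" using leg rpath_subset[OF rp] by blast
  have dist: "distinct (map aid p)" by (rule rpath_legal_distinct[OF rp leg])
  show "valid (augment s t N)" unfolding aug by (rule valid_push[OF assms(1)])
  show "map shape (augment s t N) = map shape N" by (simp add: aug)
  show "is_flow s t (augment s t N) (1 + F)"
    using is_flow_push[OF assms(1,2) rp leg, of 1] by (simp add: aug add.commute)
  have "ahead ` set (residual N) \<subseteq> V"
    using residual_heads assms(3) by (fastforce simp: over_def)
  then have "length p \<le> card V"
    using rpath_length[OF rp assms(4,5)] by simp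
  then show "mass (augment s t N) \<le> mass N + card V"
    using mass_push[OF _ dist leg'] assms(1) sum_sign_bounds[of p] by (simp add: aug valid_def)
qed

lemma is_flow_zero: "\<forall>e \<in> set N. flo e = 0 \<Longrightarrow> is_flow s t N 0"
proof -
  assume "\<forall>e \<in> set N. flo e = 0"
  then have "wsum w N = 0" for w unfolding wsum_def by (induction N) auto
  then show ?thesis by (simp add: is_flow_def)
qed

lemma mass_zero: "\<forall>e \<in> set N. flo e = 0 \<Longrightarrow> mass N = 0"
  unfolding mass_def by (induction N) auto

text \<open>Besides the minimum cut, the lemma records the length of the flow: each of the
  \<open>F\<close> augmentations runs along a simple path and adds at most
  \<open>card V\<close>.\<close>

lemma maxflow_correct:
  assumes "distinct (map eid N)" "\<forall>e \<in> set N. flo e = 0" "over V N" "finite V" "s \<in> V" "s \<noteq> t"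
  obtains F S where "valid (maxflow s t N)" "map shape (maxflow s t N) = map shape N"
    "is_flow s t (maxflow s t N) (int F)" "mass (maxflow s t N) \<le> F * card V"
    "s \<in> S" "t \<notin> S" "tight S (maxflow s t N)"
proof -
  let ?N = "\<lambda>j. (augment s t ^^ j) N"
  let ?K = "sum_list (map cap N)"
  have valid0: "valid N" using assms(1,2) by (simp add: valid_def)
  have inv: "\<exists>F. valid (?N j) \<and> map shape (?N j) = map shape N \<and> is_flow s t (?N j) (int F) \<and>
      mass (?N j) \<le> F * card V \<and> (find_path (residual (?N j)) s t = [] \<or> F = j)" for j
  proof (induction j)
    case 0
    show ?case
      using valid0 is_flow_zero[OF assms(2)] mass_zero[OF assms(2)] by (intro exI[of _ 0]) simp
  next
    case (Suc j)
    then obtain F where F: "valid (?N j)" "map shape (?N j) = map shape N"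
      "is_flow s t (?N j) (int F)" "mass (?N j) \<le> F * card V"
      "find_path (residual (?N j)) s t = [] \<or> F = j" by blast
    show ?case
    proof (cases "find_path (residual (?N j)) s t = []")
      case True
      then have "?N (Suc j) = ?N j" by (simp add: augment_def)
      then show ?thesis using F True by auto
    next
      case False
      have "over V (?N j)" using assms(3) over_shape[OF F(2)] by simp
      from augment_flow[OF F(1,3) this assms(4,5) False]
      show ?thesis using F False by (intro exI[of _ "Suc F"]) auto
    qed
  qed
  from inv[of ?K] obtain F where F: "valid (?N ?K)" "map shape (?N ?K) = map shape N"
      "is_flow s t (?N ?K) (int F)" "mass (?N ?K) \<le> F * card V"
      "find_path (residual (?N ?K)) s t = [] \<or> F = ?K" by blast
  have "find_path (residual (?N ?K)) s t = []"
  proof (rule ccontr)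
    assume path: "find_path (residual (?N ?K)) s t \<noteq> []"
    have "over V (?N ?K)" using assms(3) over_shape[OF F(2)] by simp
    note aug = augment_flow[OF F(1,3) this assms(4,5) path]
    \<comment> \<open>If all \<open>?K\<close> rounds had succeeded, another augmentation would push
      the value above the capacity of the cut \<open>{s}\<close>.\<close>
    have "1 + int F \<le> int (outcap {s} (augment s t (?N ?K)))"
      using flow_le_outcap[OF aug(3) _ _ aug(1)] assms(6) by simp
    also have "outcap {s} (augment s t (?N ?K)) = outcap {s} N"
      by (rule outcap_shape) (simp add: aug(2) F(2))
    also have "int (outcap {s} N) \<le> int ?K" using outcap_le_sum by simp
    finally show False using F(5) path by simp
  qed
  from find_path_Nil[OF this] obtain S where S: "s \<in> S" "t \<notin> S"
    "\<forall>a \<in> set (residual (?N ?K)). atail a \<in> S \<longrightarrow> ahead a \<in> S" by blast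
  have "tight S (?N ?K)" by (rule residual_closed_tight[OF S(3) F(1)])
  with F S that show thesis unfolding maxflow_def by blast
qed

section \<open>Cancelling cycles of inner entries\<close>

definition fits :: "entry list \<Rightarrow> arc \<Rightarrow> bool" where
  "fits N a \<longleftrightarrow> aid a \<in> eid ` set N \<and> (\<forall>e \<in> set N. eid e = aid a \<longrightarrow> inner e \<and>
     (if fwd a then atail a = src e \<and> ahead a = dst e else atail a = dst e \<and> ahead a = src e))"

text \<open>That potential differences add up to 0 says that the arcs form a closed walk, without
  fixing their order. So \<open>flip\<close> need not reverse the list.\<close>

definition inner_cycle :: "entry list \<Rightarrow> arc list \<Rightarrow> bool" where
  "inner_cycle N p \<longleftrightarrow> p \<noteq> [] \<and> distinct (map aid p) \<and> (\<forall>a \<in> set p. fits N a) \<and>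
     (\<forall>\<pi> :: nat \<Rightarrow> int. (\<Sum>a\<leftarrow>p. \<pi> (ahead a) - \<pi> (atail a)) = 0)"

lemma inner_cycle_flip:
  assumes "inner_cycle N p"
  shows "inner_cycle N (flip p)"
proof -
  have "(\<Sum>a\<leftarrow>flip p. \<pi> (ahead a) - \<pi> (atail a)) = - (\<Sum>a\<leftarrow>p. \<pi> (ahead a) - \<pi> (atail a))"
    for \<pi> :: "nat \<Rightarrow> int"
    by (induction p) (auto simp: flip_def)
  moreover have "map aid (flip p) = map aid p" "flip p = [] \<longleftrightarrow> p = []" by (simp_all add: flip_def)
  moreover have "\<forall>a \<in> set (flip p). fits N a"
    using assms by (auto simp: inner_cycle_def flip_def fits_def)
  ultimately show ?thesis using assms by (simp add: inner_cycle_def)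
qed

lemma sum_sign_flip: "(\<Sum>a\<leftarrow>flip p. sign a) = - (\<Sum>a\<leftarrow>p. sign a)"
  by (induction p) (auto simp: flip_def sign_def)

lemma foldl_min_bounds:
  "foldl min c rs \<le> (c :: nat) \<and> (\<forall>r \<in> set rs. foldl min c rs \<le> r) \<and> foldl min c rs \<in> insert c (set rs)"
proof (induction rs arbitrary: c)
  case (Cons r rs)
  show ?case using Cons[of "min c r"] by (auto simp: min_def split: if_splits)
qed simp

definition room :: "arc \<Rightarrow> entry \<Rightarrow> nat" where
  "room a e = (if fwd a then cap e - flo e else flo e)"

lemma set_rooms:
  assumes "distinct (map aid p)"
  shows "set (rooms p N) = {room a e | a e. a \<in> set p \<and> e \<in> set N \<and> aid a = eid e}"
proof -
  have *: "set (if list_ex (\<lambda>a. aid a = eid e \<and> fwd a) p then [cap e - flo e]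
      else if list_ex (\<lambda>a. aid a = eid e) p then [flo e] else []) =
      {room a e | a. a \<in> set p \<and> aid a = eid e}" for e
  proof (cases "\<exists>a \<in> set p. aid a = eid e")
    case True
    then obtain a where a: "a \<in> set p" "aid a = eid e" by blast
    have "b = a" if "b \<in> set p" "aid b = eid e" for b
      using assms that a by (auto simp: distinct_map inj_on_def)
    then have "{room a e | a. a \<in> set p \<and> aid a = eid e} = {room a e}"
      "list_ex (\<lambda>b. aid b = eid e \<and> fwd b) p \<longleftrightarrow> fwd a" "list_ex (\<lambda>b. aid b = eid e) p"
      using a unfolding list_ex_iff by blast+
    then show ?thesis by (simp add: room_def)
  next
    case False
    then show ?thesis by (auto simp: list_ex_iff)
  qed
  show ?thesis unfolding rooms_def set_concat set_map image_image * by blast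
qed

lemma cap_le_sum: "e \<in> set N \<Longrightarrow> cap e \<le> sum_list (map cap N)"
  by (rule member_le_sum_list) auto

lemma amount_props:
  assumes "inner_cycle N p" "valid N"
  shows "0 < amount p N" "\<forall>a \<in> set p. legal N (amount p N) a"
    "\<exists>a \<in> set p. \<exists>e \<in> set N. aid a = eid e \<and> amount p N = room a e"
proof -
  let ?R = "{room a e | a e. a \<in> set p \<and> e \<in> set N \<and> aid a = eid e}"
  have dist: "distinct (map aid p)" using assms(1) by (simp add: inner_cycle_def)
  have fits: "fits N a" if "a \<in> set p" for a using assms(1) that by (simp add: inner_cycle_def)
  have pos: "0 < room a e \<and> room a e \<le> sum_list (map cap N)"
    if "a \<in> set p" "e \<in> set N" "aid a = eid e" for a e
    using fits[OF that(1)] that cap_le_sum[OF that(2)]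
    by (auto simp: fits_def inner_def room_def)
  obtain a where a: "a \<in> set p"
    using assms(1) by (cases p) (auto simp: inner_cycle_def)
  then obtain e where e: "e \<in> set N" "aid a = eid e" using fits[OF a] by (auto simp: fits_def)
  have bounds: "amount p N \<le> sum_list (map cap N)" "\<forall>r \<in> ?R. amount p N \<le> r"
    "amount p N \<in> insert (sum_list (map cap N)) ?R"
    using foldl_min_bounds[of "sum_list (map cap N)" "rooms p N"]
    unfolding amount_def set_rooms[OF dist] by blast+
  have mem: "amount p N \<in> ?R"
  proof (cases "amount p N = sum_list (map cap N)")
    \<comment> \<open>The initial value of the fold is at least every room; a minimum equal to it is
      therefore attained by a room as well.\<close>
    case True
    have "room a e \<in> ?R" using a e by blast
    moreover from this have "amount p N \<le> room a e" using bounds(2) by blast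
    ultimately show ?thesis using True pos[OF a e] by simp
  next
    case False
    then show ?thesis using bounds(3) by blast
  qed
  then show "\<exists>a \<in> set p. \<exists>e \<in> set N. aid a = eid e \<and> amount p N = room a e" by blast
  then show "0 < amount p N" using pos by force
  show "\<forall>a \<in> set p. legal N (amount p N) a"
  proof
    fix a assume a: "a \<in> set p"
    have "amount p N \<le> room a e" if "e \<in> set N" "eid e = aid a" for e
      using bounds(2) a that by force
    then show "legal N (amount p N) a"
      using fits[OF a] assms(2) unfolding legal_def fits_def room_def valid_def
      by (auto split: if_splits) (metis add.commute le_diff_conv2)
  qed
qed

definition inner_ids :: "entry list \<Rightarrow> nat set" where
  "inner_ids N = eid ` {e \<in> set N. inner e}"

lemma finite_inner_ids [simp]: "finite (inner_ids N)"
  by (simp add: inner_ids_def)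

lemma card_inner_ids_le: "card (inner_ids N) \<le> length N"
proof -
  have "card (inner_ids N) \<le> card (eid ` set N)"
    unfolding inner_ids_def by (rule card_mono) auto
  also have "\<dots> \<le> length N" using card_image_le[of "set N" eid] card_length[of N] by simp
  finally show ?thesis .
qed

text \<open>Equal potential sums preserve conservation and value. Keeping the entries that are not
  inner ensures that none becomes inner again, and that rounding does not touch entries that are
  already integral.\<close>

definition evolves :: "entry list \<Rightarrow> entry list \<Rightarrow> bool" where
  "evolves N N' \<longleftrightarrow> valid N' \<and> map shape N' = map shape N \<and>
     (\<forall>\<pi>. wsum (\<lambda>u v. \<pi> v - \<pi> u) N' = wsum (\<lambda>u v. \<pi> v - \<pi> u) N) \<and>
     (\<forall>e \<in> set N. \<not> inner e \<longrightarrow> e \<in> set N')"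

lemma evolves_refl: "valid N \<Longrightarrow> evolves N N"
  by (simp add: evolves_def)

lemma evolves_trans: "evolves N N' \<Longrightarrow> evolves N' N'' \<Longrightarrow> evolves N N''"
  by (auto simp: evolves_def)

lemma evolves_inner_ids:
  assumes "evolves N N'"
  shows "inner_ids N' \<subseteq> inner_ids N"
proof
  fix i assume "i \<in> inner_ids N'"
  then obtain e' where e': "e' \<in> set N'" "inner e'" "i = eid e'" by (auto simp: inner_ids_def)
  have "shape e' \<in> shape ` set N" using assms e'(1) by (metis evolves_def image_eqI list.set_map)
  then obtain e where e: "e \<in> set N" "shape e = shape e'" by auto
  then have id: "eid e = eid e'" by (simp add: shape_def)
  have "inner e"
  proof (rule ccontr)
    assume "\<not> inner e"
    then have "e \<in> set N'" using assms e(1) by (simp add: evolves_def)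
    then have "e = e'" using assms e'(1) id by (auto simp: evolves_def valid_def intro: eid_inj)
    with e'(2) \<open>\<not> inner e\<close> show False by simp
  qed
  then show "i \<in> inner_ids N" using e(1) unfolding inner_ids_def e'(3) id[symmetric] by blast
qed

text \<open>An entry that attains the bottleneck ends at 0 or at its capacity and thus ceases to be
  inner.\<close>

lemma bump_props:
  assumes "inner_cycle N p" "valid N"
  shows "evolves N (bump p N)" "inner_ids (bump p N) \<subset> inner_ids N"
    "int (mass (bump p N)) = int (mass N) + int (amount p N) * (\<Sum>a\<leftarrow>p. sign a)"
proof -
  note am = amount_props[OF assms]
  have dist: "distinct (map aid p)" using assms(1) by (simp add: inner_cycle_def)
  have deid: "distinct (map eid N)" using assms(2) by (simp add: valid_def)
  have fits: "fits N a" if "a \<in> set p" for a using assms(1) that by (simp add: inner_cycle_def)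
  have "e \<in> set (bump p N)" if "e \<in> set N" "\<not> inner e" for e
  proof -
    have "eid e \<notin> aid ` set p" using fits that by (auto simp: fits_def)
    then have "adj p (amount p N) e = e" by (intro adj_notin) simp
    then show ?thesis using that(1) by (force simp: bump_def push_def)
  qed
  then show ev: "evolves N (bump p N)"
    using valid_push[OF assms(2)] wsum_push[OF deid dist am(2)] assms(1)
    by (simp add: evolves_def bump_def potential_arc_weight inner_cycle_def)
  obtain a e where ae: "a \<in> set p" "e \<in> set N" "aid a = eid e" "amount p N = room a e"
    using am(3) by blast
  have inner: "inner e" using fits[OF ae(1)] ae by (auto simp: fits_def)
  let ?e = "adj p (amount p N) e"
  have e': "?e \<in> set (bump p N)" using ae(2) by (simp add: bump_def push_def)
  have "\<not> inner ?e"
    using inner adj_in[OF dist ae(1,3), of "room a e"] by (auto simp: inner_def ae(4) room_def)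
  moreover have "x = ?e" if "x \<in> set (bump p N)" "eid x = eid e" for x
    using ev e' that by (intro eid_inj[of "bump p N"]) (auto simp: evolves_def valid_def)
  ultimately have "eid e \<notin> inner_ids (bump p N)"
    by (force simp: inner_ids_def)
  moreover have "eid e \<in> inner_ids N" using inner ae(2) by (auto simp: inner_ids_def)
  ultimately show "inner_ids (bump p N) \<subset> inner_ids N"
    using evolves_inner_ids[OF ev] by blast
  show "int (mass (bump p N)) = int (mass N) + int (amount p N) * (\<Sum>a\<leftarrow>p. sign a)"
    unfolding bump_def by (rule mass_push[OF deid dist am(2)])
qed

lemma inner_arcs_fits:
  "distinct (map eid N) \<Longrightarrow> a \<in> set (inner_arcs N i) \<Longrightarrow> fits N a \<and> aid a \<noteq> i"
  by (auto simp: inner_arcs_def fits_def split: if_splits dest: eid_inj)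

lemma fits_legal: "valid N \<Longrightarrow> fits N a \<Longrightarrow> legal N 0 a"
  by (auto simp: fits_def legal_def valid_def)

lemma inner_cycles_props:
  assumes "valid N" "over V N" "finite V" "p \<in> set (inner_cycles N)"
  shows "inner_cycle N p" "length p \<le> card V"
proof -
  have deid: "distinct (map eid N)" using assms(1) by (simp add: valid_def)
  obtain e q where e: "e \<in> set N" "inner e"
      "q \<in> set (find_path (inner_arcs N (eid e)) (dst e) (src e))"
    and p: "p = Arc (src e) (dst e) (eid e) True # q"
    using assms(4) by (auto simp: inner_cycles_def split: if_splits)
  let ?A = "set (inner_arcs N (eid e))"
  have rp: "rpath ?A (dst e) q (src e)" by (rule find_path_rpath[OF e(3)])
  have A: "\<forall>a \<in> ?A. legal N 0 a"
    using inner_arcs_fits[OF deid] fits_legal[OF assms(1)] by blast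
  have q: "fits N a" "aid a \<noteq> eid e" if "a \<in> set q" for a
    using rpath_subset[OF rp] that inner_arcs_fits[OF deid] by blast+
  have "eid e \<notin> aid ` set q" using q(2) by force
  then have "distinct (map aid p)"
    using rpath_legal_distinct[OF rp A] by (simp add: p)
  moreover have "fits N (Arc (src e) (dst e) (eid e) True)"
    using e eid_inj[OF deid] by (auto simp: fits_def)
  moreover have "(\<Sum>a\<leftarrow>p. \<pi> (ahead a) - \<pi> (atail a)) = 0" for \<pi> :: "nat \<Rightarrow> int"
    using rpath_telescope[OF rp, of \<pi>] by (simp add: p)
  ultimately show "inner_cycle N p"
    using q(1) by (auto simp: inner_cycle_def p)
  have "ahead ` ?A \<subseteq> V"
    using assms(2) by (auto simp: inner_arcs_def over_def split: if_splits)
  moreover have "dst e \<in> V" using e(1) assms(2) by (simp add: over_def)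
  ultimately show "length p \<le> card V"
    using rpath_length[OF rp assms(3)] by (simp add: p)
qed

lemma amount_le:
  assumes "inner_cycle N p" "valid N" "\<forall>e \<in> set N. cap e \<le> C"
  shows "amount p N \<le> C"
proof -
  obtain a e where "e \<in> set N" "amount p N = room a e" using amount_props(3)[OF assms(1,2)] by blast
  moreover have "room a e \<le> cap e"
    using calculation(1) assms(2) by (simp add: room_def valid_def)
  ultimately show ?thesis using assms(3) by fastforce
qed

lemma cancel_step_props:
  assumes "valid N" "over V N" "finite V" "\<forall>e \<in> set N. cap e \<le> C" "inner_cycles N \<noteq> []"
  shows "evolves N (cancel_step T N)" "inner_ids (cancel_step T N) \<subset> inner_ids N"
    "T \<le> mass N \<Longrightarrow> mass (cancel_step T N) \<le> mass N"
    "\<not> T \<le> mass N \<Longrightarrow> mass N \<le> mass (cancel_step T N)"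
    "\<bar>int (mass (cancel_step T N)) - int (mass N)\<bar> \<le> int (C * card V)"
proof -
  obtain p ps where p: "inner_cycles N = p # ps" using assms(5) by (auto simp: neq_Nil_conv)
  have cyc: "inner_cycle N p" and len: "length p \<le> card V"
    using inner_cycles_props[OF assms(1-3), of p] p by auto
  note b = bump_props[OF cyc assms(1)]
  note b' = bump_props[OF inner_cycle_flip[OF cyc] assms(1)]
  have am: "amount p N \<le> C" "amount (flip p) N \<le> C"
    using amount_le[OF _ assms(1,4)] cyc inner_cycle_flip by blast+
  let ?\<sigma> = "\<Sum>a\<leftarrow>p. sign a"
  have step: "cancel_step T N = (if (T \<le> mass N) = (mass (bump p N) \<le> mass (bump (flip p) N))
      then bump p N else bump (flip p) N)"
    by (simp add: cancel_step_def p)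
  then show "evolves N (cancel_step T N)" "inner_ids (cancel_step T N) \<subset> inner_ids N"
    using b(1,2) b'(1,2) by auto
  \<comment> \<open>The amounts for the two directions may differ, but the signs of the arcs add up
    to opposite numbers, so one direction does not raise the mass and the other does not lower
    it.\<close>
  have two: "mass (bump p N) \<le> mass N \<and> mass N \<le> mass (bump (flip p) N) \<or>
    mass (bump (flip p) N) \<le> mass N \<and> mass N \<le> mass (bump p N)"
  proof (cases "0 \<le> ?\<sigma>")
    case True
    then have "0 \<le> int (amount p N) * ?\<sigma>" "0 \<le> int (amount (flip p) N) * ?\<sigma>" by simp_all
    then show ?thesis using b(3) b'(3) unfolding sum_sign_flip by simp
  next
    case False
    then have "int (amount p N) * ?\<sigma> \<le> 0" "int (amount (flip p) N) * ?\<sigma> \<le> 0"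
      by (simp_all add: mult_nonneg_nonpos)
    then show ?thesis using b(3) b'(3) unfolding sum_sign_flip by simp
  qed
  show "T \<le> mass N \<Longrightarrow> mass (cancel_step T N) \<le> mass N"
    "\<not> T \<le> mass N \<Longrightarrow> mass N \<le> mass (cancel_step T N)"
    using two unfolding step by auto
  have "\<bar>int d * ?\<sigma>\<bar> \<le> int (C * card V)" if "d \<le> C" for d
  proof -
    have "\<bar>int d * ?\<sigma>\<bar> = int d * \<bar>?\<sigma>\<bar>" by (simp add: abs_mult)
    also have "\<dots> \<le> int C * int (card V)"
      using that len sum_sign_bounds[of p] by (intro mult_mono) auto
    finally show ?thesis by simp
  qed
  then show "\<bar>int (mass (cancel_step T N)) - int (mass N)\<bar> \<le> int (C * card V)"
    using b(3) b'(3) am unfolding step sum_sign_flip by auto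
qed

text \<open>The mass moves towards \<open>T\<close> and can jump past it only by the change of a
  single step, which is at most \<open>C * card V\<close>: the bottleneck times the length of the
  cycle. Within this distance of \<open>T\<close> it then remains.\<close>

lemma cancel_correct:
  assumes "valid N" "over V N" "finite V" "\<forall>e \<in> set N. cap e \<le> C"
  shows "evolves N (cancel T N)" "inner_cycles (cancel T N) = []"
    "mass (cancel T N) \<le> max (mass N) (T + C * card V)"
    "min (mass N) (T - C * card V) \<le> mass (cancel T N)"
proof -
  let ?N = "\<lambda>j. (cancel_step T ^^ j) N"
  have inv: "evolves N (?N j) \<and> mass (?N j) \<le> max (mass N) (T + C * card V) \<and>
      min (mass N) (T - C * card V) \<le> mass (?N j) \<and>
      (inner_cycles (?N j) = [] \<or> card (inner_ids (?N j)) + j \<le> length N)" for j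
  proof (induction j)
    case 0
    show ?case using evolves_refl[OF assms(1)] card_inner_ids_le[of N] by simp
  next
    case (Suc j)
    show ?case
    proof (cases "inner_cycles (?N j) = []")
      case True
      then have "?N (Suc j) = ?N j" by (simp add: cancel_step_def)
      then show ?thesis using Suc True by simp
    next
      case False
      have ev: "evolves N (?N j)" using Suc by blast
      then have sh: "map shape (?N j) = map shape N" and val: "valid (?N j)"
        by (simp_all add: evolves_def)
      have ov: "over V (?N j)" using over_shape[OF sh] assms(2) by simp
      have "\<forall>e \<in> set (?N j). cap e \<le> C"
      proof
        fix e assume "e \<in> set (?N j)"
        then have "shape e \<in> shape ` set N" using sh by (metis image_eqI list.set_map)
        then show "cap e \<le> C" using assms(4) by (auto simp: shape_def)
      qed
      note st = cancel_step_props[OF val ov assms(3) this False, of T]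
      have "card (inner_ids (?N (Suc j))) < card (inner_ids (?N j))"
        using psubset_card_mono[OF _ st(2)] by simp
      then have "card (inner_ids (?N (Suc j))) + Suc j \<le> length N" using Suc False by simp
      moreover have "evolves N (?N (Suc j))" using evolves_trans[OF ev st(1)] by simp
      moreover have "mass (?N (Suc j)) \<le> max (mass N) (T + C * card V) \<and>
        min (mass N) (T - C * card V) \<le> mass (?N (Suc j))"
      proof -
        let ?D = "C * card V"
        have "mass (?N (Suc j)) \<le> mass (?N j) + ?D" "mass (?N j) \<le> mass (?N (Suc j)) + ?D"
          using st(5) unfolding funpow.simps comp_apply by linarith+
        moreover have "mass (?N j) \<le> max (mass N) (T + ?D)" "min (mass N) (T - ?D) \<le> mass (?N j)"
          using Suc by blast+
        moreover have "T \<le> mass (?N j) \<Longrightarrow> mass (?N (Suc j)) \<le> mass (?N j)"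
          "\<not> T \<le> mass (?N j) \<Longrightarrow> mass (?N j) \<le> mass (?N (Suc j))"
          using st(3,4) by simp_all
        ultimately show ?thesis by linarith
      qed
      ultimately show ?thesis by blast
    qed
  qed
  have "inner_cycles (?N (length N)) = []"
  proof (rule ccontr)
    assume *: "inner_cycles (?N (length N)) \<noteq> []"
    then have "card (inner_ids (?N (length N))) = 0" using inv[of "length N"] by simp
    then have "\<forall>e \<in> set (?N (length N)). \<not> inner e" by (auto simp: inner_ids_def)
    then have "inner_cycles (?N (length N)) = []" by (auto simp: inner_cycles_def)
    with * show False by simp
  qed
  then show "evolves N (cancel T N)" "inner_cycles (cancel T N) = []"
    "mass (cancel T N) \<le> max (mass N) (T + C * card V)"
    "min (mass N) (T - C * card V) \<le> mass (cancel T N)"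
    using inv[of "length N"] by (simp_all add: cancel_def)
qed

section \<open>Forests of inner entries\<close>

text \<open>\<open>S\<close> is the side of \<open>dst e\<close> after removal of \<open>e\<close>.
  Every other inner entry can be traversed both ways, so none of them crosses the boundary of a
  closed set.\<close>

lemma no_inner_cycles_separated:
  assumes "inner_cycles N = []" "e \<in> set N" "inner e"
  shows "\<exists>S. dst e \<in> S \<and> src e \<notin> S \<and>
    (\<forall>e' \<in> set N. inner e' \<and> eid e' \<noteq> eid e \<longrightarrow> (src e' \<in> S \<longleftrightarrow> dst e' \<in> S))"
proof -
  have "find_path (inner_arcs N (eid e)) (dst e) (src e) = []"
    using assms by (auto simp: inner_cycles_def)
  from find_path_Nil[OF this] obtain S where S: "dst e \<in> S" "src e \<notin> S"
    "\<forall>a \<in> set (inner_arcs N (eid e)). atail a \<in> S \<longrightarrow> ahead a \<in> S" by blast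
  have "src e' \<in> S \<longleftrightarrow> dst e' \<in> S" if "e' \<in> set N" "inner e'" "eid e' \<noteq> eid e" for e'
  proof -
    have "Arc (src e') (dst e') (eid e') True \<in> set (inner_arcs N (eid e))"
      "Arc (dst e') (src e') (eid e') False \<in> set (inner_arcs N (eid e))"
      using that by (auto simp: inner_arcs_def)
    then show ?thesis using S(3) by fastforce
  qed
  with S show ?thesis by blast
qed

text \<open>A forest is described by each edge being the only one across some set. The induction
  contracts the edge \<open>e\<close> by the map \<open>\<phi>\<close>; a set that separates another
  edge does not separate the ends of \<open>e\<close>, so it survives the contraction.\<close>

lemma forest_card:
  fixes u v :: "'e \<Rightarrow> 'v"
  assumes "finite E" "finite V" "\<And>e. e \<in> E \<Longrightarrow> u e \<in> V \<and> v e \<in> V"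
    and "\<And>e. e \<in> E \<Longrightarrow>
      \<exists>S. v e \<in> S \<and> u e \<notin> S \<and> (\<forall>e' \<in> E - {e}. u e' \<in> S \<longleftrightarrow> v e' \<in> S)"
  shows "card E \<le> card V"
  using assms
proof (induction E arbitrary: V u v rule: finite_induct)
  case (insert e E)
  define \<phi> where "\<phi> x = (if x = v e then u e else x)" for x
  have ne: "u e \<noteq> v e" using insert.prems(3)[of e] by auto
  have eV: "u e \<in> V" "v e \<in> V" using insert.prems(2)[of e] by auto
  have "card E \<le> card (V - {v e})"
  proof (rule insert.IH[where u = "\<phi> \<circ> u" and v = "\<phi> \<circ> v"])
    show "finite (V - {v e})" using insert.prems(1) by simp
    show "(\<phi> \<circ> u) e' \<in> V - {v e} \<and> (\<phi> \<circ> v) e' \<in> V - {v e}" if "e' \<in> E" for e'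
      using insert.prems(2)[of e'] that ne eV by (auto simp: \<phi>_def)
    show "\<exists>S. (\<phi> \<circ> v) e' \<in> S \<and> (\<phi> \<circ> u) e' \<notin> S \<and>
      (\<forall>e'' \<in> E - {e'}. (\<phi> \<circ> u) e'' \<in> S \<longleftrightarrow> (\<phi> \<circ> v) e'' \<in> S)" if e': "e' \<in> E" for e'
    proof -
      obtain S where S: "v e' \<in> S" "u e' \<notin> S"
        "\<forall>e'' \<in> insert e E - {e'}. u e'' \<in> S \<longleftrightarrow> v e'' \<in> S"
        using insert.prems(3)[of e'] e' by auto
      have "u e \<in> S \<longleftrightarrow> v e \<in> S" using S(3) e' insert.hyps(2) by blast
      then have "\<phi> x \<in> S \<longleftrightarrow> x \<in> S" for x by (simp add: \<phi>_def)
      then show ?thesis using S by (intro exI[of _ S]) auto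
    qed
  qed
  moreover have "card (V - {v e}) = card V - 1" "0 < card V"
    using eV(2) insert.prems(1) by (auto simp: card_gt_0_iff)
  ultimately show ?case using insert.hyps by simp
qed simp

lemma inner_forest:
  assumes "inner_cycles N = []" "distinct (map eid N)" "over V N" "finite V"
  shows "length (filter inner N) \<le> card V"
proof -
  let ?E = "{e \<in> set N. inner e}"
  have "card ?E \<le> card V"
  proof (rule forest_card[where u = src and v = dst])
    show "src e \<in> V \<and> dst e \<in> V" if "e \<in> ?E" for e using that assms(3) by (simp add: over_def)
    fix e assume e: "e \<in> ?E"
    then obtain S where "dst e \<in> S" "src e \<notin> S"
      "\<forall>e' \<in> set N. inner e' \<and> eid e' \<noteq> eid e \<longrightarrow> (src e' \<in> S \<longleftrightarrow> dst e' \<in> S)"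
      using no_inner_cycles_separated[OF assms(1)] by blast
    moreover have "eid e' \<noteq> eid e" if "e' \<in> ?E - {e}" for e'
      using eid_inj[OF assms(2)] that e by blast
    ultimately show "\<exists>S. dst e \<in> S \<and> src e \<notin> S \<and> (\<forall>e' \<in> ?E - {e}. src e' \<in> S \<longleftrightarrow> dst e' \<in> S)"
      by (intro exI[of _ S]) blast
  qed (use assms(4) in auto)
  moreover have "length (filter inner N) = card ?E"
    using distinct_card[of "filter inner N"] assms(2) by (simp add: distinct_map)
  ultimately show ?thesis by simp
qed

text \<open>An inner entry \<open>e\<close> of a forest is the only inner entry across some set
  \<open>S\<close>. The other entries across \<open>S\<close> have flow 0 or \<open>k\<close>, and
  the net flow across \<open>S\<close> is a multiple of \<open>k\<close>; so \<open>k\<close>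
  divides the flow on \<open>e\<close>, which lies strictly between 0 and \<open>k\<close>.\<close>

lemma no_inner_if_divisible:
  assumes "inner_cycles N = []" "valid N" "\<forall>e \<in> set N. cap e = k" "is_flow s t N (int k * F)"
    and "e \<in> set N"
  shows "\<not> inner e"
proof
  assume inner: "inner e"
  obtain S where S: "dst e \<in> S" "src e \<notin> S"
    "\<forall>e' \<in> set N. inner e' \<and> eid e' \<noteq> eid e \<longrightarrow> (src e' \<in> S \<longleftrightarrow> dst e' \<in> S)"
    using no_inner_cycles_separated[OF assms(1,5) inner] by blast
  let ?\<pi> = "\<lambda>x. of_bool (x \<in> S) :: int"
  let ?g = "\<lambda>e. (?\<pi> (dst e) - ?\<pi> (src e)) * int (flo e)"
  have deid: "distinct (map eid N)" using assms(2) by (simp add: valid_def)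
  then have "distinct N" by (simp add: distinct_map)
  then have "wsum (\<lambda>u v. ?\<pi> v - ?\<pi> u) N = (\<Sum>e \<in> set N. ?g e)"
    by (simp add: wsum_def sum_list_distinct_conv_sum_set)
  also have "\<dots> = ?g e + (\<Sum>e \<in> set N - {e}. ?g e)"
    using assms(5) by (simp add: sum.remove)
  finally have sum: "?g e + (\<Sum>e \<in> set N - {e}. ?g e) = int k * F * (?\<pi> t - ?\<pi> s)"
    using assms(4) by (metis is_flow_def)
  have "int k dvd (\<Sum>e \<in> set N - {e}. ?g e)"
  proof (rule dvd_sum)
    fix e' assume e': "e' \<in> set N - {e}"
    then have id: "eid e' \<noteq> eid e" using eid_inj[OF deid] assms(5) by blast
    show "int k dvd ?g e'"
    proof (cases "inner e'")
      case True
      then show ?thesis using S(3) e' id by simp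
    next
      case False
      have "flo e' \<le> cap e'" "cap e' = k" using e' assms(2,3) by (auto simp: valid_def)
      then have "flo e' = 0 \<or> flo e' = k" using False by (auto simp: inner_def)
      then show ?thesis by auto
    qed
  qed
  then have "int k dvd ?g e"
    using sum by (simp only: eq_diff_eq[symmetric] dvd_diff mult.assoc dvd_triv_left)
  then have "k dvd flo e" using S(1,2) by simp
  then show False using inner assms(3,5) by (auto simp: inner_def dest: dvd_imp_le)
qed

section \<open>Splitting and peeling\<close>

text \<open>A lookup by id, written as a sum to be total. Flows on different lists of entries are
  compared through it.\<close>

definition fl :: "entry list \<Rightarrow> nat \<Rightarrow> nat" where
  "fl N i = (\<Sum>e\<leftarrow>N. if eid e = i then flo e else 0)"

text \<open>In contrast to \<open>shape\<close> it omits the capacity, which rounding and splitting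
  overwrite.\<close>

definition ends :: "entry \<Rightarrow> nat \<times> nat \<times> nat" where
  "ends e = (eid e, src e, dst e)"

lemma fl_eid: "distinct (map eid N) \<Longrightarrow> e \<in> set N \<Longrightarrow> fl N (eid e) = flo e"
  unfolding fl_def by (rule sum_list_single)

lemma ends_eid: "map ends N' = map ends N \<Longrightarrow> map eid N' = map eid N"
proof -
  have *: "map eid N = map fst (map ends N)" for N by (simp add: ends_def)
  show "map ends N' = map ends N \<Longrightarrow> map eid N' = map eid N" unfolding * by simp
qed

lemma shape_ends: "map shape N' = map shape N \<Longrightarrow> map ends N' = map ends N"
proof -
  have *: "map ends N = map (\<lambda>(i, u, v, c). (i, u, v)) (map shape N)" for N
    by (simp add: ends_def shape_def)
  show "map shape N' = map shape N \<Longrightarrow> map ends N' = map ends N" unfolding * by simp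
qed

lemma ends_over: "map ends N' = map ends N \<Longrightarrow> over V N' = over V N"
proof -
  have *: "over V N \<longleftrightarrow> (\<forall>(i, u, v) \<in> set (map ends N). u \<in> V \<and> v \<in> V)" for N
    by (auto simp: over_def ends_def)
  show "map ends N' = map ends N \<Longrightarrow> over V N' = over V N" unfolding * by simp
qed

lemma ends_corresponding:
  assumes "map ends N' = map ends N" "e \<in> set N"
  obtains e' where "e' \<in> set N'" "eid e' = eid e" "src e' = src e" "dst e' = dst e"
proof -
  have "ends e \<in> ends ` set N'" using assms by (metis image_eqI list.set_map)
  then show thesis using that by (auto simp: ends_def)
qed

lemma wsum_ends:
  assumes "map ends N' = map ends N" "distinct (map eid N)"
  shows "wsum w N' = (\<Sum>e\<leftarrow>N. w (src e) (dst e) * int (fl N' (eid e)))"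
proof -
  have "distinct (map eid N')" using assms ends_eid[OF assms(1)] by simp
  then have "wsum w N' = (\<Sum>e\<leftarrow>N'. w (src e) (dst e) * int (fl N' (eid e)))"
    unfolding wsum_def by (intro arg_cong[where f = sum_list] map_cong) (auto simp: fl_eid)
  also have "\<dots> = (\<Sum>(i, u, v)\<leftarrow>map ends N'. w u v * int (fl N' i))"
    by (simp add: ends_def comp_def)
  also have "\<dots> = (\<Sum>e\<leftarrow>N. w (src e) (dst e) * int (fl N' (eid e)))"
    unfolding assms(1) by (simp add: ends_def comp_def)
  finally show ?thesis .
qed

lemma int_sum_list: "int (\<Sum>x\<leftarrow>xs. f x) = (\<Sum>x\<leftarrow>xs. int (f x))"
  by (induction xs) auto

lemma mass_ends:
  assumes "map ends N' = map ends N" "distinct (map eid N)"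
  shows "mass N' = (\<Sum>e\<leftarrow>N. fl N' (eid e))"
  using mass_wsum[of N'] wsum_ends[OF assms, of "\<lambda>_ _. 1"]
  by (simp add: int_sum_list flip: of_nat_eq_iff[where 'a = int])

lemma rounded_correct:
  fixes \<tau> :: nat
  assumes "distinct (map eid H)" "\<forall>e \<in> set H. flo e \<le> k" "is_flow s t H (int k * F)"
    "over V H" "finite V"
  defines "K \<equiv> rounded \<tau> k H"
  shows "map ends K = map ends H" "\<forall>e \<in> set H. fl K (eid e) \<in> {0, k}"
    "\<forall>e \<in> set H. flo e \<in> {0, k} \<longrightarrow> fl K (eid e) = flo e" "is_flow s t K (int k * F)"
    "mass K \<le> max (mass H) (k * (\<tau> + card V))" "min (mass H) (k * (\<tau> - card V)) \<le> mass K"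
proof -
  let ?H = "map (set_cap k) H"
  have H: "valid ?H" "over V ?H" "\<forall>e \<in> set ?H. cap e \<le> k" "mass ?H = mass H"
    using assms(1,2,4) by (auto simp: valid_def over_def mass_def comp_def)
  note can = cancel_correct[OF H(1,2) assms(5) H(3), of "k * \<tau>"]
  have K: "K = cancel (k * \<tau>) ?H" by (simp add: K_def rounded_def)
  have ev: "evolves ?H K" using can(1) K by simp
  have "map ends K = map ends ?H" using ev by (intro shape_ends) (simp add: evolves_def)
  then show ends: "map ends K = map ends H" by (simp add: ends_def comp_def)
  have vK: "valid K" using ev by (simp add: evolves_def)
  have "wsum w ?H = wsum w H" for w by (simp add: wsum_def comp_def)
  then show flow: "is_flow s t K (int k * F)"
    using ev assms(3) by (simp add: evolves_def is_flow_def)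
  have cap: "\<forall>e \<in> set K. cap e = k"
  proof
    fix e assume "e \<in> set K"
    then have "shape e \<in> shape ` set ?H" using ev by (metis evolves_def image_eqI list.set_map)
    then show "cap e = k" by (auto simp: shape_def)
  qed
  have no: "\<not> inner e" if "e \<in> set K" for e
    using no_inner_if_divisible[OF _ vK cap flow that] can(2) K by simp
  have dK: "distinct (map eid K)" using vK by (simp add: valid_def)
  show "\<forall>e \<in> set H. fl K (eid e) \<in> {0, k}"
  proof
    fix e assume "e \<in> set H"
    then obtain e' where e': "e' \<in> set K" "eid e' = eid e"
      using ends_corresponding[OF ends] by metis
    then have "fl K (eid e) = flo e'" using fl_eid[OF dK e'(1)] by simp
    moreover have "flo e' \<le> cap e'" "cap e' = k" using e'(1) vK cap by (auto simp: valid_def)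
    ultimately show "fl K (eid e) \<in> {0, k}" using no[OF e'(1)] by (auto simp: inner_def)
  qed
  show "\<forall>e \<in> set H. flo e \<in> {0, k} \<longrightarrow> fl K (eid e) = flo e"
  proof (intro ballI impI)
    fix e assume e: "e \<in> set H" "flo e \<in> {0, k}"
    then have "\<not> inner (set_cap k e)" by (auto simp: inner_def)
    then have "set_cap k e \<in> set K" using ev e(1) by (auto simp: evolves_def)
    then show "fl K (eid e) = flo e" using fl_eid[OF dK, of "set_cap k e"] by simp
  qed
  show "mass K \<le> max (mass H) (k * (\<tau> + card V))" "min (mass H) (k * (\<tau> - card V)) \<le> mass K"
    using can(3,4) by (simp_all add: H(4) K add_mult_distrib2 diff_mult_distrib2)
qed

lemma uses_iff:
  assumes "map ends K = map ends H" "distinct (map eid H)" "e \<in> set H"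
  shows "uses K e \<longleftrightarrow> 0 < fl K (eid e)"
proof -
  have dK: "distinct (map eid K)" using assms(1,2) ends_eid by metis
  obtain e' where e': "e' \<in> set K" "eid e' = eid e" using ends_corresponding[OF assms(1,3)] by metis
  have "fl K (eid e) = flo e'" using fl_eid[OF dK e'(1)] e'(2) by simp
  moreover have "e'' = e'" if "e'' \<in> set K" "eid e'' = eid e" for e''
    using eid_inj[OF dK] that e' by metis
  ultimately show ?thesis using e' unfolding uses_def list_ex_iff by metis
qed

lemma ends_support [simp]: "map ends (support K H) = map ends H"
  by (simp add: support_def ends_def comp_def)

lemma ends_without [simp]: "map ends (without K H) = map ends H"
  by (simp add: without_def ends_def comp_def)

lemma fl_support:
  assumes "distinct (map eid H)" "e \<in> set H"
  shows "fl (support K H) (eid e) = of_bool (uses K e)"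
proof -
  have "distinct (map eid (support K H))" using assms(1) ends_eid[OF ends_support] by metis
  moreover have "set_cap 1 (set_flo (if uses K e then 1 else 0) e) \<in> set (support K H)"
    using assms(2) by (simp add: support_def)
  ultimately show ?thesis using fl_eid[of "support K H"] by fastforce
qed

lemma fl_without:
  assumes "distinct (map eid H)" "e \<in> set H"
  shows "fl (without K H) (eid e) = flo e - of_bool (uses K e)"
proof -
  have "distinct (map eid (without K H))" using assms(1) ends_eid[OF ends_without] by metis
  moreover have "(if uses K e then set_flo (flo e - 1) e else e) \<in> set (without K H)"
    using assms(2) by (auto simp: without_def)
  ultimately show ?thesis using fl_eid[of "without K H"] by fastforce
qed

text \<open>The case distinction on \<open>\<tau>\<close> accounts for the truncated subtraction by which \<open>\<tau>\<close> is
  obtained: \<open>\<tau> = 0\<close> makes the lower bound on the masses void.\<close>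

lemma split_step_correct:
  assumes "distinct (map eid H)" "\<forall>e \<in> set H. flo e \<le> Suc k" "is_flow s t H (int (Suc k) * F)"
    "over V H" "finite V" "0 < \<tau> \<Longrightarrow> Suc k * (\<tau> + card V) \<le> mass H"
  defines "K \<equiv> rounded \<tau> (Suc k) H"
  shows "\<forall>e \<in> set (without K H). flo e \<le> k" "is_flow s t (without K H) (int k * F)"
    "is_flow s t (support K H) F"
    "\<forall>e \<in> set H. fl (without K H) (eid e) + fl (support K H) (eid e) = flo e"
    "\<tau> \<le> mass (support K H) + card V" "0 < \<tau> \<Longrightarrow> k * (\<tau> + card V) \<le> mass (without K H)"
proof -
  note r = rounded_correct[OF assms(1-5), of \<tau>, folded K_def]
  let ?G = "support K H" and ?W = "without K H"
  have uses: "uses K e \<longleftrightarrow> fl K (eid e) = Suc k" if "e \<in> set H" for e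
    using uses_iff[OF r(1) assms(1) that] r(2) that by auto
  have G: "Suc k * fl ?G (eid e) = fl K (eid e)" if "e \<in> set H" for e
    using fl_support[OF assms(1) that, of K] uses[OF that] r(2) that by auto
  have pos: "0 < flo e" if "e \<in> set H" "uses K e" for e
    using uses[OF that(1)] that r(3) by (cases "flo e") auto
  show sum: "\<forall>e \<in> set H. fl ?W (eid e) + fl ?G (eid e) = flo e"
    using fl_support[OF assms(1), of _ K] fl_without[OF assms(1), of _ K] pos
    by (simp add: of_bool_def)
  show "\<forall>e \<in> set ?W. flo e \<le> k"
  proof
    fix e' assume "e' \<in> set ?W"
    then obtain e where e: "e \<in> set H" "e' = (if uses K e then set_flo (flo e - 1) e else e)"
      by (auto simp: without_def)
    \<comment> \<open>Entries at the bound \<open>Suc k\<close> are not inner, so rounding keeps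
      them and they lose a unit. This is how the bound on the rest drops to
      \<open>k\<close>.\<close>
    have "flo e = Suc k \<Longrightarrow> uses K e" using r(3) uses[OF e(1)] e(1) by simp
    then show "flo e' \<le> k" using assms(2) e by fastforce
  qed
  have wG: "int (Suc k) * wsum w ?G = wsum w K" for w
  proof -
    have "int (Suc k) * wsum w ?G = (\<Sum>e\<leftarrow>H. int (Suc k) * (w (src e) (dst e) * int (fl ?G (eid e))))"
      unfolding wsum_ends[OF ends_support assms(1)] by (rule sum_list_const_mult[symmetric])
    also have "\<dots> = (\<Sum>e\<leftarrow>H. w (src e) (dst e) * int (fl K (eid e)))"
      by (intro arg_cong[where f = sum_list] map_cong)
        (auto simp: G[symmetric] algebra_simps simp del: mult_Suc)
    finally show ?thesis by (simp add: wsum_ends[OF r(1) assms(1)])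
  qed
  have wH: "wsum w ?W + wsum w ?G = wsum w H" for w
  proof -
    have "wsum w ?W + wsum w ?G = (\<Sum>e\<leftarrow>H. w (src e) (dst e) * int (fl ?W (eid e)) +
        w (src e) (dst e) * int (fl ?G (eid e)))"
      unfolding wsum_ends[OF ends_support assms(1)] wsum_ends[OF ends_without assms(1)]
      by (rule sum_list_addf[symmetric])
    also have "\<dots> = wsum w H"
      unfolding wsum_def by (intro arg_cong[where f = sum_list] map_cong)
        (auto simp: sum[rule_format, symmetric] algebra_simps)
    finally show ?thesis .
  qed
  show flowG: "is_flow s t ?G F"
    unfolding is_flow_def
  proof
    fix \<pi> :: "nat \<Rightarrow> int"
    have "int (Suc k) * wsum (\<lambda>u v. \<pi> v - \<pi> u) ?G = int (Suc k) * (F * (\<pi> t - \<pi> s))"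
      using r(4) wG by (simp only: is_flow_def mult.assoc)
    then show "wsum (\<lambda>u v. \<pi> v - \<pi> u) ?G = F * (\<pi> t - \<pi> s)"
      using mult_left_cancel[of "int (Suc k)"] by force
  qed
  have "wsum (\<lambda>u v. \<pi> v - \<pi> u) ?W = int k * F * (\<pi> t - \<pi> s)" for \<pi>
  proof -
    have "wsum (\<lambda>u v. \<pi> v - \<pi> u) ?W = int (Suc k) * F * (\<pi> t - \<pi> s) - F * (\<pi> t - \<pi> s)"
      using wH[of "\<lambda>u v. \<pi> v - \<pi> u"] flowG assms(3) by (simp only: is_flow_def eq_diff_eq)
    also have "\<dots> = int k * F * (\<pi> t - \<pi> s)" by (simp add: algebra_simps)
    finally show ?thesis .
  qed
  then show "is_flow s t ?W (int k * F)" by (simp add: is_flow_def)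
  have mG: "Suc k * mass ?G = mass K"
    using wG[of "\<lambda>_ _. 1"] unfolding mass_wsum[symmetric] of_nat_mult[symmetric] by linarith
  have mH: "mass ?W + mass ?G = mass H"
    using wH[of "\<lambda>_ _. 1"] unfolding mass_wsum[symmetric] by linarith
  show "\<tau> \<le> mass ?G + card V"
  proof (cases "0 < \<tau>")
    case True
    have "Suc k * (\<tau> - card V) \<le> Suc k * (\<tau> + card V)" by (rule mult_left_mono) auto
    then have "Suc k * (\<tau> - card V) \<le> Suc k * mass ?G"
      unfolding mG using r(6) assms(6)[OF True] by linarith
    then show ?thesis by (simp add: le_diff_conv del: mult_Suc)
  qed simp
  show "k * (\<tau> + card V) \<le> mass ?W" if "0 < \<tau>"
  proof -
    \<comment> \<open>By the hypothesis on \<tau> the maximum in the upper bound for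
      \<open>K\<close> is \<open>mass H\<close>. So \<open>?G\<close> is no longer than the average,
      and the average of the rest does not decrease.\<close>
    have "Suc k * mass ?G \<le> mass H"
      unfolding mG using r(5) assms(6)[OF that] by linarith
    then have "k * mass H \<le> Suc k * mass ?W"
      unfolding mH[symmetric] by (simp add: algebra_simps)
    moreover have "k * (Suc k * (\<tau> + card V)) \<le> k * mass H"
      using assms(6)[OF that] by (rule mult_left_mono) simp
    ultimately have "Suc k * (k * (\<tau> + card V)) \<le> Suc k * mass ?W"
      by (simp only: mult.left_commute)
    then show ?thesis by (simp del: mult_Suc)
  qed
qed

text \<open>After \<open>j\<close> steps the rest has value \<open>(m - j) * F\<close> and at most
  \<open>m - j\<close> on each entry, which is what the next rounding requires.\<close>

lemma split_flow_correct:
  assumes "distinct (map eid H)" "\<forall>e \<in> set H. flo e \<le> m" "is_flow s t H (int m * F)"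
    "over V H" "finite V" "0 < \<tau> \<longrightarrow> m * (\<tau> + card V) \<le> mass H"
  shows "length (split_flow \<tau> m H) = m"
    "\<forall>G \<in> set (split_flow \<tau> m H). map ends G = map ends H \<and>
      (\<forall>e \<in> set G. flo e \<le> 1 \<and> cap e = 1) \<and> is_flow s t G F \<and> \<tau> \<le> mass G + card V"
    "\<forall>e \<in> set H. (\<Sum>G\<leftarrow>split_flow \<tau> m H. fl G (eid e)) = flo e"
proof -
  let ?st = "\<lambda>j. (split_step \<tau> ^^ j) (m, H, [])"
  let ?W = "\<lambda>j. fst (snd (?st j))" and ?Gs = "\<lambda>j. snd (snd (?st j))"
  have inv: "fst (?st j) = m - j \<and> map ends (?W j) = map ends H \<and>
      (\<forall>e \<in> set (?W j). flo e \<le> m - j) \<and> is_flow s t (?W j) (int (m - j) * F) \<and>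
      (0 < \<tau> \<longrightarrow> (m - j) * (\<tau> + card V) \<le> mass (?W j)) \<and>
      length (?Gs j) = j \<and>
      (\<forall>G \<in> set (?Gs j). map ends G = map ends H \<and> (\<forall>e \<in> set G. flo e \<le> 1 \<and> cap e = 1) \<and>
         is_flow s t G F \<and> \<tau> \<le> mass G + card V) \<and>
      (\<forall>e \<in> set H. fl (?W j) (eid e) + (\<Sum>G\<leftarrow>?Gs j. fl G (eid e)) = flo e)"
    if "j \<le> m" for j
    using that
  proof (induction j)
    case 0
    show ?case using assms fl_eid[OF assms(1)] by simp
  next
    case (Suc j)
    then obtain k where k: "m - j = Suc k" "m - Suc j = k" by (metis Suc_diff_Suc Suc_le_lessD)
    define W Gs where "W = ?W j" and "Gs = ?Gs j"
    have IH: "fst (?st j) = Suc k" "map ends W = map ends H" "\<forall>e \<in> set W. flo e \<le> Suc k"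
      "is_flow s t W (int (Suc k) * F)" "0 < \<tau> \<longrightarrow> Suc k * (\<tau> + card V) \<le> mass W"
      "length Gs = j"
      "\<forall>G \<in> set Gs. map ends G = map ends H \<and> (\<forall>e \<in> set G. flo e \<le> 1 \<and> cap e = 1) \<and>
         is_flow s t G F \<and> \<tau> \<le> mass G + card V"
      "\<forall>e \<in> set H. fl W (eid e) + (\<Sum>G\<leftarrow>Gs. fl G (eid e)) = flo e"
      using Suc unfolding k W_def Gs_def by auto
    let ?K = "rounded \<tau> (Suc k) W"
    have dW: "distinct (map eid W)" using assms(1) ends_eid[OF IH(2)] by simp
    have oW: "over V W" using assms(4) ends_over[OF IH(2)] by simp
    note st = split_step_correct[OF dW IH(3,4) oW assms(5) IH(5)[rule_format]]
    have eq: "?st (Suc j) = (k, without ?K W, support ?K W # Gs)"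
      by (simp add: split_step_def IH(1) flip: W_def Gs_def)
    have "\<forall>e \<in> set (support ?K W). flo e \<le> 1 \<and> cap e = 1" by (auto simp: support_def)
    moreover have "\<forall>e \<in> set H. fl (without ?K W) (eid e) +
        (\<Sum>G\<leftarrow>support ?K W # Gs. fl G (eid e)) = flo e"
    proof
      fix e assume e: "e \<in> set H"
      then obtain e' where e': "e' \<in> set W" "eid e' = eid e" using ends_corresponding[OF IH(2)] by metis
      have "fl (without ?K W) (eid e) + fl (support ?K W) (eid e) = fl W (eid e)"
        using st(4) e' fl_eid[OF dW e'(1)] by metis
      then show "fl (without ?K W) (eid e) + (\<Sum>G\<leftarrow>support ?K W # Gs. fl G (eid e)) = flo e"
        using IH(8)[rule_format, OF e] by simp
    qed
    ultimately show ?case unfolding eq k using st IH by simp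
  qed
  have split: "split_flow \<tau> m H = ?Gs m" by (simp add: split_flow_def)
  note I = inv[of m, folded split, simplified]
  show "length (split_flow \<tau> m H) = m"
    "\<forall>G \<in> set (split_flow \<tau> m H). map ends G = map ends H \<and>
      (\<forall>e \<in> set G. flo e \<le> 1 \<and> cap e = 1) \<and> is_flow s t G F \<and> \<tau> \<le> mass G + card V"
    using I by auto
  show "\<forall>e \<in> set H. (\<Sum>G\<leftarrow>split_flow \<tau> m H. fl G (eid e)) = flo e"
  proof
    fix e assume e: "e \<in> set H"
    then obtain e' where e': "e' \<in> set (?W m)" "eid e' = eid e"
      using ends_corresponding[of "?W m" H] I by metis
    have "distinct (map eid (?W m))" using assms(1) I ends_eid[of "?W m" H] by simp
    \<comment> \<open>After \<open>m\<close> steps the bound on the rest is 0, so the flows split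
      off add up to \<open>H\<close>.\<close>
    then have "fl (?W m) (eid e) = 0" using fl_eid[of "?W m"] e' I by metis
    moreover have "fl (?W m) (eid e) + (\<Sum>G\<leftarrow>split_flow \<tau> m H. fl G (eid e)) = flo e"
      using I e by blast
    ultimately show "(\<Sum>G\<leftarrow>split_flow \<tau> m H. fl G (eid e)) = flo e" by simp
  qed
qed

section \<open>Peeling off paths\<close>

lemma return_arcs_legal:
  "distinct (map eid N) \<Longrightarrow> a \<in> set (return_arcs N) \<Longrightarrow> legal N 1 a \<and> \<not> fwd a"
  by (auto simp: return_arcs_def legal_def split: if_splits dest: eid_inj)

text \<open>Otherwise no flow would enter the set of vertices reached backwards from
  \<open>t\<close>, although a positive net amount has to.\<close>

lemma return_path_exists:
  assumes "is_flow s t N F" "0 < F"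
  shows "find_path (return_arcs N) t s \<noteq> []"
proof
  assume "find_path (return_arcs N) t s = []"
  from find_path_Nil[OF this] obtain S where S: "t \<in> S" "s \<notin> S"
    "\<forall>a \<in> set (return_arcs N). atail a \<in> S \<longrightarrow> ahead a \<in> S" by blast
  have "flo e = 0" if "e \<in> set N" "leaving (- S) e" for e
  proof (rule ccontr)
    assume "flo e \<noteq> 0"
    then have "Arc (dst e) (src e) (eid e) False \<in> set (return_arcs N)"
      using that(1) by (auto simp: return_arcs_def)
    then show False using S(3) that(2) by (fastforce simp: leaving_def)
  qed
  then have "0 \<le> (\<Sum>e\<leftarrow>N. (if leaving S e then int (flo e) else 0) -
      (if leaving (- S) e then int (flo e) else 0))"
    by (intro sum_list_nonneg) auto
  then show False using cut_flow[OF assms(1), of S] S(1,2) assms(2) by simp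
qed

lemma fl_push_return:
  assumes "distinct (map eid N)" "e \<in> set N" "\<forall>a \<in> set p. \<not> fwd a"
  shows "fl (push p 1 N) (eid e) = flo e - of_bool (eid e \<in> aid ` set p)"
proof -
  have "distinct (map eid (push p 1 N))" using assms(1) by (simp add: push_def comp_def)
  moreover have "adj p 1 e \<in> set (push p 1 N)" using assms(2) by (simp add: push_def)
  ultimately have "fl (push p 1 N) (eid e) = flo (adj p 1 e)"
    using fl_eid[of "push p 1 N" "adj p 1 e"] by simp
  also have "\<dots> = flo e - of_bool (eid e \<in> aid ` set p)"
    using assms(3) by (force simp: adj_def list_ex_iff)
  finally show ?thesis .
qed

text \<open>After \<open>m\<close> paths the rest has value 0, though it may still contain cycles.
  It lies below \<open>F\<close>, so nothing enters a tight cut of \<open>F\<close> in it, and with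
  value 0 nothing leaves the cut either. Hence each entry leaving the cut lay on one of the removed
  paths.\<close>

lemma peel_correct:
  assumes "distinct (map eid F)" "\<forall>e \<in> set F. flo e \<le> 1 \<and> cap e = 1" "is_flow s t F (int m)"
    "over V F" "finite V" "t \<in> V"
  shows "length (peel s t m F) = m"
    "\<forall>G \<in> set (peel s t m F). map ends G = map ends F \<and> (\<forall>e \<in> set G. flo e \<le> 1) \<and>
      is_flow s t G (int m - 1) \<and> length (filter (\<lambda>e. fl G (eid e) \<noteq> flo e) F) \<le> card V"
    "\<And>S e. e \<in> set F \<Longrightarrow> tight S F \<Longrightarrow> s \<in> S \<Longrightarrow> t \<notin> S \<Longrightarrow> leaving S e \<Longrightarrow>
      \<exists>G \<in> set (peel s t m F). fl G (eid e) = 0"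
proof -
  have vF: "valid F" using assms(1,2) by (auto simp: valid_def)
  let ?st = "\<lambda>j. (peel_step s t F ^^ j) (F, [])"
  let ?R = "\<lambda>j. fst (?st j)" and ?Gs = "\<lambda>j. snd (?st j)"
  let ?P = "\<lambda>G. map ends G = map ends F \<and> (\<forall>e \<in> set G. flo e \<le> 1) \<and>
      is_flow s t G (int m - 1) \<and> length (filter (\<lambda>e. fl G (eid e) \<noteq> flo e) F) \<le> card V"
  have inv: "map shape (?R j) = map shape F \<and> valid (?R j) \<and>
      (\<forall>e \<in> set F. fl (?R j) (eid e) \<le> flo e) \<and> is_flow s t (?R j) (int m - int j) \<and>
      length (?Gs j) = j \<and> (\<forall>G \<in> set (?Gs j). ?P G) \<and>
      (\<forall>e \<in> set F. 0 < flo e \<and> fl (?R j) (eid e) = 0 \<longrightarrow> (\<exists>G \<in> set (?Gs j). fl G (eid e) = 0))"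
    if "j \<le> m" for j
    using that
  proof (induction j)
    case 0
    show ?case using vF assms(3) fl_eid[OF assms(1)] by auto
  next
    case (Suc j)
    define R Gs where "R = ?R j" and "Gs = ?Gs j"
    have IH: "map shape R = map shape F" "valid R" "\<forall>e \<in> set F. fl R (eid e) \<le> flo e"
      "is_flow s t R (int m - int j)" "length Gs = j" "\<forall>G \<in> set Gs. ?P G"
      "\<forall>e \<in> set F. 0 < flo e \<and> fl R (eid e) = 0 \<longrightarrow> (\<exists>G \<in> set Gs. fl G (eid e) = 0)"
      using Suc unfolding R_def Gs_def by auto
    have dR: "distinct (map eid R)" using IH(2) by (simp add: valid_def)
    have endsR: "map ends R = map ends F" by (rule shape_ends[OF IH(1)])
    have "0 < int m - int j" using Suc.prems by simp
    from return_path_exists[OF IH(4) this] obtain p ps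
      where p: "find_path (return_arcs R) t s = p # ps" by (auto simp: neq_Nil_conv)
    have st: "?st (Suc j) = (push p 1 R, push p 1 F # Gs)"
      using p by (simp add: peel_step_def flip: R_def Gs_def)
    have rp: "rpath (set (return_arcs R)) t p s" using find_path_rpath[of p _ t s] p by simp
    have legR: "\<forall>a \<in> set (return_arcs R). legal R 1 a"
      using return_arcs_legal[OF dR] by blast
    have legF: "\<forall>a \<in> set (return_arcs R). legal F 1 a"
    proof
      fix a assume "a \<in> set (return_arcs R)"
      then obtain r where r: "r \<in> set R" "0 < flo r" "a = Arc (dst r) (src r) (eid r) False"
        by (auto simp: return_arcs_def split: if_splits)
      then obtain e where e: "e \<in> set F" "eid e = eid r" "src e = src r" "dst e = dst r"
        using ends_corresponding[OF endsR[symmetric]] by metis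
      have "flo r \<le> flo e" using IH(3) e fl_eid[OF dR r(1)] by metis
      then have pos: "1 \<le> flo e" using r(2) by simp
      show "legal F 1 a"
        unfolding legal_def
      proof (intro conjI ballI impI)
        show "aid a \<in> eid ` set F"
          unfolding r(3) arc.sel e(2)[symmetric] by (rule imageI[OF e(1)])
        fix e' assume "e' \<in> set F" "eid e' = aid a"
        then have "e' = e" using eid_inj[OF assms(1) _ e(1)] e(2) r(3) by simp
        then show "if fwd a then atail a = src e' \<and> ahead a = dst e' \<and> flo e' + 1 \<le> cap e'
          else atail a = dst e' \<and> ahead a = src e' \<and> 1 \<le> flo e'"
          using r(3) e(3,4) pos by simp
      qed
    qed
    have bwd: "\<forall>a \<in> set p. \<not> fwd a"
      using rpath_subset[OF rp] return_arcs_legal[OF dR] by blast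
    have "over V R" using assms(4) ends_over[OF endsR] by simp
    then have "ahead ` set (return_arcs R) \<subseteq> V"
      by (auto simp: over_def return_arcs_def split: if_splits)
    then have len: "length p \<le> card V" using rpath_length[OF rp assms(5,6)] by simp
    have fR: "fl (push p 1 R) (eid e) = fl R (eid e) - of_bool (eid e \<in> aid ` set p)"
      if e: "e \<in> set F" for e
    proof -
      obtain r where r: "r \<in> set R" "eid r = eid e" using ends_corresponding[OF endsR e] by metis
      then show ?thesis using fl_push_return[OF dR r(1) bwd] fl_eid[OF dR r(1)] by simp
    qed
    have fF: "fl (push p 1 F) (eid e) = flo e - of_bool (eid e \<in> aid ` set p)"
      if "e \<in> set F" for e by (rule fl_push_return[OF assms(1) that bwd])
    have "?P (push p 1 F)"
    proof (intro conjI)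
      show "map ends (push p 1 F) = map ends F" by (rule shape_ends) simp
      show "\<forall>e \<in> set (push p 1 F). flo e \<le> 1"
        using assms(2) by (auto simp: push_def adj_def)
      show "is_flow s t (push p 1 F) (int m - 1)"
        using is_flow_push[OF vF assms(3) rp legF, of "- 1"] by simp
      let ?D = "filter (\<lambda>e. fl (push p 1 F) (eid e) \<noteq> flo e) F"
      have "eid ` set ?D \<subseteq> aid ` set p" using fF by (auto simp: of_bool_def split: if_splits)
      then have "card (eid ` set ?D) \<le> card (aid ` set p)" by (intro card_mono) auto
      also have "\<dots> \<le> length p" using card_image_le[of "set p" aid] card_length[of p] by simp
      finally have "card (eid ` set ?D) \<le> card V" using len by simp
      moreover have "distinct (map eid ?D)" using assms(1) by (rule distinct_map_filter)
      then have "length ?D = card (eid ` set ?D)" using distinct_card by fastforce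
      ultimately show "length ?D \<le> card V" by simp
    qed
    moreover have "valid (push p 1 R)" by (rule valid_push[OF IH(2)])
    moreover have "is_flow s t (push p 1 R) (int m - int (Suc j))"
      using is_flow_push[OF IH(2,4) rp legR, of "- 1"] by (simp add: algebra_simps)
    moreover have "\<forall>e \<in> set F. fl (push p 1 R) (eid e) \<le> flo e"
      using fR IH(3) by (metis diff_le_self order_trans)
    moreover have "\<forall>e \<in> set F. 0 < flo e \<and> fl (push p 1 R) (eid e) = 0 \<longrightarrow>
      (\<exists>G \<in> set (push p 1 F # Gs). fl G (eid e) = 0)"
    proof (intro ballI impI)
      fix e assume e: "e \<in> set F" "0 < flo e \<and> fl (push p 1 R) (eid e) = 0"
      show "\<exists>G \<in> set (push p 1 F # Gs). fl G (eid e) = 0"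
      proof (cases "eid e \<in> aid ` set p")
        case True
        then have "fl (push p 1 F) (eid e) = 0" using fF[OF e(1)] assms(2) e(1) by fastforce
        then show ?thesis by simp
      next
        case False
        then have "fl R (eid e) = 0" using fR[OF e(1)] e(2) by simp
        then show ?thesis using IH(7) e by fastforce
      qed
    qed
    ultimately show ?case unfolding st using IH by simp
  qed
  have peel: "peel s t m F = ?Gs m" by (simp add: peel_def)
  note I = inv[of m, folded peel, simplified]
  show "length (peel s t m F) = m" "\<forall>G \<in> set (peel s t m F). ?P G" using I by auto
  fix S e assume e: "e \<in> set F" "tight S F" "s \<in> S" "t \<notin> S" "leaving S e"
  have dR: "distinct (map eid (?R m))" using I by (simp add: valid_def)
  have endsR: "map ends (?R m) = map ends F" using I by (intro shape_ends) simp
  have zero: "flo r = 0" if r: "r \<in> set (?R m)" "leaving (- S) r" for r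
  proof -
    obtain e' where e': "e' \<in> set F" "eid e' = eid r" "src e' = src r" "dst e' = dst r"
      using ends_corresponding[OF endsR[symmetric] r(1)] by metis
    then have "flo e' = 0" using e(2) r(2) by (auto simp: tight_def leaving_def)
    moreover have "flo r \<le> flo e'" using I e' fl_eid[OF dR r(1)] by metis
    ultimately show ?thesis by simp
  qed
  have "int (\<Sum>r\<leftarrow>?R m. if leaving S r then flo r else 0) =
      (\<Sum>e\<leftarrow>?R m. (if leaving S e then int (flo e) else 0) -
      (if leaving (- S) e then int (flo e) else 0))"
    unfolding int_sum_list
    by (intro arg_cong[where f = sum_list] map_cong) (auto simp: zero)
  also have "\<dots> = 0" using cut_flow[of s t "?R m" 0 S] I by simp
  finally have "\<forall>r \<in> set (?R m). (if leaving S r then flo r else 0) = 0"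
    by (simp add: sum_list_eq_0_iff)
  moreover obtain r where r: "r \<in> set (?R m)" "eid r = eid e" "src r = src e" "dst r = dst e"
    using ends_corresponding[OF endsR e(1)] by metis
  moreover have "leaving S r" using e(5) r by (simp add: leaving_def)
  ultimately have "fl (?R m) (eid e) = 0" using fl_eid[OF dR r(1)] by auto
  moreover have "0 < flo e" using e(1,2,5) assms(2) by (auto simp: tight_def)
  ultimately show "\<exists>G \<in> set (peel s t m F). fl G (eid e) = 0" using I e(1) by blast
qed

section \<open>The family of flows\<close>

lemma netval_eq:
  assumes "is_flow s t N (int k)" "s \<noteq> t"
  shows "netval s N = k"
proof -
  let ?\<pi> = "\<lambda>v. - of_bool (v = s) :: int"
  have "int (sum_list (map flo (filter (\<lambda>e. src e = s) N))) -
      int (sum_list (map flo (filter (\<lambda>e. dst e = s) N))) = wsum (\<lambda>u v. ?\<pi> v - ?\<pi> u) N"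
    unfolding wsum_def by (induction N) (auto simp: algebra_simps)
  also have "\<dots> = int k * (?\<pi> t - ?\<pi> s)" 
    by (rule assms(1)[unfolded is_flow_def, rule_format])
  also have "\<dots> = int k" using assms(2) by simp
  finally show ?thesis by (simp add: netval_def)
qed

text \<open>\<open>S\<close> is the set reached from \<open>src e\<close>, about which nothing
  relates to \<open>s\<close> and \<open>t\<close> at first. As it is tight and left by an entry
  with flow, the net flow across it is positive, which is possible only if it contains
  \<open>s\<close> and not \<open>t\<close>.\<close>

lemma critical_cut:
  assumes "valid N" "is_flow s t N (int k)" "e \<in> set N" "critical N e"
  obtains S where "s \<in> S" "t \<notin> S" "leaving S e" "tight S N"
proof -
  have "find_path (residual N) (src e) (dst e) = []" and pos: "0 < flo e"
    using assms(4) by (simp_all add: critical_def)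
  from find_path_Nil[OF this(1)] obtain S where S: "src e \<in> S" "dst e \<notin> S"
    "\<forall>a \<in> set (residual N). atail a \<in> S \<longrightarrow> ahead a \<in> S" by blast
  have tight: "tight S N" by (rule residual_closed_tight[OF S(3) assms(1)])
  have leaving: "leaving S e" using S by (simp add: leaving_def)
  have "int (flo e) \<le> (\<Sum>e\<leftarrow>N. if leaving S e then int (flo e) else 0)"
    using member_le_sum_list[of "int (flo e)" "map (\<lambda>e. if leaving S e then int (flo e) else 0) N"]
      assms(3) leaving by (force simp: image_iff)
  also have "\<dots> = (\<Sum>e\<leftarrow>N. (if leaving S e then int (flo e) else 0) -
      (if leaving (- S) e then int (flo e) else 0))"
    using tight by (intro arg_cong[where f = sum_list] map_cong) (auto simp: tight_def)
  also have "\<dots> = int k * (of_bool (t \<notin> S) - of_bool (s \<notin> S))" by (rule cut_flow[OF assms(2)])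
  finally have "0 < int k * (of_bool (t \<notin> S) - of_bool (s \<notin> S))" using pos by linarith
  then have "s \<in> S" "t \<notin> S" by (auto simp: of_bool_def split: if_splits)
  with that leaving tight show thesis by blast
qed

text \<open>A residual path from the tail of \<open>e\<close> to its head would have to leave
  \<open>S\<close>, but no residual arc leaves a tight set.\<close>

lemma tight_leaving_critical:
  assumes "tight S N" "e \<in> set N" "leaving S e" "0 < cap e"
  shows "critical N e"
proof -
  have "find_path (residual N) (src e) (dst e) = []"
  proof (rule ccontr)
    assume "\<not> ?thesis"
    then obtain p ps where "find_path (residual N) (src e) (dst e) = p # ps"
      by (auto simp: neq_Nil_conv)
    then have rp: "rpath (set (residual N)) (src e) p (dst e)"
      using find_path_rpath[of p "residual N" "src e" "dst e"] by simp
    obtain a where "a \<in> set p" "atail a \<in> S" "ahead a \<notin> S"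
      using rpath_crossing[OF rp, of S] assms(3) by (auto simp: leaving_def)
    then show False using tight_residual[OF assms(1)] rpath_subset[OF rp] by blast
  qed
  moreover have "0 < flo e" using assms by (auto simp: tight_def)
  ultimately show ?thesis by (simp add: critical_def)
qed

section \<open>The relaxed network and its maximum flow\<close>

lemma outcap_unit: "\<forall>e \<in> set N. cap e = 1 \<Longrightarrow> (\<Sum>e\<leftarrow>N. if leaving S e then c else 0) = c * outcap S N"
  unfolding outcap_def by (induction N) auto

lemma outcap_relaxed:
  "outcap S (relaxed_network N k) =
    (\<Sum>e\<leftarrow>N. if leaving S e then (if critical N e then Suc k else k) else 0)"
  by (simp add: outcap_def relaxed_network_def leaving_def comp_def cong: if_cong)

lemma outcap_relaxed_tight:
  assumes "valid N" "is_flow s t N (int k)" "\<forall>e \<in> set N. cap e = 1" "s \<in> S" "t \<notin> S" "tight S N"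
  shows "outcap S (relaxed_network N k) = Suc k * k"
proof -
  have "outcap S (relaxed_network N k) = (\<Sum>e\<leftarrow>N. if leaving S e then Suc k else 0)"
    unfolding outcap_relaxed
    using tight_leaving_critical[OF assms(6)] assms(3)
    by (intro arg_cong[where f = sum_list] map_cong) auto
  also have "\<dots> = Suc k * outcap S N" by (rule outcap_unit[OF assms(3)])
  also have "outcap S N = k" using tight_iff[OF assms(2,4,5,1)] assms(6) by simp
  finally show ?thesis .
qed

lemma outcap_relaxed_ge:
  assumes "valid N" "is_flow s t N (int k)" "\<forall>e \<in> set N. cap e = 1" "s \<in> S" "t \<notin> S"
  shows "Suc k * k \<le> outcap S (relaxed_network N k)"
proof (cases "tight S N")
  case True
  then show ?thesis using outcap_relaxed_tight[OF assms] by simp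
next
  case False
  then have "Suc k \<le> outcap S N"
    using tight_iff[OF assms(2,4,5,1)] flow_le_outcap[OF assms(2,4,5,1)] by linarith
  then have "Suc k * k \<le> k * outcap S N" by (metis mult.commute mult_le_mono2)
  also have "\<dots> = (\<Sum>e\<leftarrow>N. if leaving S e then k else 0)" by (rule outcap_unit[OF assms(3), symmetric])
  also have "\<dots> \<le> outcap S (relaxed_network N k)"
    unfolding outcap_relaxed by (rule sum_list_mono) auto
  finally show ?thesis .
qed

lemma relaxed_flow:
  assumes "valid N" "is_flow s t N (int k)" "\<forall>e \<in> set N. cap e = 1" "over V N" "finite V"
    "s \<in> V" "s \<noteq> t" "s \<in> S" "t \<notin> S" "tight S N"
  defines "H \<equiv> cancel 0 (maxflow s t (relaxed_network N k))"
  shows "map ends H = map ends N" "valid H" "is_flow s t H (int (Suc k) * int k)"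
    "\<forall>e \<in> set H. cap e = k \<or> cap e = Suc k" "\<forall>e \<in> set N. \<not> critical N e \<longrightarrow> fl H (eid e) \<le> k"
    "length (filter inner H) \<le> card V" "mass H \<le> max (Suc k * k * card V) (Suc k * card V)"
proof -
  let ?R = "relaxed_network N k" and ?M = "maxflow s t (relaxed_network N k)"
  have endsR: "map ends ?R = map ends N" by (simp add: relaxed_network_def ends_def comp_def)
  have dR: "distinct (map eid ?R)" using ends_eid[OF endsR] assms(1) by (simp add: valid_def)
  have zero: "\<forall>e \<in> set ?R. flo e = 0" by (auto simp: relaxed_network_def)
  have oR: "over V ?R" using ends_over[OF endsR] assms(4) by simp
  obtain F S' where M: "valid ?M" "map shape ?M = map shape ?R" "is_flow s t ?M (int F)"
    "mass ?M \<le> F * card V" "s \<in> S'" "t \<notin> S'" "tight S' ?M"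
    using maxflow_correct[OF dR zero oR assms(5-7)] by blast
  have out: "outcap X ?M = outcap X ?R" for X by (rule outcap_shape[OF M(2)])
  have "F = outcap S' ?R" using tight_iff[OF M(3,5,6,1)] M(7) out by simp
  then have "Suc k * k \<le> F" using outcap_relaxed_ge[OF assms(1-3) M(5,6)] by simp
  moreover have "F \<le> outcap S ?R" using flow_le_outcap[OF M(3) assms(8,9) M(1)] out by simp
  ultimately have F: "F = Suc k * k"
    using outcap_relaxed_tight[OF assms(1-3,8-10)] by simp
  have caps: "cap e = k \<or> cap e = Suc k" if "shape e \<in> shape ` set ?R" for e
    using that by (auto simp: relaxed_network_def shape_def split: if_splits)
  have oM: "over V ?M" using over_shape[OF M(2)] oR by simp
  have capM: "\<forall>e \<in> set ?M. cap e \<le> Suc k"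
    using caps M(2) by (metis image_eqI le_SucI list.set_map order_refl)
  note can = cancel_correct[OF M(1) oM assms(5) capM, of 0, folded H_def]
  have ev: "evolves ?M H" by (rule can(1))
  then have shH: "map shape H = map shape ?R" using M(2) by (simp add: evolves_def)
  then show endsH: "map ends H = map ends N" using shape_ends endsR by metis
  show vH: "valid H" using ev by (simp add: evolves_def)
  have "int F = int (Suc k) * int k" unfolding F by (rule of_nat_mult)
  then show "is_flow s t H (int (Suc k) * int k)"
    using ev M(3) by (simp add: evolves_def is_flow_def)
  show "\<forall>e \<in> set H. cap e = k \<or> cap e = Suc k"
    using caps shH by (metis image_eqI list.set_map)
  show "\<forall>e \<in> set N. \<not> critical N e \<longrightarrow> fl H (eid e) \<le> k"
  proof (intro ballI impI)
    fix e assume e: "e \<in> set N" "\<not> critical N e"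
    have dH: "distinct (map eid H)" using vH by (simp add: valid_def)
    have "(eid e, src e, dst e, k) \<in> set (map shape ?R)"
      using e by (force simp: relaxed_network_def shape_def)
    then have "(eid e, src e, dst e, k) \<in> set (map shape H)" by (simp only: shH)
    then obtain h where h: "h \<in> set H" "eid h = eid e" "cap h = k" by (auto simp: shape_def)
    then have "fl H (eid e) = flo h" using fl_eid[OF dH h(1)] by simp
    then show "fl H (eid e) \<le> k" using vH h by (auto simp: valid_def)
  qed
  show "length (filter inner H) \<le> card V"
    using inner_forest[OF can(2) _ _ assms(5)] vH over_shape[OF shH] oR by (simp add: valid_def)
  \<comment> \<open>The second term of the maximum is the general allowance for overshooting, here
    with target 0 and capacities up to \<open>Suc k\<close>.\<close>
  have "mass H \<le> max (mass ?M) (Suc k * card V)" using can(3) by simp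
  then show "mass H \<le> max (Suc k * k * card V) (Suc k * card V)"
    using M(4) unfolding F by linarith
qed

lemma saturated_mass:
  assumes "\<forall>e \<in> set H. k \<le> cap e"
  shows "k * saturated H \<le> mass H" "saturated H \<le> mass H"
proof -
  show "k * saturated H \<le> mass H"
    using assms unfolding saturated_def mass_def by (induction H) auto
  show "saturated H \<le> mass H"
    unfolding saturated_def mass_def by (induction H) auto
qed

text \<open>The mass is at least \<open>k * saturated H\<close> and at most
  \<open>k * Suc k * n\<close>, whence \<open>saturated H \<le> Suc k * n\<close>. Therefore
  \<open>Suc k * (saturated H - n)\<close> is at most \<open>k * saturated H\<close>, so at most the
  mass.\<close>

lemma split_target:
  assumes "\<forall>e \<in> set H. k \<le> cap e" "mass H \<le> max (Suc k * k * n) (Suc k * n)"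
    and "0 < saturated H - (n + n)"
  shows "Suc k * (saturated H - (n + n) + n) \<le> mass H"
proof -
  \<comment> \<open>For \<open>k = 0\<close> the mass is at most \<open>n\<close>, so the truncated
    target would be 0.\<close>
  have "k \<noteq> 0"
  proof
    assume "k = 0"
    then have "saturated H \<le> n" using saturated_mass(2)[OF assms(1)] assms(2) by simp
    then show False using assms(3) by simp
  qed
  then have "Suc k * 1 * n \<le> Suc k * k * n" by (intro mult_right_mono mult_left_mono) auto
  then have "mass H \<le> Suc k * k * n" using assms(2) unfolding mult_1_right by linarith
  then have "k * saturated H \<le> k * (Suc k * n)"
    using saturated_mass(1)[OF assms(1)] by (simp only: mult.assoc mult.left_commute)
  then have sat: "saturated H \<le> Suc k * n" using \<open>k \<noteq> 0\<close> by simp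
  have "saturated H - (n + n) + n = saturated H - n" using assms(3) by simp
  then have "Suc k * (saturated H - (n + n) + n) = k * saturated H + saturated H - Suc k * n"
    by (simp add: diff_mult_distrib2)
  also have "\<dots> \<le> k * saturated H" using sat by simp
  also have "\<dots> \<le> mass H" by (rule saturated_mass(1)[OF assms(1)])
  finally show ?thesis .
qed

section \<open>Distances between the flows\<close>

definition disagreement :: "entry list \<Rightarrow> (entry \<Rightarrow> nat) \<Rightarrow> (entry \<Rightarrow> nat) \<Rightarrow> nat" where
  "disagreement H f g = length (filter (\<lambda>e. f e \<noteq> g e) H)"

lemma disagreement_commute: "disagreement H f g = disagreement H g f"
  unfolding disagreement_def by (intro arg_cong[where f = length] filter_cong) auto

lemma disagreement_triangle: "disagreement H f h \<le> disagreement H f g + disagreement H h g"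
  unfolding disagreement_def by (induction H) auto

lemma disagreement_saturated:
  assumes "valid H" "map ends G = map ends H" "\<forall>e \<in> set H. fl G (eid e) \<le> min 1 (flo e)"
    "length (filter inner H) \<le> n" "saturated H - (n + n) \<le> mass G + n"
  shows "disagreement H (\<lambda>e. fl G (eid e)) (\<lambda>e. of_bool (0 < flo e \<and> flo e = cap e)) \<le> 5 * n"
proof -
  let ?D = "disagreement H (\<lambda>e. fl G (eid e)) (\<lambda>e. of_bool (0 < flo e \<and> flo e = cap e))"
  have "disagreement H' (\<lambda>e. fl G (eid e)) (\<lambda>e. of_bool (0 < flo e \<and> flo e = cap e)) +
      (\<Sum>e\<leftarrow>H'. fl G (eid e)) \<le> saturated H' + 2 * length (filter inner H')"
    if "\<forall>e \<in> set H'. fl G (eid e) \<le> min 1 (flo e) \<and> flo e \<le> cap e" for H'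
    using that
  proof (induction H')
    case (Cons e H')
    then have "of_bool (fl G (eid e) \<noteq> of_bool (0 < flo e \<and> flo e = cap e)) + fl G (eid e)
      \<le> of_bool (0 < flo e \<and> flo e = cap e) + 2 * of_bool (inner e)"
      by (auto simp: inner_def of_bool_def)
    then show ?case using Cons by (auto simp: disagreement_def saturated_def)
  qed (simp add: disagreement_def saturated_def)
  from this[of H] have "?D + mass G \<le> saturated H + 2 * n"
    using assms(1,3,4) mass_ends[OF assms(2)] by (simp add: valid_def)
  then show ?thesis using assms(5) by linarith
qed

lemma network_props:
  "distinct (map eid (network xs))" "map (\<lambda>e. (src e, dst e)) (network xs) = xs"
  "\<forall>e \<in> set (network xs). cap e = 1 \<and> flo e = 0"
proof -
  let ?N = "\<lambda>xs. foldl (\<lambda>N x. Entry (length N) (fst x) (snd x) 1 0 # N) [] xs"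
  have len: "length (?N xs) = length xs" for xs by (induction xs rule: rev_induct) auto
  have "map eid (?N xs) = rev [0..<length xs] \<and> map (\<lambda>e. (src e, dst e)) (?N xs) = rev xs \<and>
    (\<forall>e \<in> set (?N xs). cap e = 1 \<and> flo e = 0)"
  proof (induction xs rule: rev_induct)
    case (snoc x xs)
    then show ?case using len[of xs] by simp
  qed simp
  then show "distinct (map eid (network xs))" "map (\<lambda>e. (src e, dst e)) (network xs) = xs"
    "\<forall>e \<in> set (network xs). cap e = 1 \<and> flo e = 0"
    by (simp_all add: network_def rev_map[symmetric])
qed

text \<open>The second alternative for an entry \<open>e\<close> comes with a minimum cut that
  \<open>e\<close> leaves. It certifies that \<open>k - 1\<close> is optimal without
  \<open>e\<close>; in the first alternative the cut \<open>S\<close> does so for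
  \<open>k\<close>.\<close>

theorem fault_tolerant_flows_correct:
  fixes s t :: nat and V :: "nat set"
  assumes "over V (network xs)" "finite V" "s \<in> V" "t \<in> V" "s \<noteq> t"
  defines "N \<equiv> network xs" and "L \<equiv> fault_tolerant_flows (card V, xs, s, t)"
  obtains k S where "s \<in> S" "t \<notin> S" "outcap S N = k" "length L = 2 * k + 1"
    "\<forall>G \<in> set L. map ends G = map ends N \<and> (\<forall>e \<in> set G. flo e \<le> 1) \<and> (\<exists>v. is_flow s t G v)"
    "\<exists>G \<in> set L. is_flow s t G (int k)"
    "\<forall>e \<in> set N. (\<exists>G \<in> set L. fl G (eid e) = 0 \<and> is_flow s t G (int k)) \<or>
      (\<exists>S. s \<in> S \<and> t \<notin> S \<and> leaving S e \<and> outcap S N = k \<and>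
        (\<exists>G \<in> set L. fl G (eid e) = 0 \<and> is_flow s t G (int k - 1)))"
    "\<forall>G \<in> set L. \<forall>G' \<in> set L.
      length (filter (\<lambda>e. fl G (eid e) \<noteq> fl G' (eid e)) N) \<le> 12 * card V"
proof -
  let ?n = "card V"
  have N: "distinct (map eid N)" "\<forall>e \<in> set N. flo e = 0" "\<forall>e \<in> set N. cap e = 1" "over V N"
    using network_props[of xs] assms(1) by (auto simp: N_def)
  define N1 where "N1 = maxflow s t N"
  obtain k S where N1: "valid N1" "map shape N1 = map shape N" "is_flow s t N1 (int k)"
    "s \<in> S" "t \<notin> S" "tight S N1"
    using maxflow_correct[OF N(1,2,4) assms(2,3,5)] unfolding N1_def by metis
  have ends1: "map ends N1 = map ends N" by (rule shape_ends[OF N1(2)])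
  have cap1: "\<forall>e \<in> set N1. cap e = 1"
  proof
    fix e assume "e \<in> set N1"
    then have "shape e \<in> shape ` set N" using N1(2) by (metis image_eqI list.set_map)
    then show "cap e = 1" using N(3) by (auto simp: shape_def)
  qed
  have over1: "over V N1" using over_shape[OF N1(2)] N(4) by simp
  have out1: "outcap X N = outcap X N1" for X by (rule outcap_shape[OF N1(2)[symmetric]])
  define H where "H = cancel 0 (maxflow s t (relaxed_network N1 k))"
  note H = relaxed_flow[OF N1(1,3) cap1 over1 assms(2,3,5) N1(4-6), folded H_def]
  have endsH: "map ends H = map ends N" using H(1) ends1 by simp
  have dH: "distinct (map eid H)" using H(2) by (simp add: valid_def)
  have overH: "over V H" using ends_over[OF endsH] N(4) by simp
  have floH: "\<forall>e \<in> set H. flo e \<le> Suc k" using H(2,4) by (fastforce simp: valid_def)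
  have capH: "\<forall>e \<in> set H. k \<le> cap e" using H(4) by fastforce
  define \<tau> where "\<tau> = saturated H - (?n + ?n)"
  define Fs where "Fs = split_flow \<tau> (Suc k) H"
  have target: "0 < \<tau> \<longrightarrow> Suc k * (\<tau> + ?n) \<le> mass H"
    using split_target[OF capH H(7)] unfolding \<tau>_def by blast
  note Fs = split_flow_correct[OF dH floH H(3) overH assms(2) target, folded Fs_def]
  obtain F Fs' where F: "Fs = F # Fs'" using Fs(1) by (cases Fs) auto
  define Os where "Os = peel s t k F"
  have L: "L = Fs @ Os"
    by (simp add: L_def fault_tolerant_flows_def families_def Let_def netval_eq[OF N1(3) assms(5)]
        F Os_def flip: N_def N1_def H_def \<tau>_def Fs_def)
  have FF: "map ends F = map ends H" "\<forall>e \<in> set F. flo e \<le> 1 \<and> cap e = 1" "is_flow s t F (int k)"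
    using Fs(2) F by auto
  have endsF: "map ends F = map ends N" using FF(1) endsH by simp
  have dF: "distinct (map eid F)" using dH ends_eid[OF FF(1)] by simp
  have overF: "over V F" using ends_over[OF endsF] N(4) by simp
  have vF: "valid F" using dF FF(2) by (auto simp: valid_def)
  note Os = peel_correct[OF dF FF(2,3) overF assms(2,4), folded Os_def]
  have shF: "map shape F = map shape N"
  proof -
    have "map shape M = map (\<lambda>(i, u, v). (i, u, v, 1)) (map ends M)"
      if "\<forall>e \<in> set M. cap e = 1" for M
      using that by (auto simp: shape_def ends_def)
    then show ?thesis using endsF FF(2) N(3) by metis
  qed
  have outF: "outcap X F = outcap X N" for X by (rule outcap_shape[OF shF])
  show thesis
  proof (rule that)
    show "s \<in> S" "t \<notin> S" using N1 by auto
    show "outcap S N = k" using tight_iff[OF N1(3-5,1)] N1(6) out1 by simp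
    show "length L = 2 * k + 1" using Fs(1) Os(1) by (simp add: L)
    show "\<exists>G \<in> set L. is_flow s t G (int k)" using FF(3) F by (auto simp: L)
    show "\<forall>G \<in> set L. map ends G = map ends N \<and> (\<forall>e \<in> set G. flo e \<le> 1) \<and> (\<exists>v. is_flow s t G v)"
      using Fs(2) Os(2) by (auto simp: L endsH endsF)
    show "\<forall>e \<in> set N. (\<exists>G \<in> set L. fl G (eid e) = 0 \<and> is_flow s t G (int k)) \<or>
      (\<exists>S. s \<in> S \<and> t \<notin> S \<and> leaving S e \<and> outcap S N = k \<and>
        (\<exists>G \<in> set L. fl G (eid e) = 0 \<and> is_flow s t G (int k - 1)))"
    proof
      fix e assume e: "e \<in> set N"
      obtain e1 where e1: "e1 \<in> set N1" "eid e1 = eid e" "src e1 = src e" "dst e1 = dst e"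
        using ends_corresponding[OF ends1 e] by metis
      show "(\<exists>G \<in> set L. fl G (eid e) = 0 \<and> is_flow s t G (int k)) \<or>
        (\<exists>S. s \<in> S \<and> t \<notin> S \<and> leaving S e \<and> outcap S N = k \<and>
          (\<exists>G \<in> set L. fl G (eid e) = 0 \<and> is_flow s t G (int k - 1)))"
      proof (cases "critical N1 e1")
        case True
        then obtain S' where S': "s \<in> S'" "t \<notin> S'" "leaving S' e1" "tight S' N1"
          using critical_cut[OF N1(1,3) e1(1)] by blast
        have out: "outcap S' N = k" using tight_iff[OF N1(3) S'(1,2) N1(1)] S'(4) out1 by simp
        \<comment> \<open>The value of \<open>F\<close> equals the capacity of this cut, so
          tightness carries over from \<open>N1\<close> to \<open>F\<close>.\<close>
        have tF: "tight S' F" using tight_iff[OF FF(3) S'(1,2) vF] out outF by simp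
        obtain f where f: "f \<in> set F" "eid f = eid e" "src f = src e" "dst f = dst e"
          using ends_corresponding[OF endsF e] by metis
        have lv: "leaving S' f" "leaving S' e" using S'(3) e1 f by (auto simp: leaving_def)
        obtain G where "G \<in> set Os" "fl G (eid e) = 0"
          using Os(3)[OF f(1) tF S'(1,2) lv(1)] f(2) by auto
        then show ?thesis using Os(2) S'(1,2) lv(2) out unfolding L set_append by blast
      next
        case False
        then have le: "fl H (eid e) \<le> k" using H(5) e1 by metis
        obtain h where h: "h \<in> set H" "eid h = eid e" using ends_corresponding[OF endsH e] by metis
        have sum: "(\<Sum>G\<leftarrow>Fs. fl G (eid e)) \<le> k"
          using Fs(3) h fl_eid[OF dH h(1)] le by metis
        \<comment> \<open>Pigeonhole: \<open>Suc k\<close> flows that all use \<open>e\<close> would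
          add up to more than \<open>k\<close>.\<close>
        have "\<exists>G \<in> set Fs. fl G (eid e) = 0"
        proof (rule ccontr)
          assume "\<not> ?thesis"
          then have "(\<Sum>G\<leftarrow>Fs. 1) \<le> (\<Sum>G\<leftarrow>Fs. fl G (eid e))"
            by (intro sum_list_mono) (auto simp: Suc_le_eq)
          then show False using sum Fs(1) by (simp add: sum_list_triv)
        qed
        then show ?thesis using Fs(2) unfolding L set_append by blast
      qed
    qed
    let ?b = "\<lambda>e. of_bool (0 < flo e \<and> flo e = cap e) :: nat"
    have dFs: "disagreement H (\<lambda>e. fl G (eid e)) ?b \<le> 5 * ?n" if G: "G \<in> set Fs" for G
    proof (rule disagreement_saturated[OF H(2)])
      show endsG: "map ends G = map ends H" using Fs(2) G by blast
      show "length (filter inner H) \<le> ?n" by (rule H(6))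
      show "saturated H - (?n + ?n) \<le> mass G + ?n" using Fs(2) G unfolding \<tau>_def by blast
      show "\<forall>e \<in> set H. fl G (eid e) \<le> min 1 (flo e)"
      proof
        fix e assume e: "e \<in> set H"
        obtain g where g: "g \<in> set G" "eid g = eid e" using ends_corresponding[OF endsG e] by metis
        have "distinct (map eid G)" using dH ends_eid[OF endsG] by simp
        then have "fl G (eid e) = flo g" using fl_eid[OF _ g(1)] g(2) by simp
        then have "fl G (eid e) \<le> 1" using Fs(2) G g(1) by auto
        moreover have "fl G (eid e) \<le> (\<Sum>G\<leftarrow>Fs. fl G (eid e))"
          using G by (intro member_le_sum_list) auto
        ultimately show "fl G (eid e) \<le> min 1 (flo e)" using Fs(3) e by simp
      qed
    qed
    have filt: "length (filter (\<lambda>e. P (eid e)) M) = length (filter P (map eid M))" for P M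
      by (simp add: filter_map comp_def)
    have eids: "map eid H = map eid N" "map eid F = map eid N"
      using ends_eid endsH endsF by blast+
    have dL: "disagreement H (\<lambda>e. fl G (eid e)) ?b \<le> 6 * ?n" if G: "G \<in> set L" for G
    proof (cases "G \<in> set Fs")
      case True
      then show ?thesis using dFs by fastforce
    next
      \<comment> \<open>A peeled flow differs from \<open>F\<close> on a single path, which adds at
        most \<open>card V\<close> to the distance of \<open>F\<close> from the reference.\<close>
      case False
      then have G: "G \<in> set Os" using G by (simp add: L)
      have "disagreement H (\<lambda>e. fl G (eid e)) (\<lambda>e. fl F (eid e)) =
        length (filter (\<lambda>e. fl G (eid e) \<noteq> fl F (eid e)) F)"
        unfolding disagreement_def filt[of "\<lambda>i. fl G i \<noteq> fl F i"] eids ..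
      also have "\<dots> = length (filter (\<lambda>e. fl G (eid e) \<noteq> flo e) F)"
        by (intro arg_cong[where f = length] filter_cong) (auto simp: fl_eid[OF dF])
      also have "\<dots> \<le> ?n" using Os(2) G by blast
      finally have "disagreement H (\<lambda>e. fl G (eid e)) (\<lambda>e. fl F (eid e)) \<le> ?n" .
      moreover have "disagreement H ?b (\<lambda>e. fl F (eid e)) \<le> 5 * ?n"
        using dFs[of F] F disagreement_commute[of H ?b] by simp
      ultimately show ?thesis
        using disagreement_triangle[of H "\<lambda>e. fl G (eid e)" ?b "\<lambda>e. fl F (eid e)"] by linarith
    qed
    show "\<forall>G \<in> set L. \<forall>G' \<in> set L.
      length (filter (\<lambda>e. fl G (eid e) \<noteq> fl G' (eid e)) N) \<le> 12 * ?n"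
    proof (intro ballI)
      fix G G' assume G: "G \<in> set L" "G' \<in> set L"
      have "disagreement H (\<lambda>e. fl G (eid e)) (\<lambda>e. fl G' (eid e)) \<le> 12 * ?n"
        using disagreement_triangle[of H "\<lambda>e. fl G (eid e)" "\<lambda>e. fl G' (eid e)" ?b]
          dL[OF G(1)] dL[OF G(2)] by linarith
      then show "length (filter (\<lambda>e. fl G (eid e) \<noteq> fl G' (eid e)) N) \<le> 12 * ?n"
        unfolding disagreement_def filt[of "\<lambda>i. fl G i \<noteq> fl G' i"] eids .
    qed
  qed
qed

section \<open>Flows of digraphs\<close>

lemma sum_in_arcs:
  "finite (arcs G) \<Longrightarrow> (\<Sum>e \<in> in_arcs G v. f e) = (\<Sum>e \<in> arcs G. if head G e = v then f e else 0)"
  by (simp add: in_arcs_def sum.inter_filter)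

lemma sum_out_arcs:
  "finite (arcs G) \<Longrightarrow> (\<Sum>e \<in> out_arcs G v. f e) = (\<Sum>e \<in> arcs G. if tail G e = v then f e else 0)"
  by (simp add: out_arcs_def sum.inter_filter)

text \<open>Weak duality once more, now for real-valued flows of the digraph, since
  \<open>st_max_flow\<close> compares with all of these. The net flow out of each vertex is summed
  over \<open>U\<close>.\<close>

lemma flow_value_le_cut:
  assumes "fin_digraph G" "st_flow G s t f" "U \<subseteq> verts G" "s \<in> U" "t \<notin> U"
  shows "flow_value G s f \<le> (\<Sum>e \<in> {e \<in> arcs G. tail G e \<in> U \<and> head G e \<notin> U}. f e)"
proof -
  interpret fin_digraph G by fact
  let ?net = "\<lambda>v. (\<Sum>e \<in> out_arcs G v. f e) - (\<Sum>e \<in> in_arcs G v. f e)"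
  have finU: "finite U" using assms(3) finite_verts by (rule finite_subset)
  have "?net v = 0" if "v \<in> U - {s}" for v
  proof -
    have "v \<in> verts G - {s, t}" using assms(3,5) that by auto
    then show ?thesis using assms(2) by (simp add: st_flow_def)
  qed
  then have "(\<Sum>v \<in> U. ?net v) = ?net s"
    using sum.remove[OF finU assms(4), of ?net] by simp
  then have "flow_value G s f = (\<Sum>v \<in> U. ?net v)" by (simp add: flow_value_def)
  also have "\<dots> = (\<Sum>v \<in> U. \<Sum>e \<in> arcs G. (if tail G e = v then f e else 0) - (if head G e = v then f e else 0))"
    by (simp add: sum_in_arcs sum_out_arcs sum_subtractf)
  also have "\<dots> = (\<Sum>e \<in> arcs G. \<Sum>v \<in> U. (if tail G e = v then f e else 0) - (if head G e = v then f e else 0))"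
    by (rule sum.swap)
  also have "\<dots> = (\<Sum>e \<in> arcs G. (if tail G e \<in> U then f e else 0) - (if head G e \<in> U then f e else 0))"
    using finU by (simp add: sum_subtractf)
  also have "\<dots> \<le> (\<Sum>e \<in> arcs G. if tail G e \<in> U \<and> head G e \<notin> U then f e else 0)"
    using assms(2) by (intro sum_mono) (auto simp: st_flow_def)
  also have "\<dots> = (\<Sum>e \<in> {e \<in> arcs G. tail G e \<in> U \<and> head G e \<notin> U}. f e)"
    by (simp add: sum.inter_filter)
  finally show ?thesis .
qed

lemma st_flow_del_arc:
  assumes "fin_digraph G" "e \<in> arcs G"
  shows "st_flow (pre_digraph.del_arc G e) s t f \<longleftrightarrow> st_flow G s t f \<and> f e = 0"
    and "f e = 0 \<Longrightarrow> flow_value (pre_digraph.del_arc G e) s f = flow_value G s f"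
proof -
  interpret fin_digraph G by fact
  have "(\<Sum>x \<in> in_arcs (del_arc e) v. f x) = (\<Sum>x \<in> in_arcs G v. f x)"
    "(\<Sum>x \<in> out_arcs (del_arc e) v. f x) = (\<Sum>x \<in> out_arcs G v. f x)" if "f e = 0" for v
    using that by (auto intro!: sum.mono_neutral_left)
  then show "flow_value (del_arc e) s f = flow_value G s f" if "f e = 0"
    using that by (simp add: flow_value_def)
  show "st_flow (del_arc e) s t f \<longleftrightarrow> st_flow G s t f \<and> f e = 0"
  proof (cases "f e = 0")
    case True
    have "(\<forall>x \<in> arcs (del_arc e). 0 \<le> f x \<and> f x \<le> 1) \<longleftrightarrow> (\<forall>x \<in> arcs G. 0 \<le> f x \<and> f x \<le> 1)"
      "(\<forall>x. x \<notin> arcs (del_arc e) \<longrightarrow> f x = 0) \<longleftrightarrow> (\<forall>x. x \<notin> arcs G \<longrightarrow> f x = 0)"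
      using True by auto
    then show ?thesis
      using True \<open>\<And>v. f e = 0 \<Longrightarrow> (\<Sum>x \<in> in_arcs (del_arc e) v. f x) = (\<Sum>x \<in> in_arcs G v. f x)\<close>
        \<open>\<And>v. f e = 0 \<Longrightarrow> (\<Sum>x \<in> out_arcs (del_arc e) v. f x) = (\<Sum>x \<in> out_arcs G v. f x)\<close>
      by (simp add: st_flow_def)
  next
    case False
    then show ?thesis by (auto simp: st_flow_def)
  qed
qed

section \<open>Translation between digraphs and networks\<close>

locale presented_digraph = fin_digraph G
  for G :: "('v, 'e) pre_digraph" and num :: "'v \<Rightarrow> nat" and es :: "'e list" and s t :: 'v +
  assumes presentation: "graph_presentation G num es"
    and terminals: "s \<in> verts G" "t \<in> verts G" "s \<noteq> t"
begin

definition endpoints :: "(nat \<times> nat) list" where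
  "endpoints = map (\<lambda>e. (num (tail G e), num (head G e))) es"

text \<open>Arcs and entries correspond by their position in \<open>es\<close>.\<close>

definition entry_of :: "'e \<Rightarrow> entry" where
  "entry_of x = the (map_of (zip es (network endpoints)) x)"

definition flow_of :: "entry list \<Rightarrow> 'e \<Rightarrow> real" where
  "flow_of L x = (if x \<in> arcs G then real (fl L (eid (entry_of x))) else 0)"

lemma num_inj: "u \<in> verts G \<Longrightarrow> v \<in> verts G \<Longrightarrow> num u = num v \<longleftrightarrow> u = v"
  using presentation by (auto simp: graph_presentation_def bij_betw_def inj_on_def)

lemma num_less: "v \<in> verts G \<Longrightarrow> num v < card (verts G)"
  using presentation by (auto simp: graph_presentation_def bij_betw_def)

lemma es: "distinct es" "set es = arcs G"
  using presentation by (auto simp: graph_presentation_def)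

lemma map_entry_of: "map entry_of es = network endpoints"
proof -
  have len: "length (network endpoints) = length es"
    using arg_cong[OF network_props(2)[of endpoints], of length] by (simp add: endpoints_def)
  then have "map_of (zip es (network endpoints)) (es ! i) = Some (network endpoints ! i)"
    if "i < length es" for i
    using map_of_zip_nth[OF len[symmetric] es(1)] that by simp
  then show ?thesis
    using len by (intro nth_equalityI) (auto simp: entry_of_def)
qed

lemma entry_of:
  assumes "x \<in> arcs G"
  shows "entry_of x \<in> set (network endpoints)" "src (entry_of x) = num (tail G x)"
    "dst (entry_of x) = num (head G x)"
proof -
  have "map (\<lambda>x. (src (entry_of x), dst (entry_of x))) es =
      map (\<lambda>e. (src e, dst e)) (network endpoints)"
    unfolding map_entry_of[symmetric] by (simp add: comp_def)
  also have "\<dots> = map (\<lambda>e. (num (tail G e), num (head G e))) es"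
    unfolding network_props(2) endpoints_def ..
  finally show "src (entry_of x) = num (tail G x)" "dst (entry_of x) = num (head G x)"
    using assms es(2) by (auto simp: map_eq_conv)
  show "entry_of x \<in> set (network endpoints)"
    using assms es(2) unfolding map_entry_of[symmetric] by simp
qed

lemma over_network: "over {..<card (verts G)} (network endpoints)"
  unfolding over_def map_entry_of[symmetric] using entry_of es(2) num_less wellformed by auto

lemma sum_list_network:
  "(\<Sum>e\<leftarrow>network endpoints. g e) = (\<Sum>x \<in> arcs G. g (entry_of x))"
  unfolding map_entry_of[symmetric]
  using es by (simp add: comp_def sum_list_distinct_conv_sum_set)

lemma sum_flow_of:
  assumes "map ends L = map ends (network endpoints)"
  shows "(\<Sum>x \<in> arcs G. (real_of_int (\<pi> (num (head G x))) - real_of_int (\<pi> (num (tail G x)))) * flow_of L x)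
    = real_of_int (wsum (\<lambda>u v. \<pi> v - \<pi> u) L)"
  unfolding wsum_ends[OF assms network_props(1)] sum_list_network of_int_sum
  by (intro sum.cong) (auto simp: flow_of_def entry_of)

text \<open>The potential that is 1 at \<open>v\<close> alone turns the potential sum into inflow
  minus outflow at \<open>v\<close>.\<close>

lemma net_flow_of:
  assumes "map ends L = map ends (network endpoints)" "v \<in> verts G" "is_flow (num s) (num t) L F"
  shows "(\<Sum>e \<in> in_arcs G v. flow_of L e) - (\<Sum>e \<in> out_arcs G v. flow_of L e) =
    real_of_int F * (of_bool (t = v) - of_bool (s = v))"
proof -
  let ?\<pi> = "\<lambda>u. of_bool (u = num v) :: int"
  have "(\<Sum>e \<in> in_arcs G v. flow_of L e) - (\<Sum>e \<in> out_arcs G v. flow_of L e) =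
    (\<Sum>x \<in> arcs G. (real_of_int (?\<pi> (num (head G x))) - real_of_int (?\<pi> (num (tail G x)))) * flow_of L x)"
    unfolding sum_in_arcs[OF finite_arcs] sum_out_arcs[OF finite_arcs] sum_subtractf[symmetric]
    using assms(2) wellformed by (intro sum.cong) (auto simp: num_inj)
  also have "\<dots> = real_of_int (F * (?\<pi> (num t) - ?\<pi> (num s)))"
    using sum_flow_of[OF assms(1), of ?\<pi>] assms(3)[unfolded is_flow_def, rule_format, of ?\<pi>]
    by (simp only:)
  also have "\<dots> = real_of_int F * (of_bool (t = v) - of_bool (s = v))"
    using assms(2) terminals by (simp add: num_inj)
  finally show ?thesis .
qed

lemma st_flow_flow_of:
  assumes "map ends L = map ends (network endpoints)" "\<forall>e \<in> set L. flo e \<le> 1"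
    "is_flow (num s) (num t) L F"
  shows "st_flow G s t (flow_of L)" "flow_value G s (flow_of L) = real_of_int F"
proof -
  have dL: "distinct (map eid L)" using ends_eid[OF assms(1)] network_props(1) by simp
  have "fl L (eid (entry_of x)) \<le> 1" if x: "x \<in> arcs G" for x
  proof -
    obtain l where l: "l \<in> set L" "eid l = eid (entry_of x)"
      using ends_corresponding[OF assms(1) entry_of(1)[OF x]] by metis
    then show ?thesis using fl_eid[OF dL l(1)] assms(2) by simp
  qed
  then have "\<forall>x \<in> arcs G. 0 \<le> flow_of L x \<and> flow_of L x \<le> 1" by (simp add: flow_of_def)
  moreover have "(\<Sum>e \<in> in_arcs G v. flow_of L e) = (\<Sum>e \<in> out_arcs G v. flow_of L e)"
    if "v \<in> verts G - {s, t}" for v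
    using net_flow_of[OF assms(1) _ assms(3), of v] that by auto
  ultimately show "st_flow G s t (flow_of L)" by (simp add: st_flow_def flow_of_def)
  show "flow_value G s (flow_of L) = real_of_int F"
    using net_flow_of[OF assms(1) terminals(1) assms(3)] terminals(3) by (auto simp: flow_value_def)
qed

text \<open>The second bound is the one for flows of \<open>G - x\<close>: an arc of the cut without
  flow lowers its contribution by 1.\<close>

lemma cut_bound:
  assumes "num s \<in> S" "num t \<notin> S" "st_flow G s t f"
  shows "flow_value G s f \<le> real (outcap S (network endpoints))"
    and "x \<in> arcs G \<Longrightarrow> leaving S (entry_of x) \<Longrightarrow> f x = 0 \<Longrightarrow>
      flow_value G s f \<le> real (outcap S (network endpoints)) - 1"
proof -
  let ?U = "{v \<in> verts G. num v \<in> S}"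
  let ?C = "{x \<in> arcs G. leaving S (entry_of x)}"
  have "{x \<in> arcs G. tail G x \<in> ?U \<and> head G x \<notin> ?U} = ?C"
    using wellformed by (auto simp: leaving_def entry_of)
  then have le: "flow_value G s f \<le> (\<Sum>x \<in> ?C. f x)"
    using flow_value_le_cut[OF fin_digraph_axioms assms(3), of ?U] assms(1,2) terminals by auto
  have "outcap S (network endpoints) = (\<Sum>x \<in> arcs G. if leaving S (entry_of x) then 1 else 0)"
    unfolding outcap_def sum_list_network
    using network_props(3) entry_of(1) by (intro sum.cong) auto
  then have out: "outcap S (network endpoints) = card ?C" by (simp add: sum.If_cases Int_def)
  have bound: "(\<Sum>x \<in> A. f x) \<le> real (card A)" if "A \<subseteq> arcs G" for A
    using sum_bounded_above[of A f 1] assms(3) that by (auto simp: st_flow_def)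
  show "flow_value G s f \<le> real (outcap S (network endpoints))"
    using le bound[of ?C] by (simp add: out)
  show "flow_value G s f \<le> real (outcap S (network endpoints)) - 1"
    if x: "x \<in> arcs G" "leaving S (entry_of x)" "f x = 0"
  proof -
    have "(\<Sum>x \<in> ?C. f x) = (\<Sum>x \<in> ?C - {x}. f x)"
      using x by (simp add: sum.remove[of ?C x])
    also have "\<dots> \<le> real (card (?C - {x}))" by (rule bound) auto
    also have "\<dots> = real (card ?C) - 1"
      using x card_Suc_Diff1[of ?C x] by simp
    finally show ?thesis using le by (simp add: out)
  qed
qed

lemma max_flow_del_arc:
  assumes "x \<in> arcs G" "st_flow G s t f" "f x = 0"
    "\<And>g. st_flow G s t g \<Longrightarrow> g x = 0 \<Longrightarrow> flow_value G s g \<le> flow_value G s f"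
  shows "st_max_flow (del_arc x) s t f"
  unfolding st_max_flow_def
  using assms st_flow_del_arc[OF fin_digraph_axioms assms(1)] by auto

lemma card_disagreement:
  "card {x \<in> arcs G. flow_of L x \<noteq> flow_of L' x} =
    length (filter (\<lambda>e. fl L (eid e) \<noteq> fl L' (eid e)) (network endpoints))"
proof -
  have "{x \<in> arcs G. flow_of L x \<noteq> flow_of L' x} =
      set (filter (\<lambda>x. fl L (eid (entry_of x)) \<noteq> fl L' (eid (entry_of x))) es)"
    using es(2) by (auto simp: flow_of_def)
  then show ?thesis
    using distinct_card[OF distinct_filter[OF es(1)]]
    unfolding map_entry_of[symmetric] by (simp add: filter_map comp_def)
qed

lemma fractions_of_flow_flow_of:
  assumes "map ends L = map ends (network endpoints)"
  shows "fractions_of_flow es (flow_of L) (map (\<lambda>e. (flo e, 1)) L)"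
proof -
  have dL: "distinct (map eid L)" using ends_eid[OF assms] network_props(1) by simp
  have "map flo L = map (fl L) (map eid L)" using fl_eid[OF dL] by simp
  also have "map eid L = map (\<lambda>x. eid (entry_of x)) es"
    unfolding ends_eid[OF assms] map_entry_of[symmetric] by simp
  finally have flo: "map flo L = map (fl L) (map (\<lambda>x. eid (entry_of x)) es)" .
  have "map (\<lambda>e. (flo e, 1::nat)) L = map (\<lambda>c. (c, 1)) (map flo L)" by simp
  also have "\<dots> = map (\<lambda>x. (fl L (eid (entry_of x)), 1)) es" unfolding flo by simp
  finally have eq: "map (\<lambda>e. (flo e, 1::nat)) L = map (\<lambda>x. (fl L (eid (entry_of x)), 1)) es" .
  show ?thesis
    unfolding fractions_of_flow_def eq list_all2_map2
    by (intro list.rel_refl_strong) (auto simp: flow_of_def es(2))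
qed

lemma enc_instance_repr:
  "enc_instance G num es s t = repr (card (verts G), endpoints, num s, num t)"
proof -
  have "enc_list (\<lambda>e. Node (enc_nat (num (tail G e))) (enc_nat (num (head G e)))) xs =
    repr (map (\<lambda>e. (num (tail G e), num (head G e))) xs)" for xs
    by (induction xs) (simp_all add: repr_nat_def)
  then show ?thesis by (simp add: enc_instance_def endpoints_def repr_nat_def)
qed

lemma rsize_instance:
  "rsize (card (verts G), endpoints, num s, num t) \<le> (card (verts G) + card (arcs G) + 2) ^ 2"
proof -
  let ?n = "card (verts G)" and ?m = "card (arcs G)"
  have "length endpoints = ?m"
    using distinct_card[OF es(1)] es(2) by (simp add: endpoints_def)
  moreover have "rsize e \<le> 2 * ?n + 1" if "e \<in> set endpoints" for e
  proof -
    obtain x where x: "x \<in> arcs G" "e = (num (tail G x), num (head G x))"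
      using \<open>e \<in> set endpoints\<close> es(2) by (auto simp: endpoints_def)
    have "num (tail G x) < ?n" "num (head G x) < ?n" using num_less wellformed x(1) by auto
    then show ?thesis by (simp add: x(2))
  qed
  ultimately have "rsize endpoints \<le> ?m * Suc (2 * ?n + 1)" using rsize_list_le by metis
  moreover have "num s \<le> ?n" "num t \<le> ?n" using num_less terminals by (simp_all add: less_imp_le)
  ultimately have "rsize (?n, endpoints, num s, num t) \<le> ?m * (2 * ?n + 2) + 3 * ?n + 3" by simp
  also have "\<dots> \<le> (?n + ?m + 2) ^ 2" by (simp add: power2_eq_square algebra_simps)
  finally show ?thesis .
qed

theorem flows_correct:
  assumes "st_max_flow G s t f" "flow_value G s f = lam"
  defines "L \<equiv> fault_tolerant_flows (card (verts G), endpoints, num s, num t)"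
  defines "B \<equiv> map flow_of L"
  shows "encodes_flows es B (repr (solve (card (verts G), endpoints, num s, num t)))"
    "real (length B) = 2 * lam + 1" "\<forall>f \<in> set B. st_flow G s t f"
    "\<forall>e \<in> arcs G. \<exists>f \<in> set B. st_max_flow (del_arc e) s t f"
    "\<forall>f \<in> set B. \<forall>f' \<in> set B. real (card {x \<in> arcs G. f x \<noteq> f' x}) \<le> 12 * real (card (verts G))"
proof -
  have st: "num s \<in> {..<card (verts G)}" "num t \<in> {..<card (verts G)}" "num s \<noteq> num t"
    using num_less terminals num_inj by auto
  let ?N = "network endpoints"
  obtain k S where S: "num s \<in> S" "num t \<notin> S" "outcap S ?N = k" and len: "length L = 2 * k + 1"
    and ends: "\<forall>A \<in> set L. map ends A = map ends ?N \<and> (\<forall>e \<in> set A. flo e \<le> 1) \<and>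
      (\<exists>v. is_flow (num s) (num t) A v)"
    and ex: "\<exists>A \<in> set L. is_flow (num s) (num t) A (int k)"
    and cover: "\<forall>e \<in> set ?N. (\<exists>A \<in> set L. fl A (eid e) = 0 \<and> is_flow (num s) (num t) A (int k)) \<or>
      (\<exists>S. num s \<in> S \<and> num t \<notin> S \<and> leaving S e \<and> outcap S ?N = k \<and>
        (\<exists>A \<in> set L. fl A (eid e) = 0 \<and> is_flow (num s) (num t) A (int k - 1)))"
    and dis: "\<forall>A \<in> set L. \<forall>A' \<in> set L.
      length (filter (\<lambda>e. fl A (eid e) \<noteq> fl A' (eid e)) ?N) \<le> 12 * card (verts G)"
    by (rule fault_tolerant_flows_correct[OF over_network finite_lessThan st,
          unfolded card_lessThan, folded L_def])
  have flows: "st_flow G s t (flow_of A)" if "A \<in> set L" for A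
    using st_flow_flow_of(1) ends that by blast
  have val: "flow_value G s (flow_of A) = real_of_int F"
    if "A \<in> set L" "is_flow (num s) (num t) A F" for A F
    using st_flow_flow_of(2) ends that by blast
  obtain A0 where A0: "A0 \<in> set L" "is_flow (num s) (num t) A0 (int k)" using ex by blast
  have "real k \<le> lam"
    using assms(1,2) flows[OF A0(1)] val[OF A0] unfolding st_max_flow_def by auto
  moreover have "lam \<le> real k"
    using cut_bound(1)[OF S(1,2)] assms(1,2) S(3) unfolding st_max_flow_def by auto
  ultimately have lam: "lam = real k" by simp
  show "real (length B) = 2 * lam + 1" by (simp add: B_def len lam)
  show "\<forall>f \<in> set B. st_flow G s t f" using flows by (auto simp: B_def)
  show "\<forall>f \<in> set B. \<forall>f' \<in> set B.
      real (card {x \<in> arcs G. f x \<noteq> f' x}) \<le> 12 * real (card (verts G))"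
  proof -
    have "real (card {x \<in> arcs G. flow_of A x \<noteq> flow_of A' x}) \<le> 12 * real (card (verts G))"
      if "A \<in> set L" "A' \<in> set L" for A A'
    proof -
      have "card {x \<in> arcs G. flow_of A x \<noteq> flow_of A' x} \<le> 12 * card (verts G)"
        unfolding card_disagreement using dis that by blast
      then show ?thesis by linarith
    qed
    then show ?thesis by (simp add: B_def)
  qed
  show "\<forall>x \<in> arcs G. \<exists>f \<in> set B. st_max_flow (del_arc x) s t f"
  proof
    fix x assume x: "x \<in> arcs G"
    have "\<exists>A \<in> set L. st_max_flow (del_arc x) s t (flow_of A)"
      using cover[rule_format, OF entry_of(1)[OF x]]
    proof (elim disjE exE conjE bexE)
      fix A assume A: "A \<in> set L" "fl A (eid (entry_of x)) = 0" "is_flow (num s) (num t) A (int k)"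
      have "st_max_flow (del_arc x) s t (flow_of A)"
      proof (rule max_flow_del_arc[OF x flows[OF A(1)]])
        show "flow_of A x = 0" using A(2) by (simp add: flow_of_def)
        show "flow_value G s g \<le> flow_value G s (flow_of A)" if "st_flow G s t g" for g
          using cut_bound(1)[OF S(1,2) that] val[OF A(1,3)] S(3) by simp
      qed
      then show ?thesis using A(1) by blast
    next
      fix S' A assume S': "num s \<in> S'" "num t \<notin> S'" "leaving S' (entry_of x)" "outcap S' ?N = k"
        and A: "A \<in> set L" "fl A (eid (entry_of x)) = 0" "is_flow (num s) (num t) A (int k - 1)"
      have "st_max_flow (del_arc x) s t (flow_of A)"
      proof (rule max_flow_del_arc[OF x flows[OF A(1)]])
        show "flow_of A x = 0" using A(2) by (simp add: flow_of_def)
        show "flow_value G s g \<le> flow_value G s (flow_of A)" if "st_flow G s t g" "g x = 0" for g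
          using cut_bound(2)[OF S'(1,2) that(1) x S'(3) that(2)] val[OF A(1,3)] S'(4) by simp
      qed
      then show ?thesis using A(1) by blast
    qed
    then show "\<exists>f \<in> set B. st_max_flow (del_arc x) s t f" by (auto simp: B_def)
  qed
  have "list_all2 (fractions_of_flow es) B (map (map (\<lambda>e. (flo e, 1))) L)"
    unfolding B_def list_all2_map1 list_all2_map2
    using ends fractions_of_flow_flow_of by (intro list.rel_refl_strong) blast
  moreover have "repr (solve (card (verts G), endpoints, num s, num t)) =
      enc_list (enc_list (enc_pair enc_nat enc_nat)) (map (map (\<lambda>e. (flo e, 1))) L)"
    by (simp add: solve_def L_def repr_list_def repr_prod_def repr_nat_def)
  ultimately show "encodes_flows es B (repr (solve (card (verts G), endpoints, num s, num t)))"
    unfolding encodes_flows_def by blast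
qed

end

section \<open>The final program and its running time\<close>

text \<open>\<open>runs\<close> starts with the first function, so a body that calls the desired one
  is put in front. The two calls cost 4 units each.\<close>

lemma ptime_runs:
  assumes "ptime f"
  obtains P c where "\<And>x. \<exists>k \<le> (rsize x + 2) ^ c + 8. runs P (repr x) (repr (f x)) k"
proof -
  obtain P i c where P: "realizes P i f c" using assms unfolding ptime_def by blast
  let ?main = "Call (1 + i) [Var 0]"
  let ?Q = "[?main] @ map (shift (length [?main])) P @ []"
  have Q: "realizes ?Q (1 + i) f c"
    using realizes_shift[OF P, of "[?main]" "[]"] by simp
  have "\<exists>k \<le> (rsize x + 2) ^ c + 8. runs ?Q (repr x) (repr (f x)) k" for x
  proof -
    obtain k where k: "k \<le> (rsize x + 2) ^ c + 4" "eval ?Q [repr x] ?main (repr (f x)) k"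
      using realizes_call0[OF Q, of x "[]"] by blast
    have "eval ?Q [repr x] (Call 0 [Var 0]) (repr (f x)) ((1 + 1 + 1) + k + 1)"
      using eval_evals.Call[OF eval_evals.More[OF eval_Var0 eval_evals.Empty], of 0 ?Q] k(2) by simp
    then show ?thesis
      using k(1) unfolding runs_def by (intro exI[of _ "(1 + 1 + 1) + k + 1"]) simp
  qed
  then show thesis by (rule that)
qed

theorem theorem8:
  shows "\<exists>(P :: program) (p :: nat poly) (C :: real).
    \<forall>(G :: ('v, 'e) pre_digraph) num es s t (lam :: real).
      fin_digraph G \<and> graph_presentation G num es \<and>
      s \<in> verts G \<and> t \<in> verts G \<and> s \<noteq> t \<and>
      (\<exists>f. st_max_flow G s t f \<and> flow_value G s f = lam) \<longrightarrow>
      (\<exists>(B :: ('e \<Rightarrow> real) list) out k.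
        runs P (enc_instance G num es s t) out k \<and>
        k \<le> poly p (card (verts G) + card (arcs G)) \<and>
        encodes_flows es B out \<and>
        real (length B) = 2 * lam + 1 \<and>
        (\<forall>f \<in> set B. st_flow G s t f) \<and>
        (\<forall>e \<in> arcs G. \<exists>f \<in> set B. st_max_flow (pre_digraph.del_arc G e) s t f) \<and>
        (\<forall>f \<in> set B. \<forall>f' \<in> set B.
           real (card {x \<in> arcs G. f x \<noteq> f' x}) \<le> C * real (card (verts G))))"
proof -
  obtain P c where P: "\<And>x. \<exists>k \<le> (rsize x + 2) ^ c + 8. runs P (repr x) (repr (solve x)) k"
    using ptime_runs[OF ptime_solve] by blast
  \<comment> \<open>\<open>[:2, 1:] ^ 2\<close> is the bound of \<open>rsize_instance\<close> on the
    size of the input; the rest is the time bound of \<open>P\<close> at that size.\<close>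
  let ?p = "([:2, 1:] ^ 2 + [:2:]) ^ c + [:8:] :: nat poly"
  show ?thesis
  proof (intro exI[of _ P] exI[of _ ?p] exI[of _ "12 :: real"] allI impI)
    fix G :: "('v, 'e) pre_digraph" and num es s t and lam :: real
    assume asm: "fin_digraph G \<and> graph_presentation G num es \<and>
      s \<in> verts G \<and> t \<in> verts G \<and> s \<noteq> t \<and>
      (\<exists>f. st_max_flow G s t f \<and> flow_value G s f = lam)"
    then interpret presented_digraph G num es s t
      by (simp add: presented_digraph_def presented_digraph_axioms_def)
    obtain f where f: "st_max_flow G s t f" "flow_value G s f = lam" using asm by blast
    let ?I = "(card (verts G), endpoints, num s, num t)"
    obtain k where k: "k \<le> (rsize ?I + 2) ^ c + 8" "runs P (repr ?I) (repr (solve ?I)) k"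
      using P by blast
    have "(rsize ?I + 2) ^ c \<le> ((card (verts G) + card (arcs G) + 2) ^ 2 + 2) ^ c"
      using rsize_instance by (intro power_mono) auto
    also have "\<dots> + 8 = poly ?p (card (verts G) + card (arcs G))"
      by (simp add: poly_power add.commute)
    finally have "k \<le> poly ?p (card (verts G) + card (arcs G))" using k(1) by simp
    then show "\<exists>(B :: ('e \<Rightarrow> real) list) out k.
        runs P (enc_instance G num es s t) out k \<and>
        k \<le> poly ?p (card (verts G) + card (arcs G)) \<and>
        encodes_flows es B out \<and>
        real (length B) = 2 * lam + 1 \<and>
        (\<forall>f \<in> set B. st_flow G s t f) \<and>
        (\<forall>e \<in> arcs G. \<exists>f \<in> set B. st_max_flow (pre_digraph.del_arc G e) s t f) \<and>
        (\<forall>f \<in> set B. \<forall>f' \<in> set B.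
           real (card {x \<in> arcs G. f x \<noteq> f' x}) \<le> 12 * real (card (verts G)))"
      using flows_correct[OF f] k(2) unfolding enc_instance_repr by blast
  qed
qed

end
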